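(* Fix a player $i$ and suppose each opponent $k\neq i$ uses a noise-state linear strategy with deterministic impulse-response maps (as part of a fixed baseline noise-state linear profile), which pins down a deterministic forward environment: the state impulse response $X_t(u)$, the filtering objects $(P^k,\widetilde X^k,F^k)$, and the policy kernels $D^k_t(u)$. Then there exist linear processes (in the extended sense) $H^{X,i}_t$ and $H^{k,i}_t(u)$, $k\ne i$, $0\le u\le t$, such that, defining for each $k\neq i$ $$\mathcal V^{k,i}_t:=\Gamma^k(t)^\top E^kH^{k,i}_t(t)+P^k(t)\int_0^t\widetilde X^k_t(z)\,H^{k,i}_t(z)\,dz,\qquad \mathcal V^i_t:=\sum_{k\ne i}\mathcal V^{k,i}_t,$$ one has $$\frac{d}{dt}H^{X,i}_t=-\bigl(G^{XX,i}(t)X_t+G^{X,i}_t\bigr)-A(t)^\top H^{X,i}_t-\mathcal V^i_t,$$ $$\frac{d}{dt}H^{k,i}_t(u)=-\bigl(D^k_t(u)\bigr)^\top H^{X,i}_t+X_t(u)^\top\mathcal V^{k,i}_t,\qquad k\neq i,$$ with terminal conditions $H^{X,i}_T=G^{XX,i}(T)X_T+G^{X,i}_T$ and $H^{k,i}_T(\cdot)=0$. All coefficients $P^k(t)$, $\widetilde X^k_t(z)$, $D^k_t(u)$, $X_t(u)$ in this system are determined by the frozen strategy maps (including the frozen filters) and do not change when player $i$ deviates.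
   Context: **Game.** There are $n$ players on $[0,T]$. $W=(W^0,\dots,W^n)$ consists of mutually independent $d$-dimensional Brownian motions. The state $X_t\in\mathbb{R}^d$ satisfies $dX_t=(A(t)X_t+\sum_{j=1}^nD^j_t)\,dt+\Sigma(t)\,dW^0_t$, $X_0=x_0$, with $A,\Sigma$ deterministic and bounded, and $D^j_t\in\mathbb{R}^d$ player $j$'s control. Player $j$ observes $dY^j_t=\Gamma^j(t)X_t\,dt+E^j\,dW_t$, $Y^j_0=0$, with $\Gamma^j(t)\in\mathbb{R}^{d\times d}$ deterministic and $E^j\in\mathbb{R}^{d\times(n+1)d}$ the selector $E^jW=W^j$; $P^j=\Gamma^{j\top}\Gamma^j$, $\Pi^j=E^{j\top}E^j$, $\mathcal{F}^j_t=\sigma(Y^j_s:s\le t)$. Player $i$ minimizes $$J^i(D^i;D^{-i})=\mathbb{E}\Big[\int_0^T\big(X_t^\top G^{XX,i}(t)X_t+2(G^{X,i}_t)^\top X_t+G^i(t)+(D^i_t)^\top G^{DD,i}(t)D^i_t\big)dt+X_T^\top G^{XX,i}(T)X_T+2(G^{X,i}_T)^\top X_T\Big],$$ with $G^{XX,i}(t),G^{DD,i}(t)$ deterministic symmetric positive semidefinite, $G^{DD,i}(t)$ positive definite, and $G^{X,i}_t$ deterministic and bounded (more generally $G^{X,i}_t=\bar G^{X,i}_t+\int_0^tG^{X,i}_t(r)\,dW_r$ with deterministic mean and kernel). **Linear processes.** A linear process is an $L^2$ process $L_t=\bar L(t)+\int_0^tL(t,s)\,dW_s$ with deterministic $\bar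 L$ and $L(t,\cdot)\in L^2$. In the extended sense, kernels with $s>t$ are allowed: $L_t=\bar L(t)+\int_0^TL(t,s)\,dW_s$. **Noise-state linear strategies and frozen filters.** On a profile, $\widehat W^k_t(u)=\mathbb{E}[W_u\mid\mathcal{F}^k_t]$, $0\le u\le t$. A noise-state linear strategy is a map $D^k_t[Y^k]=\bar D^k_t+\int_0^tD^k_t(u)\,d_u\widehat W^k_t[Y^k](u)$ with deterministic $\bar D^k_t\in\mathbb{R}^d$, $D^k_t(u)\in\mathbb{R}^{d\times(n+1)d}$, $\int_0^t\|D^k_t(u)\|^2du<\infty$, $D^k_t(u)=0$ for $u>t$. On the baseline profile $X_t=\bar X_t+\int_0^tX_t(s)\,dW_s$ with deterministic mean and kernel (the state impulse response), and $\widetilde X^k_t(u)$ is the kernel of $X_t-\mathbb{E}[X_t\mid\mathcal{F}^k_t]=\int_0^t\widetilde X^k_t(u)\,dW_u$. The filtering kernel $F^k$ is the deterministic kernel with $d_u\widehat W^k_t(u)=\Pi^kdW_u+(\int_0^tF^k_t(u,s)\,dW_s)\,du$. The functional $\widehat W^k[Y^k]$ is the linear-Gaussian filter of the baseline profile applied to the realized history: $d_u\widehat W^k_t(u)=E^{k\top}dI^k_u+\big(\int_u^t\widetilde X^k_s(u)^\top\Gamma^k(s)^\top dI^k_s\big)du$, with $dI^k_t=dY^k_t-\Gamma^k(t)\widehat X^k_t\,dt$ and $\widehat X^k_t=\bar X_t+\int_0^tX_t(u)\,d_u\widehat W^k_t(u)$. When player $i$ deviates, the opponents' strategy maps and filters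 are not recomputed; they are applied to the deviated signal paths. In the backward system, $X_t$ is the state process, $X_t(u)$ is the baseline impulse-response kernel, and $H^{k,i}_t(t)$ is the right-boundary value ($u=t$) of $u\mapsto H^{k,i}_t(u)\in\mathbb{R}^{(n+1)d}$. The deterministic coefficients $A,\Gamma^k,P^k,\widetilde X^k,D^k,X(\cdot,\cdot)$ of the linearized system are bounded. *)

theory Defs
  imports "HOL-Probability.Probability"
begin

section \<open>Noise and Wiener integrals\<close>

text \<open>
  The players are the elements of the finite type \<open>'p\<close>, the state space is \<open>real^'d\<close>, and the
  driving noise \<open>W = (W\<^sup>0, \<dots>, W\<^sup>n)\<close> takes values in \<open>real^('p option \<times> 'd)\<close>, a space of
  dimension \<open>(n+1)d\<close>: the coordinates \<open>(None, _)\<close> make up \<open>W\<^sup>0\<close> and \<open>(Some j, _)\<close> make up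
  \<open>W\<^sup>j\<close>. The matrix \<open>noise_sel (Some j)\<close> is the selector \<open>E\<^sup>j\<close>.
\<close>

definition noise_sel :: "'p option \<Rightarrow> real^('p::finite option \<times> 'd::finite)^'d" where
  "noise_sel j = (\<chi> a c. if c = (j, a) then 1 else 0)"

definition noise_proj :: "'p \<Rightarrow> real^('p::finite option \<times> 'd::finite)^('p option \<times> 'd)" where
  "noise_proj k = transpose (noise_sel (Some k)) ** noise_sel (Some k)"

definition brownian_motion :: "'w measure \<Rightarrow> real \<Rightarrow> (real \<Rightarrow> 'w \<Rightarrow> real^'d::finite) \<Rightarrow> bool" where
  "brownian_motion M T B \<longleftrightarrow>
     (\<forall>t\<in>{0..T}. B t \<in> borel_measurable M) \<and>
     (AE \<omega> in M. B 0 \<omega> = 0) \<and>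
     (AE \<omega> in M. continuous_on {0..T} (\<lambda>t. B t \<omega>)) \<and>
     (\<forall>s t. 0 \<le> s \<and> s < t \<and> t \<le> T \<longrightarrow>
        prob_space.indep_vars M (\<lambda>_. borel) (\<lambda>a \<omega>. (B t \<omega> - B s \<omega>) $ a) UNIV \<and>
        (\<forall>a. distributed M lborel (\<lambda>\<omega>. (B t \<omega> - B s \<omega>) $ a)
               (\<lambda>x. ennreal (normal_density 0 (sqrt (t - s)) x)))) \<and>
     (\<forall>m (\<tau>::nat \<Rightarrow> real). (\<forall>j<m. 0 \<le> \<tau> j \<and> \<tau> j \<le> \<tau> (Suc j) \<and> \<tau> (Suc j) \<le> T) \<longrightarrow>
        prob_space.indep_vars M (\<lambda>_. borel) (\<lambda>j \<omega>. B (\<tau> (Suc j)) \<omega> - B (\<tau> j) \<omega>) {..<m})"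

definition driving_noise ::
  "'w measure \<Rightarrow> real \<Rightarrow> (real \<Rightarrow> 'w \<Rightarrow> real^('p::finite option \<times> 'd::finite)) \<Rightarrow> bool" where
  "driving_noise M T W \<longleftrightarrow>
     (\<forall>j. brownian_motion M T (\<lambda>t \<omega>. noise_sel j *v W t \<omega>)) \<and>
     prob_space.indep_sets M
       (\<lambda>j. sigma_sets (space M)
              {(\<lambda>\<omega>. noise_sel j *v W t \<omega>) -` S \<inter> space M | t S. t \<in> {0..T} \<and> S \<in> sets borel})
       UNIV"

definition step_fun :: "nat \<Rightarrow> (nat \<Rightarrow> real) \<Rightarrow> (nat \<Rightarrow> real^'n^'r) \<Rightarrow> real \<Rightarrow> real^'n^'r" where
  "step_fun m \<tau> c s = (\<Sum>j<m. indicat_real {\<tau> j<..\<tau> (Suc j)} s *\<^sub>R c j)"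

definition step_integral ::
  "(real \<Rightarrow> 'w \<Rightarrow> real^'n::finite) \<Rightarrow> nat \<Rightarrow> (nat \<Rightarrow> real) \<Rightarrow> (nat \<Rightarrow> real^'n^'r) \<Rightarrow> 'w \<Rightarrow> real^'r" where
  "step_integral W m \<tau> c \<omega> = (\<Sum>j<m. c j *v (W (\<tau> (Suc j)) \<omega> - W (\<tau> j) \<omega>))"

text \<open>
  \<open>wiener_integral M W a b f Z\<close>: the kernel \<open>f\<close> is square integrable on \<open>[a,b]\<close> and the random
  vector \<open>Z\<close> is a version of \<open>\<integral>\<^sub>a\<^sup>b f(s) dW\<^sub>s\<close>, i.e. the \<open>L\<^sup>2\<close> limit of the integrals of
  deterministic step functions converging to \<open>f\<close> in \<open>L\<^sup>2[a,b]\<close>.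
\<close>

definition wiener_integral ::
  "'w measure \<Rightarrow> (real \<Rightarrow> 'w \<Rightarrow> real^'n::finite) \<Rightarrow> real \<Rightarrow> real
     \<Rightarrow> (real \<Rightarrow> real^'n^'r::finite) \<Rightarrow> ('w \<Rightarrow> real^'r) \<Rightarrow> bool" where
  "wiener_integral M W a b f Z \<longleftrightarrow>
     set_borel_measurable lborel {a..b} f \<and>
     set_integrable lborel {a..b} (\<lambda>s. (norm (f s))\<^sup>2) \<and>
     Z \<in> borel_measurable M \<and>
     (\<exists>m \<tau> c.
        (\<forall>q. \<forall>j<m q. a \<le> \<tau> q j \<and> \<tau> q j \<le> \<tau> q (Suc j) \<and> \<tau> q (Suc j) \<le> b) \<and>
        (\<lambda>q. \<integral>\<^sup>+s\<in>{a..b}. ennreal ((norm (step_fun (m q) (\<tau> q) (c q) s - f s))\<^sup>2) \<partial>lborel)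
          \<longlonglongrightarrow> 0 \<and>
        (\<lambda>q. \<integral>\<^sup>+\<omega>. ennreal ((norm (step_integral W (m q) (\<tau> q) (c q) \<omega> - Z \<omega>))\<^sup>2) \<partial>M)
          \<longlonglongrightarrow> 0)"

text \<open>
  \<open>differential_integral M W a b \<phi> \<sigma> \<beta> Z\<close>: the random vector \<open>Z\<close> is a version of
  \<open>\<integral>\<^sub>a\<^sup>b \<phi>(s) dL\<^sub>s\<close>, where \<open>dL\<^sub>s = \<sigma>(s) dW\<^sub>s + \<beta>\<^sub>s ds\<close> with deterministic \<open>\<phi>\<close> and \<open>\<sigma>\<close> and a
  random drift \<open>\<beta>\<close>.
\<close>

definition differential_integral ::
  "'w measure \<Rightarrow> (real \<Rightarrow> 'w \<Rightarrow> real^'n::finite) \<Rightarrow> real \<Rightarrow> real \<Rightarrow> (real \<Rightarrow> real^'m::finite^'r::finite)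
     \<Rightarrow> (real \<Rightarrow> real^'n^'m) \<Rightarrow> (real \<Rightarrow> 'w \<Rightarrow> real^'m) \<Rightarrow> ('w \<Rightarrow> real^'r) \<Rightarrow> bool" where
  "differential_integral M W a b \<phi> \<sigma> \<beta> Z \<longleftrightarrow>
     (AE \<omega> in M. set_integrable lborel {a..b} (\<lambda>s. \<phi> s *v \<beta> s \<omega>)) \<and>
     wiener_integral M W a b (\<lambda>s. \<phi> s ** \<sigma> s)
       (\<lambda>\<omega>. Z \<omega> - (LINT s:{a..b}|lborel. \<phi> s *v \<beta> s \<omega>))"


section \<open>Linear processes\<close>

definition L2_process ::
  "'w measure \<Rightarrow> 'i::euclidean_space set \<Rightarrow> ('i \<Rightarrow> 'w \<Rightarrow> real^'r::finite) \<Rightarrow> bool" where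
  "L2_process M I L \<longleftrightarrow>
     (\<lambda>(t, \<omega>). L t \<omega>) \<in> borel_measurable (restrict_space lborel I \<Otimes>\<^sub>M M) \<and>
     (\<forall>t\<in>I. integrable M (\<lambda>\<omega>. (norm (L t \<omega>))\<^sup>2)) \<and>
     integrable (restrict_space lborel I \<Otimes>\<^sub>M M) (\<lambda>(t, \<omega>). (norm (L t \<omega>))\<^sup>2)"

definition linear_process_with ::
  "'w measure \<Rightarrow> (real \<Rightarrow> 'w \<Rightarrow> real^'n::finite) \<Rightarrow> real \<Rightarrow> (real \<Rightarrow> 'w \<Rightarrow> real^'r::finite)
     \<Rightarrow> (real \<Rightarrow> real^'r) \<Rightarrow> (real \<Rightarrow> real \<Rightarrow> real^'n^'r) \<Rightarrow> bool" where
  "linear_process_with M W T L Lbar Lker \<longleftrightarrow>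
     L2_process M {0..T} L \<and>
     (\<forall>t\<in>{0..T}. wiener_integral M W 0 t (Lker t) (\<lambda>\<omega>. L t \<omega> - Lbar t))"

definition linear_process ::
  "'w measure \<Rightarrow> (real \<Rightarrow> 'w \<Rightarrow> real^'n::finite) \<Rightarrow> real \<Rightarrow> (real \<Rightarrow> 'w \<Rightarrow> real^'r::finite) \<Rightarrow> bool" where
  "linear_process M W T L \<longleftrightarrow> (\<exists>Lbar Lker. linear_process_with M W T L Lbar Lker)"

text \<open>
  In the extended sense the noise is integrated over all of \<open>[0,T]\<close>. The index set \<open>I\<close> may be
  multi-dimensional, so that a field such as \<open>(t,u) \<mapsto> H\<^sub>t(u)\<close> is covered.
\<close>

definition extended_linear_process ::
  "'w measure \<Rightarrow> (real \<Rightarrow> 'w \<Rightarrow> real^'n::finite) \<Rightarrow> real \<Rightarrow> 'i::euclidean_space set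
     \<Rightarrow> ('i \<Rightarrow> 'w \<Rightarrow> real^'r::finite) \<Rightarrow> bool" where
  "extended_linear_process M W T I L \<longleftrightarrow>
     L2_process M I L \<and>
     (\<exists>Lbar Lker. \<forall>t\<in>I. wiener_integral M W 0 T (Lker t) (\<lambda>\<omega>. L t \<omega> - Lbar t))"


section \<open>The game\<close>

record ('p, 'd, 'w) lq_game =
  horizon :: real
  x_init :: "real^'d"
  mat_A :: "real \<Rightarrow> real^'d^'d"
  mat_Sigma :: "real \<Rightarrow> real^'d^'d"
  mat_Gamma :: "'p \<Rightarrow> real \<Rightarrow> real^'d^'d"
  cost_XX :: "'p \<Rightarrow> real \<Rightarrow> real^'d^'d"
  cost_X :: "'p \<Rightarrow> real \<Rightarrow> 'w \<Rightarrow> real^'d"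
  cost_0 :: "'p \<Rightarrow> real \<Rightarrow> real"
  cost_DD :: "'p \<Rightarrow> real \<Rightarrow> real^'d^'d"

definition mat_P :: "('p, 'd::finite, 'w) lq_game \<Rightarrow> 'p \<Rightarrow> real \<Rightarrow> real^'d^'d" where
  "mat_P G k t = transpose (mat_Gamma G k t) ** mat_Gamma G k t"

definition bounded_coeff :: "real \<Rightarrow> (real \<Rightarrow> 'a::euclidean_space) \<Rightarrow> bool" where
  "bounded_coeff T f \<longleftrightarrow> set_borel_measurable lborel {0..T} f \<and> bounded (f ` {0..T})"

definition psd :: "real^'d::finite^'d \<Rightarrow> bool" where
  "psd S \<longleftrightarrow> transpose S = S \<and> (\<forall>x. 0 \<le> x \<bullet> (S *v x))"

definition pos_def :: "real^'d::finite^'d \<Rightarrow> bool" where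
  "pos_def S \<longleftrightarrow> transpose S = S \<and> (\<forall>x. x \<noteq> 0 \<longrightarrow> 0 < x \<bullet> (S *v x))"

text \<open>
  Integrability in time of \<open>cost_XX\<close> and \<open>cost_0\<close> is what makes the running cost well defined;
  a deterministic bounded \<open>cost_X\<close> is the special case of a linear process with zero kernel.
\<close>

definition game ::
  "'w measure \<Rightarrow> (real \<Rightarrow> 'w \<Rightarrow> real^('p::finite option \<times> 'd::finite)) \<Rightarrow> ('p, 'd, 'w) lq_game \<Rightarrow> bool"
where
  "game M W G \<longleftrightarrow>
     prob_space M \<and> 0 < horizon G \<and> driving_noise M (horizon G) W \<and>
     bounded_coeff (horizon G) (mat_A G) \<and>
     bounded_coeff (horizon G) (mat_Sigma G) \<and>
     (\<forall>j. bounded_coeff (horizon G) (mat_Gamma G j)) \<and>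
     (\<forall>j. set_integrable lborel {0..horizon G} (cost_XX G j) \<and>
          (\<forall>t\<in>{0..horizon G}. psd (cost_XX G j t))) \<and>
     (\<forall>j. linear_process M W (horizon G) (cost_X G j)) \<and>
     (\<forall>j. set_integrable lborel {0..horizon G} (cost_0 G j)) \<and>
     (\<forall>j. set_borel_measurable lborel {0..horizon G} (cost_DD G j) \<and>
          (\<forall>t\<in>{0..horizon G}. pos_def (cost_DD G j t)))"

definition player_cost ::
  "'w measure \<Rightarrow> ('p, 'd::finite, 'w) lq_game \<Rightarrow> 'p
     \<Rightarrow> (real \<Rightarrow> 'w \<Rightarrow> real^'d) \<Rightarrow> (real \<Rightarrow> 'w \<Rightarrow> real^'d) \<Rightarrow> real" where
  "player_cost M G i X D = (LINT \<omega>|M.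
     (LINT t:{0..horizon G}|lborel.
        X t \<omega> \<bullet> (cost_XX G i t *v X t \<omega>) + 2 * (cost_X G i t \<omega> \<bullet> X t \<omega>) + cost_0 G i t
          + D t \<omega> \<bullet> (cost_DD G i t *v D t \<omega>))
     + X (horizon G) \<omega> \<bullet> (cost_XX G i (horizon G) *v X (horizon G) \<omega>)
     + 2 * (cost_X G i (horizon G) \<omega> \<bullet> X (horizon G) \<omega>))"

definition state_equation ::
  "'w measure \<Rightarrow> (real \<Rightarrow> 'w \<Rightarrow> real^('p::finite option \<times> 'd::finite)) \<Rightarrow> ('p, 'd, 'w) lq_game
     \<Rightarrow> (real \<Rightarrow> 'w \<Rightarrow> real^'d) \<Rightarrow> ('p \<Rightarrow> real \<Rightarrow> 'w \<Rightarrow> real^'d) \<Rightarrow> bool" where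
  "state_equation M W G X D \<longleftrightarrow>
     (\<forall>t\<in>{0..horizon G}.
        differential_integral M W 0 t (\<lambda>_. mat 1) (\<lambda>s. mat_Sigma G s ** noise_sel None)
          (\<lambda>s \<omega>. mat_A G s *v X s \<omega> + (\<Sum>j\<in>UNIV. D j s \<omega>))
          (\<lambda>\<omega>. X t \<omega> - x_init G))"

definition observation ::
  "(real \<Rightarrow> 'w \<Rightarrow> real^('p::finite option \<times> 'd::finite)) \<Rightarrow> ('p, 'd, 'w) lq_game
     \<Rightarrow> (real \<Rightarrow> 'w \<Rightarrow> real^'d) \<Rightarrow> 'p \<Rightarrow> real \<Rightarrow> 'w \<Rightarrow> real^'d" where
  "observation W G X k t \<omega> =
     (LINT s:{0..t}|lborel. mat_Gamma G k s *v X s \<omega>) + noise_sel (Some k) *v W t \<omega>"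

definition observed_info ::
  "'w measure \<Rightarrow> (real \<Rightarrow> 'w \<Rightarrow> real^('p::finite option \<times> 'd::finite)) \<Rightarrow> ('p, 'd, 'w) lq_game
     \<Rightarrow> (real \<Rightarrow> 'w \<Rightarrow> real^'d) \<Rightarrow> 'p \<Rightarrow> real \<Rightarrow> 'w measure" where
  "observed_info M W G X k t =
     sigma (space M)
       {observation W G X k s -` S \<inter> space M | s S. s \<in> {0..t} \<and> S \<in> sets borel}"

definition vec_cond_exp :: "'w measure \<Rightarrow> 'w measure \<Rightarrow> ('w \<Rightarrow> real^'r) \<Rightarrow> 'w \<Rightarrow> real^'r" where
  "vec_cond_exp M F Z \<omega> = (\<chi> a. real_cond_exp M F (\<lambda>\<omega>'. Z \<omega>' $ a) \<omega>)"


section \<open>Baseline profile and frozen strategies\<close>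

text \<open>
  The deterministic data of the baseline profile. In all kernels the arguments are ordered as in
  \<open>X\<^sub>t(u)\<close> and \<open>F\<^sup>k\<^sub>t(u,s)\<close>: \<open>state_ker V t u\<close>, \<open>filter_ker V k t u s\<close>. The field \<open>err_ker\<close> is the
  kernel of the filtering error, and \<open>pol_mean\<close>, \<open>pol_ker\<close> are the coefficients of the
  noise-state linear strategies.
\<close>

record ('p, 'd) environment =
  state_mean :: "real \<Rightarrow> real^'d"
  state_ker :: "real \<Rightarrow> real \<Rightarrow> real^('p option \<times> 'd)^'d"
  err_ker :: "'p \<Rightarrow> real \<Rightarrow> real \<Rightarrow> real^('p option \<times> 'd)^'d"
  filter_ker :: "'p \<Rightarrow> real \<Rightarrow> real \<Rightarrow> real \<Rightarrow> real^('p option \<times> 'd)^('p option \<times> 'd)"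
  pol_mean :: "'p \<Rightarrow> real \<Rightarrow> real^'d"
  pol_ker :: "'p \<Rightarrow> real \<Rightarrow> real \<Rightarrow> real^('p option \<times> 'd)^'d"

definition triangle :: "real \<Rightarrow> (real \<times> real) set" where
  "triangle T = {(t, u). 0 \<le> u \<and> u \<le> t \<and> t \<le> T}"

definition measurable_kernel :: "real \<Rightarrow> (real \<Rightarrow> real \<Rightarrow> 'a::euclidean_space) \<Rightarrow> bool" where
  "measurable_kernel T K \<longleftrightarrow> set_borel_measurable lborel (triangle T) (\<lambda>(t, u). K t u)"

definition bounded_kernel :: "real \<Rightarrow> (real \<Rightarrow> real \<Rightarrow> 'a::euclidean_space) \<Rightarrow> bool" where
  "bounded_kernel T K \<longleftrightarrow> measurable_kernel T K \<and> bounded ((\<lambda>(t, u). K t u) ` triangle T)"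

definition noise_state_coeffs ::
  "real \<Rightarrow> (real \<Rightarrow> real^'d::finite) \<Rightarrow> (real \<Rightarrow> real \<Rightarrow> real^'n::finite^'d) \<Rightarrow> bool" where
  "noise_state_coeffs T Dbar Dker \<longleftrightarrow>
     set_borel_measurable lborel {0..T} Dbar \<and>
     measurable_kernel T Dker \<and>
     (\<forall>t\<in>{0..T}. set_integrable lborel {0..t} (\<lambda>u. (norm (Dker t u))\<^sup>2)) \<and>
     (\<forall>t\<in>{0..T}. \<forall>u. t < u \<longrightarrow> Dker t u = 0)"

text \<open>
  On the baseline profile \<open>\<beta> k t u\<close> is \<open>\<integral>\<^sub>0\<^sup>t F\<^sup>k\<^sub>t(u,s) dW\<^sub>s\<close>, the drift of the filtered noise
  \<open>u \<mapsto> E[W\<^sub>u | F\<^sup>k\<^sub>t]\<close>, so that integrals against the filtered noise are integrals against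
  \<open>\<Pi>\<^sup>k dW\<^sub>u + \<beta> k t u du\<close>.
\<close>

definition baseline_profile ::
  "'w measure \<Rightarrow> (real \<Rightarrow> 'w \<Rightarrow> real^('p::finite option \<times> 'd::finite)) \<Rightarrow> ('p, 'd, 'w) lq_game
     \<Rightarrow> ('p, 'd) environment \<Rightarrow> (real \<Rightarrow> 'w \<Rightarrow> real^'d) \<Rightarrow> bool" where
  "baseline_profile M W G V X \<longleftrightarrow>
     linear_process_with M W (horizon G) X (state_mean V) (state_ker V) \<and>
     (\<forall>k. noise_state_coeffs (horizon G) (pol_mean V k) (pol_ker V k)) \<and>
     (\<exists>D \<beta>.
        state_equation M W G X D \<and>
        (\<forall>k. L2_process M {0..horizon G} (D k)) \<and>
        (\<forall>k. \<forall>t\<in>{0..horizon G}.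
           wiener_integral M W 0 t (err_ker V k t)
             (\<lambda>\<omega>. X t \<omega> - vec_cond_exp M (observed_info M W G X k t) (X t) \<omega>) \<and>
           L2_process M {0..t} (\<beta> k t) \<and>
           (\<forall>u\<in>{0..t}.
              wiener_integral M W 0 t (filter_ker V k t u) (\<beta> k t u) \<and>
              differential_integral M W 0 u (\<lambda>_. mat 1) (\<lambda>_. noise_proj k) (\<beta> k t)
                (vec_cond_exp M (observed_info M W G X k t) (W u))) \<and>
           differential_integral M W 0 t (pol_ker V k t) (\<lambda>_. noise_proj k) (\<beta> k t)
             (\<lambda>\<omega>. D k t \<omega> - pol_mean V k t)))"

text \<open>
  Player \<open>k\<close>'s frozen filter and strategy along a possibly deviated state path \<open>X\<close>, i.e. applied
  to the realized signal \<open>dY\<^sup>k = \<Gamma>\<^sup>k X dt + E\<^sup>k dW\<close>. With \<open>Xh\<close> the frozen state estimate, the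
  innovation is \<open>dI\<^sup>k\<^sub>s = dY\<^sup>k\<^sub>s - \<Gamma>\<^sup>k(s) Xh\<^sub>s ds = E\<^sup>k dW\<^sub>s + \<iota> s ds\<close>; \<open>J t u\<close> is
  \<open>\<integral>\<^sub>u\<^sup>t err_ker\<^sub>s(u)\<^sup>T \<Gamma>\<^sup>k(s)\<^sup>T dI\<^sup>k\<^sub>s\<close>. Hence the filtered noise has the differential
  \<open>E\<^sup>k\<^sup>T dI\<^sup>k\<^sub>u + J t u du = \<Pi>\<^sup>k dW\<^sub>u + (E\<^sup>k\<^sup>T \<iota> u + J t u) du\<close>. All kernels are those of the baseline
  profile; only \<open>X\<close>, and through it \<open>Xh\<close>, \<open>J\<close> and the resulting control \<open>D\<close>, changes with a
  deviation.
\<close>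

definition frozen_response ::
  "'w measure \<Rightarrow> (real \<Rightarrow> 'w \<Rightarrow> real^('p::finite option \<times> 'd::finite)) \<Rightarrow> ('p, 'd, 'w) lq_game
     \<Rightarrow> ('p, 'd) environment \<Rightarrow> 'p \<Rightarrow> (real \<Rightarrow> 'w \<Rightarrow> real^'d) \<Rightarrow> (real \<Rightarrow> 'w \<Rightarrow> real^'d) \<Rightarrow> bool" where
  "frozen_response M W G V k X D \<longleftrightarrow>
     (\<exists>Xh J. let \<iota> = (\<lambda>s \<omega>. mat_Gamma G k s *v (X s \<omega> - Xh s \<omega>));
                 drift = (\<lambda>t u \<omega>. transpose (noise_sel (Some k)) *v \<iota> u \<omega> + J t u \<omega>)
      in
        L2_process M {0..horizon G} Xh \<and>
        L2_process M {0..horizon G} D \<and>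
        (\<forall>t\<in>{0..horizon G}.
           L2_process M {0..t} (J t) \<and>
           (\<forall>u\<in>{0..t}.
              differential_integral M W u t
                (\<lambda>s. transpose (err_ker V k s u) ** transpose (mat_Gamma G k s))
                (\<lambda>_. noise_sel (Some k)) \<iota> (J t u)) \<and>
           differential_integral M W 0 t (state_ker V t) (\<lambda>_. noise_proj k) (drift t)
             (\<lambda>\<omega>. Xh t \<omega> - state_mean V t) \<and>
           differential_integral M W 0 t (pol_ker V k t) (\<lambda>_. noise_proj k) (drift t)
             (\<lambda>\<omega>. D t \<omega> - pol_mean V k t)))"

text \<open>
  \<open>X\<close> is the state when player \<open>i\<close> plays some linear-process control instead of the baseline
  strategy while the opponents' strategy maps and filters stay frozen.
\<close>

definition deviated_state ::
  "'w measure \<Rightarrow> (real \<Rightarrow> 'w \<Rightarrow> real^('p::finite option \<times> 'd::finite)) \<Rightarrow> ('p, 'd, 'w) lq_game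
     \<Rightarrow> ('p, 'd) environment \<Rightarrow> 'p \<Rightarrow> (real \<Rightarrow> 'w \<Rightarrow> real^'d) \<Rightarrow> bool" where
  "deviated_state M W G V i X \<longleftrightarrow>
     linear_process M W (horizon G) X \<and>
     (\<exists>D. linear_process M W (horizon G) (D i) \<and>
          (\<forall>k. k \<noteq> i \<longrightarrow> frozen_response M W G V k X (D k)) \<and>
          state_equation M W G X D)"


section \<open>The backward system\<close>

text \<open>
  \<open>has_derivative_path a b h r\<close>: \<open>d/dt h = r\<close> on \<open>[a,b]\<close> in the sense of Caratheodory, i.e. \<open>h\<close> is
  the absolutely continuous primitive of the integrable function \<open>r\<close>. The coefficients are only
  measurable and bounded in time, so the classical derivative need not exist.
\<close>

definition has_derivative_path ::
  "real \<Rightarrow> real \<Rightarrow> (real \<Rightarrow> 'a::euclidean_space) \<Rightarrow> (real \<Rightarrow> 'a) \<Rightarrow> bool" where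
  "has_derivative_path a b h r \<longleftrightarrow>
     set_integrable lborel {a..b} r \<and>
     (\<forall>t\<in>{a..b}. h t = h a + (LINT s:{a..t}|lborel. r s))"

text \<open>The process \<open>V\<^sup>k\<^sup>,\<^sup>i\<close> of the backward system; \<open>H t u \<omega>\<close> stands for \<open>H\<^sup>k\<^sup>,\<^sup>i\<^sub>t(u)\<close>.\<close>

definition filter_load ::
  "('p::finite, 'd::finite, 'w) lq_game \<Rightarrow> ('p, 'd) environment \<Rightarrow> 'p
     \<Rightarrow> (real \<Rightarrow> real \<Rightarrow> 'w \<Rightarrow> real^('p option \<times> 'd)) \<Rightarrow> real \<Rightarrow> 'w \<Rightarrow> real^'d" where
  "filter_load G V k H t \<omega> =
     transpose (mat_Gamma G k t) *v (noise_sel (Some k) *v H t t \<omega>)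
     + mat_P G k t *v (LINT z:{0..t}|lborel. err_ker V k t z *v H t z \<omega>)"

end

theory Submission
  imports Defs
begin

text \<open>
  Substituting the formula for \<open>H\<^sup>k\<^sup>,\<^sup>i\<^sub>t(u)\<close> as an integral over \<open>[t,T]\<close> into the definition of \<open>V\<^sup>k\<^sup>,\<^sup>i\<close> turns
  the backward system into a single linear Volterra equation
  \<open>Y\<^sub>t = g\<^sub>t + \<integral>\<^sub>t\<^sup>T K(t,s) Y\<^sub>s ds\<close> for the stacked process \<open>Y = (H\<^sup>X\<^sup>,\<^sup>i, (V\<^sup>k\<^sup>,\<^sup>i)\<^sub>k)\<close>, with a bounded
  deterministic kernel and a forcing \<open>g\<close> built from \<open>X\<close> and \<open>G\<^sup>X\<^sup>,\<^sup>i\<close>. Its solution is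
  \<open>Y\<^sub>t = g\<^sub>t + \<integral>\<^sub>t\<^sup>T R(t,s) g\<^sub>s ds\<close> with a deterministic resolvent \<open>R\<close>, so everything reduces to the fact
  that the random vectors \<open>c + \<integral>\<^sub>0\<^sup>T f dW\<close> form a closed subspace of \<open>L\<^sup>2\<close> which is stable under time
  integration. Closedness is the Ito isometry together with completeness of \<open>L\<^sup>2[0,T]\<close>. For
  stability, time points \<open>u\<^sub>1, u\<^sub>2, \<dots>\<close> are chosen greedily so that the averages of the \<open>Z(u\<^sub>j)\<close> converge to
  \<open>\<integral> Z\<^sub>s ds\<close> in \<open>L\<^sup>2\<close> at the Monte Carlo rate.
\<close>

section \<open>Covariance of the driving noise\<close>

text \<open>Two different demands meet here. The equations must hold off one null set for all t and
  u together, whereas membership in the class of linear processes concerns each random variable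
  separately. Moreover \<open>wiener_integral\<close> is only a relation up to versions, so there is
  no integral operator to which a stochastic Fubini theorem could be applied. A deterministic
  resolvent answers both demands: the same formula for Y is an exact Volterra solution along every
  path with bounded forcing, and it is a time integral of elements of a closed subspace. No
  continuity in time is available, so such integrals cannot be taken as limits of Riemann sums;
  hence the selection of good time points. The cost matrix is merely integrable in time, so it is
  kept out of the kernel and enters only the forcing, after a second-moment bound for X_t uniform in
  t has been read off the state equation. Coefficients are extended by zero to the whole line, so
  that integrals run over \<open>lborel\<close> and supports are carried by indicators.\<close>

lemma noise_sel_mult: "(noise_sel j *v w) $ a = w $ (j, a)"
  by (simp add: noise_sel_def matrix_vector_mult_def if_distrib[of "\<lambda>z. z * _"] cong: if_cong)

locale noise_space = prob_space M
  for M :: "'w measure"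
    and W :: "real \<Rightarrow> 'w \<Rightarrow> real^('p::finite option \<times> 'd::finite)"
    and T :: real +
  assumes T_nonneg: "0 \<le> T" and noise: "driving_noise M T W"
begin

lemma player_brownian: "brownian_motion M T (\<lambda>t \<omega>. noise_sel j *v W t \<omega>)"
  using noise by (simp add: driving_noise_def)

lemma W_comp_measurable:
  assumes "0 \<le> t" "t \<le> T"
  shows "(\<lambda>\<omega>. W t \<omega> $ x) \<in> borel_measurable M"
proof -
  obtain j a where x: "x = (j, a)" by (cases x)
  have "(\<lambda>\<omega>. noise_sel j *v W t \<omega>) \<in> borel_measurable M"
    using player_brownian[of j] assms by (auto simp: brownian_motion_def)
  then have "(\<lambda>\<omega>. (noise_sel j *v W t \<omega>) $ a) \<in> borel_measurable M"
    by (rule measurable_compose) (auto intro!: borel_measurable_continuous_onI continuous_intros)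
  then show ?thesis by (simp add: x noise_sel_mult)
qed

lemma W_0: "AE \<omega> in M. W 0 \<omega> $ x = 0"
proof -
  obtain j a where x: "x = (j, a)" by (cases x)
  have "AE \<omega> in M. noise_sel j *v W 0 \<omega> = 0"
    using player_brownian[of j] by (auto simp: brownian_motion_def)
  then show ?thesis
  proof eventually_elim
    case (elim \<omega>)
    then have "(noise_sel j *v W 0 \<omega>) $ a = 0" by simp
    then show ?case by (simp add: x noise_sel_mult)
  qed
qed

lemma increment_moments:
  assumes "0 \<le> s" "s \<le> t" "t \<le> T"
  shows "integrable M (\<lambda>\<omega>. W t \<omega> $ x - W s \<omega> $ x)"
    and "integrable M (\<lambda>\<omega>. (W t \<omega> $ x - W s \<omega> $ x)\<^sup>2)"
    and "expectation (\<lambda>\<omega>. W t \<omega> $ x - W s \<omega> $ x) = 0"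
    and "expectation (\<lambda>\<omega>. (W t \<omega> $ x - W s \<omega> $ x)\<^sup>2) = t - s"
proof -
  obtain j a where x: "x = (j, a)" by (cases x)
  have *: "integrable M (\<lambda>\<omega>. W t \<omega> $ x - W s \<omega> $ x) \<and>
    integrable M (\<lambda>\<omega>. (W t \<omega> $ x - W s \<omega> $ x)\<^sup>2) \<and>
    expectation (\<lambda>\<omega>. W t \<omega> $ x - W s \<omega> $ x) = 0 \<and>
    expectation (\<lambda>\<omega>. (W t \<omega> $ x - W s \<omega> $ x)\<^sup>2) = t - s"
  \<comment> \<open>\<open>brownian_motion\<close> provides a normal density only for s < t; for s =
    t every claim is about the constant 0.\<close>
  proof (cases "s = t")
    case False
    then have st: "s < t" "0 < sqrt (t - s)" using assms by auto
    have "distributed M lborel (\<lambda>\<omega>. (noise_sel j *v W t \<omega> - noise_sel j *v W s \<omega>) $ a)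
       (\<lambda>x. ennreal (normal_density 0 (sqrt (t - s)) x))"
      using player_brownian[of j] assms st unfolding brownian_motion_def by blast
    then have D: "distributed M lborel (\<lambda>\<omega>. W t \<omega> $ x - W s \<omega> $ x)
       (\<lambda>x. ennreal (normal_density 0 (sqrt (t - s)) x))"
      by (simp add: x noise_sel_mult)
    have m: "expectation (\<lambda>\<omega>. W t \<omega> $ x - W s \<omega> $ x) = 0"
      by (rule normal_distributed_expectation[OF st(2) D])
    have v: "variance (\<lambda>\<omega>. W t \<omega> $ x - W s \<omega> $ x) = (sqrt (t - s))\<^sup>2"
      by (rule normal_distributed_variance[OF st(2) D])
    have sq: "integrable M (\<lambda>\<omega>. (W t \<omega> $ x - W s \<omega> $ x)\<^sup>2)"
      using distributed_integrable[OF D, of "\<lambda>x. x\<^sup>2"] integrable_normal_moment[of "sqrt (t-s)" 0 2] st(2)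
      by simp
    moreover have "integrable M (\<lambda>\<omega>. W t \<omega> $ x - W s \<omega> $ x)"
      by (rule square_integrable_imp_integrable[OF _ sq])
        (use assms in \<open>auto intro!: borel_measurable_diff W_comp_measurable\<close>)
    ultimately show ?thesis using m v st by simp
  qed (simp_all)
  from * show "integrable M (\<lambda>\<omega>. W t \<omega> $ x - W s \<omega> $ x)"
    and "integrable M (\<lambda>\<omega>. (W t \<omega> $ x - W s \<omega> $ x)\<^sup>2)"
    and "expectation (\<lambda>\<omega>. W t \<omega> $ x - W s \<omega> $ x) = 0"
    and "expectation (\<lambda>\<omega>. (W t \<omega> $ x - W s \<omega> $ x)\<^sup>2) = t - s" by auto
qed

lemma indep_product_mean_zero:
  fixes X Y :: "'w \<Rightarrow> real"
  assumes "indep_var borel X borel Y" "integrable M X" "integrable M Y" "expectation X = 0"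
  shows "integrable M (\<lambda>\<omega>. X \<omega> * Y \<omega>) \<and> expectation (\<lambda>\<omega>. X \<omega> * Y \<omega>) = 0"
  using indep_var_lebesgue_integral[OF assms(1-3)] indep_var_integrable[OF assms(1-3)] assms(4)
  by simp

text \<open>Restricting the family to two singletons gives independent variables with values in
  product spaces; composing with the coordinate projections and then with f and g removes these
  products.\<close>

lemma indep_var_of_indep_vars:
  assumes "indep_vars N X I" "i \<in> I" "j \<in> I" "i \<noteq> j"
    and "f \<in> measurable (N i) borel" "g \<in> measurable (N j) borel"
  shows "indep_var borel (\<lambda>\<omega>. f (X i \<omega>)) borel (\<lambda>\<omega>. g (X j \<omega>))"
proof -
  have "indep_var (PiM {i} N) (\<lambda>\<omega>. restrict (\<lambda>i. X i \<omega>) {i}) (PiM {j} N) (\<lambda>\<omega>. restrict (\<lambda>i. X i \<omega>) {j})"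
    using assms by (intro indep_var_restrict[of _ _ I]) auto
  from indep_var_compose[OF this, of "\<lambda>h. f (h i)" borel "\<lambda>h. g (h j)" borel]
  show ?thesis
    using assms by (auto simp: comp_def intro!: measurable_compose[OF measurable_component_singleton])
qed

lemma same_interval_cov:
  assumes "0 \<le> s" "s \<le> t" "t \<le> T" "a \<noteq> b"
  shows "integrable M (\<lambda>\<omega>. (W t \<omega> $ (j,a) - W s \<omega> $ (j,a)) * (W t \<omega> $ (j,b) - W s \<omega> $ (j,b)))
   \<and> expectation (\<lambda>\<omega>. (W t \<omega> $ (j,a) - W s \<omega> $ (j,a)) * (W t \<omega> $ (j,b) - W s \<omega> $ (j,b))) = 0"
proof (cases "s = t")
  case False
  have "indep_vars (\<lambda>_. borel) (\<lambda>a \<omega>. (noise_sel j *v W t \<omega> - noise_sel j *v W s \<omega>) $ a) UNIV"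
    using player_brownian[of j] assms False unfolding brownian_motion_def by auto
  from indep_var_of_indep_vars[OF this, of a b "\<lambda>x. x" "\<lambda>x. x"] \<open>a \<noteq> b\<close>
  have "indep_var borel (\<lambda>\<omega>. W t \<omega> $ (j,a) - W s \<omega> $ (j,a)) borel (\<lambda>\<omega>. W t \<omega> $ (j,b) - W s \<omega> $ (j,b))"
    by (simp add: noise_sel_mult)
  then show ?thesis
    using increment_moments[OF assms(1-3)] by (intro indep_product_mean_zero)
qed simp

lemma disjoint_interval_cov:
  assumes "0 \<le> r" "r \<le> s" "s \<le> t" "t \<le> T"
  shows "integrable M (\<lambda>\<omega>. (W s \<omega> $ (j,a) - W r \<omega> $ (j,a)) * (W t \<omega> $ (j,b) - W s \<omega> $ (j,b)))
   \<and> expectation (\<lambda>\<omega>. (W s \<omega> $ (j,a) - W r \<omega> $ (j,a)) * (W t \<omega> $ (j,b) - W s \<omega> $ (j,b))) = 0"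
proof -
  \<comment> \<open>The partition r, s, t: its cells 0 and 1 carry the two increments of the
    claim.\<close>
  define \<tau> where "\<tau> = (\<lambda>n::nat. if n = 0 then r else if n = 1 then s else t)"
  have "\<forall>m (\<tau>::nat \<Rightarrow> real). (\<forall>j<m. 0 \<le> \<tau> j \<and> \<tau> j \<le> \<tau> (Suc j) \<and> \<tau> (Suc j) \<le> T) \<longrightarrow>
        indep_vars (\<lambda>_. borel) (\<lambda>i \<omega>. noise_sel j *v W (\<tau> (Suc i)) \<omega> - noise_sel j *v W (\<tau> i) \<omega>) {..<m}"
    using player_brownian[of j] unfolding brownian_motion_def by blast
  moreover have "\<forall>j<2. 0 \<le> \<tau> j \<and> \<tau> j \<le> \<tau> (Suc j) \<and> \<tau> (Suc j) \<le> T"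
    using assms by (auto simp: \<tau>_def)
  ultimately have "indep_vars (\<lambda>_. borel)
      (\<lambda>i \<omega>. noise_sel j *v W (\<tau> (Suc i)) \<omega> - noise_sel j *v W (\<tau> i) \<omega>) {..<2}"
    by blast
  from indep_var_of_indep_vars[OF this, of 0 1 "\<lambda>x. x $ a" "\<lambda>x. x $ b"]
  have "indep_var borel (\<lambda>\<omega>. W s \<omega> $ (j,a) - W r \<omega> $ (j,a)) borel (\<lambda>\<omega>. W t \<omega> $ (j,b) - W s \<omega> $ (j,b))"
    by (simp add: noise_sel_mult \<tau>_def borel_measurable_continuous_onI continuous_intros)
  then show ?thesis
    using increment_moments assms by (intro indep_product_mean_zero) auto
qed

lemma W_comp_moments:
  assumes "0 \<le> t" "t \<le> T"
  shows "integrable M (\<lambda>\<omega>. W t \<omega> $ x)" "expectation (\<lambda>\<omega>. W t \<omega> $ x) = 0"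
proof -
  \<comment> \<open>The known moments are those of increments, and W vanishes at time 0 only almost
    surely.\<close>
  have ae: "AE \<omega> in M. W t \<omega> $ x - W 0 \<omega> $ x = W t \<omega> $ x"
    using W_0[of x] by eventually_elim simp
  have m: "(\<lambda>\<omega>. W t \<omega> $ x) \<in> borel_measurable M" "(\<lambda>\<omega>. W 0 \<omega> $ x) \<in> borel_measurable M"
    using assms by (auto intro!: W_comp_measurable)
  show "integrable M (\<lambda>\<omega>. W t \<omega> $ x)"
    using integrable_cong_AE[OF _ _ ae] increment_moments(1)[of 0 t x] assms m by auto
  show "expectation (\<lambda>\<omega>. W t \<omega> $ x) = 0"
    using integral_cong_AE[OF _ _ ae] increment_moments(3)[of 0 t x] assms m by auto
qed

text \<open>Independence is assumed for the sigma-algebras of the whole paths of the blocks. It is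
  transferred to the smaller sigma-algebras generated by one coordinate at one time, where it
  becomes independence of two real variables.\<close>

lemma distinct_player_cov:
  assumes "0 \<le> s" "s \<le> T" "0 \<le> t" "t \<le> T" "j \<noteq> k"
  shows "integrable M (\<lambda>\<omega>. W s \<omega> $ (j,a) * W t \<omega> $ (k,b))
   \<and> expectation (\<lambda>\<omega>. W s \<omega> $ (j,a) * W t \<omega> $ (k,b)) = 0"
proof -
  let ?G = "\<lambda>j. {(\<lambda>\<omega>. noise_sel j *v W t \<omega>) -` S \<inter> space M | t S. t \<in> {0..T} \<and> S \<in> sets borel}"
  have ind: "indep_sets (\<lambda>j. sigma_sets (space M) (?G j)) UNIV"
    using noise unfolding driving_noise_def by blast
  have sub: "sigma_sets (space M) {(\<lambda>\<omega>. W t \<omega> $ (j,a)) -` A \<inter> space M | A. A \<in> sets borel}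
    \<subseteq> sigma_sets (space M) (?G j)" if "0 \<le> t" "t \<le> T" for t j a
  proof (rule sigma_sets_subseteq, safe)
    fix A :: "real set" assume A: "A \<in> sets borel"
    have "(\<lambda>x::real^'d. x $ a) -` A \<inter> space borel \<in> sets borel"
      by (rule measurable_sets[OF _ A]) (auto intro!: borel_measurable_continuous_onI continuous_intros)
    moreover have "(\<lambda>\<omega>. W t \<omega> $ (j,a)) -` A \<inter> space M =
      (\<lambda>\<omega>. noise_sel j *v W t \<omega>) -` ((\<lambda>x. x $ a) -` A) \<inter> space M"
      by (auto simp: noise_sel_mult)
    ultimately show "\<exists>t' S. (\<lambda>\<omega>. W t \<omega> $ (j,a)) -` A \<inter> space M =
      (\<lambda>\<omega>. noise_sel j *v W t' \<omega>) -` S \<inter> space M \<and> t' \<in> {0..T} \<and> S \<in> sets borel"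
      using that by (intro exI[of _ t] exI[of _ "(\<lambda>x. x $ a) -` A"]) auto
  qed
  have "indep_set (sigma_sets (space M) {(\<lambda>\<omega>. W s \<omega> $ (j,a)) -` A \<inter> space M | A. A \<in> sets borel})
     (sigma_sets (space M) {(\<lambda>\<omega>. W t \<omega> $ (k,b)) -` A \<inter> space M | A. A \<in> sets borel})"
  proof (rule indep_setI)
    fix A B assume AB: "A \<in> sigma_sets (space M) {(\<lambda>\<omega>. W s \<omega> $ (j,a)) -` A \<inter> space M | A. A \<in> sets borel}"
      "B \<in> sigma_sets (space M) {(\<lambda>\<omega>. W t \<omega> $ (k,b)) -` A \<inter> space M | A. A \<in> sets borel}"
    \<comment> \<open>Of the whole family only the members j and k are tested; as j and k differ,
      intersection and product have exactly the two factors A and B.\<close>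
    have "prob (\<Inter>l\<in>{j,k}. (if l = j then A else B)) = (\<Prod>l\<in>{j,k}. prob (if l = j then A else B))"
      using AB sub[OF assms(1,2), of j a] sub[OF assms(3,4), of k b] by (intro indep_setsD[OF ind]) auto
    then show "prob (A \<inter> B) = prob A * prob B" using assms by (auto simp: Int_commute)
  qed (use ind sub[OF assms(1,2), of j a] sub[OF assms(3,4), of k b] in \<open>auto simp: indep_sets_def\<close>)
  then have "indep_var borel (\<lambda>\<omega>. W s \<omega> $ (j,a)) borel (\<lambda>\<omega>. W t \<omega> $ (k,b))"
    using assms by (simp add: indep_var_eq W_comp_measurable)
  then show ?thesis
    using assms W_comp_moments by (intro indep_product_mean_zero) auto
qed

lemma W_cov_le:
  assumes "0 \<le> s" "s \<le> t" "t \<le> T"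
  shows "integrable M (\<lambda>\<omega>. W s \<omega> $ x * W t \<omega> $ y) \<and>
    expectation (\<lambda>\<omega>. W s \<omega> $ x * W t \<omega> $ y) = (if x = y then s else 0)"
proof -
  obtain j a where x: "x = (j, a)" by (cases x)
  obtain k b where y: "y = (k, b)" by (cases y)
  have meas: "\<And>s x. 0 \<le> s \<Longrightarrow> s \<le> T \<Longrightarrow> (\<lambda>\<omega>. W s \<omega> $ x) \<in> borel_measurable M"
    by (rule W_comp_measurable)
  show ?thesis
  proof (cases "j = k")
    case False
    then show ?thesis using distinct_player_cov[of s t j k a b] assms by (auto simp: x y)
  next
    case [simp]: True
    \<comment> \<open>W_t is split into W_s and the increment after s. The first summand gives the
      variance at s, or 0 for different coordinates; the second has mean 0 by independence of
      increments.\<close>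
    let ?f = "\<lambda>\<omega>. (W s \<omega> $ (k,a) - W 0 \<omega> $ (k,a)) * (W s \<omega> $ (k,b) - W 0 \<omega> $ (k,b))
      + (W s \<omega> $ (k,a) - W 0 \<omega> $ (k,a)) * (W t \<omega> $ (k,b) - W s \<omega> $ (k,b))"
    have ae: "AE \<omega> in M. ?f \<omega> = W s \<omega> $ x * W t \<omega> $ y"
      using W_0[of x] W_0[of y] by eventually_elim (simp add: x y algebra_simps)
    have 1: "integrable M (\<lambda>\<omega>. (W s \<omega> $ (k,a) - W 0 \<omega> $ (k,a)) * (W s \<omega> $ (k,b) - W 0 \<omega> $ (k,b))) \<and>
      expectation (\<lambda>\<omega>. (W s \<omega> $ (k,a) - W 0 \<omega> $ (k,a)) * (W s \<omega> $ (k,b) - W 0 \<omega> $ (k,b)))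
        = (if a = b then s else 0)"
      using same_interval_cov[of 0 s a b k] increment_moments[of 0 s "(k,a)"] assms
      by (auto simp: power2_eq_square)
    have 2: "integrable M (\<lambda>\<omega>. (W s \<omega> $ (k,a) - W 0 \<omega> $ (k,a)) * (W t \<omega> $ (k,b) - W s \<omega> $ (k,b)))
     \<and> expectation (\<lambda>\<omega>. (W s \<omega> $ (k,a) - W 0 \<omega> $ (k,a)) * (W t \<omega> $ (k,b) - W s \<omega> $ (k,b))) = 0"
      using disjoint_interval_cov[of 0 s t k a b] assms by auto
    have 3: "integrable M ?f" "integral\<^sup>L M ?f = (if a = b then s else 0)"
      using 1 2 by simp_all
    have m: "?f \<in> borel_measurable M" "(\<lambda>\<omega>. W s \<omega> $ x * W t \<omega> $ y) \<in> borel_measurable M"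
      using assms by (auto intro!: borel_measurable_add borel_measurable_times borel_measurable_diff meas)
    show ?thesis
      using integrable_cong_AE[OF m ae] integral_cong_AE[OF m ae] 3 by (auto simp: x y)
  qed
qed

lemma W_cov:
  assumes "0 \<le> s" "s \<le> T" "0 \<le> t" "t \<le> T"
  shows "integrable M (\<lambda>\<omega>. W s \<omega> $ x * W t \<omega> $ y)"
    and "expectation (\<lambda>\<omega>. W s \<omega> $ x * W t \<omega> $ y) = (if x = y then min s t else 0)"
proof -
  have "integrable M (\<lambda>\<omega>. W s \<omega> $ x * W t \<omega> $ y) \<and>
    expectation (\<lambda>\<omega>. W s \<omega> $ x * W t \<omega> $ y) = (if x = y then min s t else 0)"
  proof (cases "s \<le> t")
    case True
    then show ?thesis using W_cov_le[of s t x y] assms by auto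
  next
    case False
    then show ?thesis using W_cov_le[of t s y x] assms by (auto simp: mult.commute)
  qed
  then show "integrable M (\<lambda>\<omega>. W s \<omega> $ x * W t \<omega> $ y)"
    and "expectation (\<lambda>\<omega>. W s \<omega> $ x * W t \<omega> $ y) = (if x = y then min s t else 0)" by auto
qed

text \<open>Written as the measure of an overlap, the covariance is the L2 inner product of two
  indicators. The Ito isometry then follows by bilinearity, without ordering the intervals.\<close>

lemma increment_cov:
  assumes "0 \<le> a" "a \<le> b" "b \<le> T" "0 \<le> a'" "a' \<le> b'" "b' \<le> T"
  shows "integrable M (\<lambda>\<omega>. (W b \<omega> - W a \<omega>) $ x * (W b' \<omega> - W a' \<omega>) $ y)"
    and "expectation (\<lambda>\<omega>. (W b \<omega> - W a \<omega>) $ x * (W b' \<omega> - W a' \<omega>) $ y) =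
      (if x = y then measure lborel ({a<..b} \<inter> {a'<..b'}) else 0)"
proof -
  have *: "(\<lambda>\<omega>. (W b \<omega> - W a \<omega>) $ x * (W b' \<omega> - W a' \<omega>) $ y) =
    (\<lambda>\<omega>. W b \<omega> $ x * W b' \<omega> $ y - W b \<omega> $ x * W a' \<omega> $ y - W a \<omega> $ x * W b' \<omega> $ y + W a \<omega> $ x * W a' \<omega> $ y)"
    by (simp add: algebra_simps)
  have i: "{a<..b} \<inter> {a'<..b'} = {max a a'<..min b b'}" by auto
  show "integrable M (\<lambda>\<omega>. (W b \<omega> - W a \<omega>) $ x * (W b' \<omega> - W a' \<omega>) $ y)"
    unfolding * using assms W_cov by auto
  show "expectation (\<lambda>\<omega>. (W b \<omega> - W a \<omega>) $ x * (W b' \<omega> - W a' \<omega>) $ y) =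
      (if x = y then measure lborel ({a<..b} \<inter> {a'<..b'}) else 0)"
    unfolding * i using assms W_cov by (auto simp: measure_def max_def min_def)
qed

end

section \<open>Mean squares and simple integrals\<close>

text \<open>In this form measurability, boundedness and interchange with integrals come from the
  general theory of bounded bilinear maps.\<close>

lemma bounded_bilinear_matrix_vector_mult:
  "bounded_bilinear ((*v) :: real^'n::finite^'m::finite \<Rightarrow> real^'n \<Rightarrow> real^'m)"
  by (subst bilinear_conv_bounded_bilinear[symmetric])
    (auto simp: bilinear_def linear_iff matrix_vector_mult_add_rdistrib matrix_vector_right_distrib
      scaleR_matrix_vector_assoc matrix_vector_mult_scaleR)

lemma matrix_mult_scaleR_right: "A ** (r *\<^sub>R B) = r *\<^sub>R (A ** B :: real^'n^'m)"
  by (simp add: vec_eq_iff matrix_matrix_mult_def sum_distrib_left algebra_simps)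

lemma matrix_mult_scaleR_left: "(r *\<^sub>R A) ** B = r *\<^sub>R (A ** B :: real^'n^'m)"
  by (simp add: vec_eq_iff matrix_matrix_mult_def sum_distrib_left algebra_simps)

lemma matrix_add_rdistrib: "(A + B) ** C = A ** C + B ** (C :: real^'n^'m)"
  by (simp add: vec_eq_iff matrix_matrix_mult_def sum.distrib distrib_right)

lemma bounded_bilinear_matrix_matrix_mult:
  "bounded_bilinear ((**) :: real^'n::finite^'m::finite \<Rightarrow> real^'k::finite^'n \<Rightarrow> real^'k^'m)"
  by (subst bilinear_conv_bounded_bilinear[symmetric])
    (auto simp: bilinear_def linear_iff matrix_add_ldistrib matrix_add_rdistrib
      matrix_mult_scaleR_left matrix_mult_scaleR_right)

lemma borel_measurable_matrix_vector_mult [measurable (raw)]: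
  fixes f :: "'a \<Rightarrow> real^'n::finite^'m::finite"
  assumes "f \<in> borel_measurable M" "g \<in> borel_measurable M"
  shows "(\<lambda>x. f x *v g x) \<in> borel_measurable M"
  by (rule borel_measurable_continuous_Pair[OF assms])
    (intro bounded_bilinear.continuous_on[OF bounded_bilinear_matrix_vector_mult] continuous_intros)

text \<open>The squared L2 norm, with values in \<open>ennreal\<close> so that estimates carry no
  integrability conditions. The same notion serves random vectors and matrix kernels, whose norm is
  the Frobenius norm; this makes the Ito isometry an equality between two
  \<open>msq\<close>.\<close>

definition msq :: "'a measure \<Rightarrow> ('a \<Rightarrow> 'b::real_normed_vector) \<Rightarrow> ennreal" where
  "msq M f = (\<integral>\<^sup>+x. ennreal ((norm (f x))\<^sup>2) \<partial>M)"

lemma msq_cong: "(\<And>x. x \<in> space M \<Longrightarrow> norm (f x) = norm (g x)) \<Longrightarrow> msq M f = msq M g"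
  unfolding msq_def by (intro nn_integral_cong) simp

lemma msq_mono: "AE x in M. norm (f x) \<le> norm (g x) \<Longrightarrow> msq M f \<le> msq M g"
  unfolding msq_def by (intro nn_integral_mono_AE) (auto elim!: eventually_mono intro!: ennreal_leI power_mono)

lemma msq_add:
  assumes [measurable]: "f \<in> borel_measurable M" "g \<in> borel_measurable M"
  shows "msq M (\<lambda>x. f x + g x :: 'b::{real_normed_vector, second_countable_topology}) \<le> 2 * msq M f + 2 * msq M g"
proof -
  have "ennreal ((norm (f x + g x))\<^sup>2) \<le> 2 * ennreal ((norm (f x))\<^sup>2) + 2 * ennreal ((norm (g x))\<^sup>2)" for x
  proof -
    have "(norm (f x + g x))\<^sup>2 \<le> (norm (f x) + norm (g x))\<^sup>2"
      by (intro power_mono norm_triangle_ineq) simp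
    also have "\<dots> \<le> 2 * (norm (f x))\<^sup>2 + 2 * (norm (g x))\<^sup>2"
      using sum_squares_bound[of "norm (f x)" "norm (g x)"] by (simp add: power2_sum)
    finally show ?thesis
      by (simp add: ennreal_leI flip: ennreal_numeral ennreal_mult' ennreal_plus)
  qed
  then have "msq M (\<lambda>x. f x + g x) \<le> (\<integral>\<^sup>+x. 2 * ennreal ((norm (f x))\<^sup>2) + 2 * ennreal ((norm (g x))\<^sup>2) \<partial>M)"
    unfolding msq_def by (intro nn_integral_mono)
  also have "\<dots> = 2 * msq M f + 2 * msq M g"
    by (simp add: msq_def nn_integral_add nn_integral_cmult)
  finally show ?thesis .
qed

lemma msq_diff:
  assumes "f \<in> borel_measurable M" "g \<in> borel_measurable M"
  shows "msq M (\<lambda>x. f x - g x :: 'b::{real_normed_vector, second_countable_topology}) \<le> 2 * msq M f + 2 * msq M g"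
  using msq_add[of f M "\<lambda>x. - g x"] assms by (simp add: msq_def)

text \<open>The crude bound (x + y)^2 <= 2 x^2 + 2 y^2 replaces Minkowski's inequality; each summand
  pays a factor 2, whence the quarters.\<close>

lemma msq_add_less:
  assumes "f \<in> borel_measurable M" "g \<in> borel_measurable M"
    and "msq M f < ennreal (\<epsilon>/4)" "msq M g < ennreal (\<epsilon>/4)"
  shows "msq M (\<lambda>x. f x + g x :: 'b::{real_normed_vector, second_countable_topology}) < ennreal \<epsilon>"
proof -
  have *: "2 * x + 2 * y < ennreal \<epsilon>" if "x < ennreal (\<epsilon>/4)" "y < ennreal (\<epsilon>/4)" for x y
    using that by (cases x; cases y)
      (simp_all add: ennreal_less_iff flip: ennreal_numeral ennreal_mult' ennreal_plus)
  show ?thesis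
    by (rule order.strict_trans1[OF msq_add[OF assms(1,2)] *[OF assms(3,4)]])
qed

lemma msq_scaleR: "f \<in> borel_measurable M \<Longrightarrow>
  msq M (\<lambda>x. r *\<^sub>R f x :: 'b::{real_normed_vector, second_countable_topology}) = ennreal (r\<^sup>2) * msq M f"
  unfolding msq_def by (simp add: power_mult_distrib ennreal_mult nn_integral_cmult)

lemma msq_matrix_mult:
  fixes A :: "real^'n::finite^'m::finite"
  assumes "f \<in> borel_measurable M"
  shows "msq M (\<lambda>x. A *v f x) \<le> ennreal ((onorm ((*v) A))\<^sup>2) * msq M f"
proof -
  have "msq M (\<lambda>x. A *v f x) \<le> (\<integral>\<^sup>+x. ennreal ((onorm ((*v) A))\<^sup>2) * ennreal ((norm (f x))\<^sup>2) \<partial>M)"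
    unfolding msq_def
    by (intro nn_integral_mono)
      (auto simp flip: ennreal_mult power_mult_distrib
        intro!: ennreal_leI power_mono onorm)
  also have "\<dots> = ennreal ((onorm ((*v) A))\<^sup>2) * msq M f"
    unfolding msq_def using assms by (intro nn_integral_cmult) measurable
  finally show ?thesis .
qed

lemma msq_integrable:
  assumes "f \<in> borel_measurable M" "msq M f < \<infinity>"
  shows "integrable M (\<lambda>x. (norm (f x))\<^sup>2)"
  using assms by (intro integrableI_bounded) (simp_all add: msq_def)

lemma msq_eq_integral: "integrable M (\<lambda>x. (norm (f x))\<^sup>2) \<Longrightarrow> msq M f = ennreal (\<integral>x. (norm (f x))\<^sup>2 \<partial>M)"
  unfolding msq_def by (intro nn_integral_eq_integral) auto

text \<open>Kernel and integral are generated together from increments over intervals that may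
  overlap. Closure under sums is then a plain induction and covariances are computed bilinearly;
  ordered partitions enter only in \<open>simple_integral_as_step\<close>.\<close>

inductive simple_integral ::
  "(real \<Rightarrow> 'w \<Rightarrow> real^'n::finite) \<Rightarrow> real \<Rightarrow> (real \<Rightarrow> real^'n^'r::finite) \<Rightarrow> ('w \<Rightarrow> real^'r) \<Rightarrow> bool"
  for W T where
  zero: "simple_integral W T (\<lambda>_. 0) (\<lambda>_. 0)"
| add: "simple_integral W T \<phi> Z \<Longrightarrow> 0 \<le> a \<Longrightarrow> a \<le> b \<Longrightarrow> b \<le> T \<Longrightarrow>
    simple_integral W T (\<lambda>s. indicat_real {a<..b} s *\<^sub>R c + \<phi> s) (\<lambda>\<omega>. c *v (W b \<omega> - W a \<omega>) + Z \<omega>)"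

lemma simple_integral_add:
  assumes "simple_integral W T \<phi> Z" "simple_integral W T \<psi> Y"
  shows "simple_integral W T (\<lambda>s. \<phi> s + \<psi> s) (\<lambda>\<omega>. Z \<omega> + Y \<omega>)"
  using assms(1)
proof induction
  case zero
  then show ?case using assms(2) by simp
next
  case (add \<phi> Z a b c)
  from simple_integral.add[OF this(5,2-4)] show ?case by (simp add: add.assoc)
qed

lemma simple_integral_matrix_mult:
  assumes "simple_integral W T \<phi> Z"
  shows "simple_integral W T (\<lambda>s. A ** \<phi> s) (\<lambda>\<omega>. A *v Z \<omega>)"
  using assms
proof induction
  case zero
  have "A ** (0 :: real^'b^'c) = 0" by (simp add: vec_eq_iff matrix_matrix_mult_def)
  then show ?case using simple_integral.zero by simp
next
  case (add \<phi> Z a b c)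
  from simple_integral.add[OF this(5,2-4), of "A ** c"] show ?case
    by (simp add: matrix_add_ldistrib matrix_vector_right_distrib matrix_vector_mul_assoc matrix_mult_scaleR_right)
qed

lemma simple_integral_scaleR:
  assumes "simple_integral W T \<phi> Z"
  shows "simple_integral W T (\<lambda>s. r *\<^sub>R \<phi> s) (\<lambda>\<omega>. r *\<^sub>R Z \<omega>)"
  using assms
proof induction
  case zero
  then show ?case using simple_integral.zero by simp
next
  case (add \<phi> Z a b c)
  from simple_integral.add[OF this(5,2-4), of "r *\<^sub>R c"] show ?case
    by (simp add: scaleR_matrix_vector_assoc scaleR_right_distrib mult.commute)
qed

lemma simple_integral_diff:
  assumes "simple_integral W T \<phi> Z" "simple_integral W T \<psi> Y"
  shows "simple_integral W T (\<lambda>s. \<phi> s - \<psi> s) (\<lambda>\<omega>. Z \<omega> - Y \<omega>)"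
  using simple_integral_add[OF assms(1) simple_integral_scaleR[OF assms(2), of "-1"]] by simp

lemma simple_integral_measurable: "simple_integral W T \<phi> Z \<Longrightarrow> \<phi> \<in> borel_measurable borel"
  by (induction rule: simple_integral.induct) auto

lemma simple_integral_step:
  assumes "\<And>j. j < m \<Longrightarrow> 0 \<le> \<tau> j \<and> \<tau> j \<le> \<tau> (Suc j) \<and> \<tau> (Suc j) \<le> T"
  shows "simple_integral W T (step_fun m \<tau> c) (step_integral W m \<tau> c)"
  using assms
proof (induction m)
  case 0
  then show ?case using simple_integral.zero by (simp add: step_fun_def[abs_def] step_integral_def[abs_def])
next
  case (Suc m)
  then have "simple_integral W T (step_fun m \<tau> c) (step_integral W m \<tau> c)" by simp
  from simple_integral.add[OF this, of "\<tau> m" "\<tau> (Suc m)" "c m"] Suc.prems[of m]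
  have "simple_integral W T (\<lambda>s. indicat_real {\<tau> m<..\<tau> (Suc m)} s *\<^sub>R c m + step_fun m \<tau> c s)
    (\<lambda>\<omega>. c m *v (W (\<tau> (Suc m)) \<omega> - W (\<tau> m) \<omega>) + step_integral W m \<tau> c \<omega>)" by simp
  moreover have "(\<lambda>s. indicat_real {\<tau> m<..\<tau> (Suc m)} s *\<^sub>R c m + step_fun m \<tau> c s) = step_fun (Suc m) \<tau> c"
    unfolding step_fun_def[abs_def] by (simp add: add.commute)
  moreover have "(\<lambda>\<omega>. c m *v (W (\<tau> (Suc m)) \<omega> - W (\<tau> m) \<omega>) + step_integral W m \<tau> c \<omega>) =
    step_integral W (Suc m) \<tau> c"
    unfolding step_integral_def[abs_def] by (simp add: add.commute)
  ultimately show ?case by simp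
qed

text \<open>Used with h the path of W and with h t the indicator of \<open>{..t}\<close>: cutting an
  interval into the cells of a finer partition preserves both its increment and its
  indicator.\<close>

lemma sum_indicator_telescope:
  fixes h :: "real \<Rightarrow> 'b::real_vector" and \<sigma> :: "nat \<Rightarrow> real"
  assumes mono: "\<And>i j. i < j \<Longrightarrow> j \<le> n \<Longrightarrow> \<sigma> i < \<sigma> j"
    and "p \<le> n" "q \<le> n" "\<sigma> p \<le> \<sigma> q"
  shows "(\<Sum>j<n. indicat_real {\<sigma> p<..\<sigma> q} (\<sigma> (Suc j)) *\<^sub>R (h (\<sigma> (Suc j)) - h (\<sigma> j))) = h (\<sigma> q) - h (\<sigma> p)"
proof -
  have less_iff: "\<sigma> i < \<sigma> j \<longleftrightarrow> i < j" if "i \<le> n" "j \<le> n" for i j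
    using mono[of i j] mono[of j i] that by (cases i j rule: linorder_cases) auto
  have pq: "p \<le> q" using less_iff[of q p] assms by force
  have "(\<Sum>j<n. indicat_real {\<sigma> p<..\<sigma> q} (\<sigma> (Suc j)) *\<^sub>R (h (\<sigma> (Suc j)) - h (\<sigma> j)))
    = (\<Sum>j<n. if j \<in> {p..<q} then h (\<sigma> (Suc j)) - h (\<sigma> j) else 0)"
  proof (rule sum.cong)
    fix j assume "j \<in> {..<n}"
    \<comment> \<open>The indicator is tested at the right endpoint of cell j, which lies in the
      left-open interval exactly when p <= j < q.\<close>
    then have "\<sigma> p < \<sigma> (Suc j) \<longleftrightarrow> p \<le> j" "\<sigma> (Suc j) \<le> \<sigma> q \<longleftrightarrow> j < q"
      using less_iff[of p "Suc j"] less_iff[of q "Suc j"] assms by (auto simp: not_less[symmetric])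
    then show "indicat_real {\<sigma> p<..\<sigma> q} (\<sigma> (Suc j)) *\<^sub>R (h (\<sigma> (Suc j)) - h (\<sigma> j)) =
      (if j \<in> {p..<q} then h (\<sigma> (Suc j)) - h (\<sigma> j) else 0)"
      by (auto simp: indicator_def)
  qed simp
  also have "\<dots> = (\<Sum>j\<in>{p..<q}. h (\<sigma> (Suc j)) - h (\<sigma> j))"
    using assms by (simp add: sum.inter_filter[symmetric] set_eq_iff) (intro sum.cong, auto)
  also have "\<dots> = h (\<sigma> q) - h (\<sigma> p)" using pq by (rule sum_Suc_diff')
  finally show ?thesis .
qed

text \<open>The claim quantifies over every strictly increasing partition through P instead of
  exhibiting one. This lets the induction add the endpoints of a new interval: the old part is still
  represented on the refined partition. Coefficients are read off at right endpoints because the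
  cells are open on the left.\<close>

lemma simple_integral_common_partition:
  assumes "simple_integral W T \<phi> Z"
  shows "\<exists>P. finite P \<and> P \<subseteq> {0..T} \<and> (\<forall>n \<sigma>. (\<forall>i j. i < j \<longrightarrow> j \<le> n \<longrightarrow> \<sigma> i < \<sigma> j) \<longrightarrow> P \<subseteq> \<sigma> ` {..n} \<longrightarrow>
      step_fun n \<sigma> (\<lambda>j. \<phi> (\<sigma> (Suc j))) = \<phi> \<and> step_integral W n \<sigma> (\<lambda>j. \<phi> (\<sigma> (Suc j))) = Z)"
  using assms
proof induction
  case zero
  then show ?case
    by (intro exI[of _ "{}"]) (auto simp: step_fun_def[abs_def] step_integral_def[abs_def])
next
  case (add \<phi> Z a b c)
  then obtain P where P: "finite P" "P \<subseteq> {0..T}"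
    "\<And>n \<sigma>. (\<And>i j. i < j \<Longrightarrow> j \<le> n \<Longrightarrow> \<sigma> i < \<sigma> j) \<Longrightarrow> P \<subseteq> \<sigma> ` {..n} \<Longrightarrow>
      step_fun n \<sigma> (\<lambda>j. \<phi> (\<sigma> (Suc j))) = \<phi> \<and> step_integral W n \<sigma> (\<lambda>j. \<phi> (\<sigma> (Suc j))) = Z"
    by auto
  show ?case
  proof (intro exI[of _ "P \<union> {a, b}"] conjI allI impI)
    fix n and \<sigma> :: "nat \<Rightarrow> real"
    assume "\<forall>i j. i < j \<longrightarrow> j \<le> n \<longrightarrow> \<sigma> i < \<sigma> j" and sub: "P \<union> {a, b} \<subseteq> \<sigma> ` {..n}"
    then have mono: "\<And>i j. i < j \<Longrightarrow> j \<le> n \<Longrightarrow> \<sigma> i < \<sigma> j" by auto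
    obtain p q where pq: "a = \<sigma> p" "b = \<sigma> q" "p \<le> n" "q \<le> n" using sub by auto
    note IH = P(3)[of n \<sigma>, OF mono]
    have IH1: "step_fun n \<sigma> (\<lambda>j. \<phi> (\<sigma> (Suc j))) = \<phi>" and IH2: "step_integral W n \<sigma> (\<lambda>j. \<phi> (\<sigma> (Suc j))) = Z"
      using IH sub by auto
    note tel = sum_indicator_telescope[of n \<sigma> p q, OF mono pq(3,4)]
    show "step_fun n \<sigma> (\<lambda>j. indicat_real {a<..b} (\<sigma> (Suc j)) *\<^sub>R c + \<phi> (\<sigma> (Suc j))) =
      (\<lambda>s. indicat_real {a<..b} s *\<^sub>R c + \<phi> s)"
    proof
      fix s
      \<comment> \<open>As a difference of two half-line indicators the cell fits the telescoping
        sum.\<close>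
      have *: "indicat_real {\<sigma> j<..\<sigma> (Suc j)} s = indicat_real {..\<sigma> (Suc j)} s - indicat_real {..\<sigma> j} s"
        if "j < n" for j
        using mono[of j "Suc j"] that by (auto simp: indicator_def)
      have "step_fun n \<sigma> (\<lambda>j. indicat_real {a<..b} (\<sigma> (Suc j)) *\<^sub>R c + \<phi> (\<sigma> (Suc j))) s =
        (\<Sum>j<n. indicat_real {\<sigma> p<..\<sigma> q} (\<sigma> (Suc j)) *\<^sub>R (indicat_real {..\<sigma> (Suc j)} s - indicat_real {..\<sigma> j} s)) *\<^sub>R c
        + step_fun n \<sigma> (\<lambda>j. \<phi> (\<sigma> (Suc j))) s"
        unfolding step_fun_def scaleR_sum_left sum.distrib[symmetric]
        by (intro sum.cong refl) (simp add: * pq scaleR_right_distrib mult.commute)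
      also have "\<dots> = (indicat_real {..b} s - indicat_real {..a} s) *\<^sub>R c + \<phi> s"
        unfolding IH1 using tel[of "\<lambda>t. indicat_real {..t} s"] add(2-4) pq by simp
      also have "\<dots> = indicat_real {a<..b} s *\<^sub>R c + \<phi> s"
        using add(2-4) by (auto simp: indicator_def)
      finally show "step_fun n \<sigma> (\<lambda>j. indicat_real {a<..b} (\<sigma> (Suc j)) *\<^sub>R c + \<phi> (\<sigma> (Suc j))) s =
        indicat_real {a<..b} s *\<^sub>R c + \<phi> s" .
    qed
    show "step_integral W n \<sigma> (\<lambda>j. indicat_real {a<..b} (\<sigma> (Suc j)) *\<^sub>R c + \<phi> (\<sigma> (Suc j))) =
      (\<lambda>\<omega>. c *v (W b \<omega> - W a \<omega>) + Z \<omega>)"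
    proof
      fix \<omega>
      have "step_integral W n \<sigma> (\<lambda>j. indicat_real {a<..b} (\<sigma> (Suc j)) *\<^sub>R c + \<phi> (\<sigma> (Suc j))) \<omega> =
        c *v (\<Sum>j<n. indicat_real {\<sigma> p<..\<sigma> q} (\<sigma> (Suc j)) *\<^sub>R (W (\<sigma> (Suc j)) \<omega> - W (\<sigma> j) \<omega>))
        + step_integral W n \<sigma> (\<lambda>j. \<phi> (\<sigma> (Suc j))) \<omega>"
        unfolding step_integral_def matrix_vector_right_distrib
          linear_sum[OF matrix_vector_mul_linear] sum.distrib[symmetric]
        by (intro sum.cong refl)
          (simp add: pq matrix_vector_mult_add_rdistrib matrix_vector_mult_scaleR
            scaleR_matrix_vector_assoc)
      also have "\<dots> = c *v (W b \<omega> - W a \<omega>) + Z \<omega>"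
        unfolding IH2 using tel[of "\<lambda>t. W t \<omega>"] add(2-4) pq by simp
      finally show "step_integral W n \<sigma> (\<lambda>j. indicat_real {a<..b} (\<sigma> (Suc j)) *\<^sub>R c + \<phi> (\<sigma> (Suc j))) \<omega> =
        c *v (W b \<omega> - W a \<omega>) + Z \<omega>" .
    qed
  qed (use P add in auto)
qed

text \<open>The definition of \<open>wiener_integral\<close> asks for step functions over one
  ordered partition, so the freely generated integrals have to be brought back to that form.\<close>

lemma simple_integral_as_step:
  assumes "simple_integral W T \<phi> Z" "0 \<le> T"
  obtains m \<tau> c where "\<And>j. j < m \<Longrightarrow> 0 \<le> \<tau> j \<and> \<tau> j \<le> \<tau> (Suc j) \<and> \<tau> (Suc j) \<le> T"
    "step_fun m \<tau> c = \<phi>" "step_integral W m \<tau> c = Z"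
proof -
  obtain P where P: "finite P" "P \<subseteq> {0..T}"
    "\<And>n \<sigma>. (\<And>i j. i < j \<Longrightarrow> j \<le> n \<Longrightarrow> \<sigma> i < \<sigma> j) \<Longrightarrow> P \<subseteq> \<sigma> ` {..n} \<Longrightarrow>
      step_fun n \<sigma> (\<lambda>j. \<phi> (\<sigma> (Suc j))) = \<phi> \<and> step_integral W n \<sigma> (\<lambda>j. \<phi> (\<sigma> (Suc j))) = Z"
    using simple_integral_common_partition[OF assms(1)] by auto
  \<comment> \<open>The point 0 keeps the list nonempty, so that its length minus 1 is the number of
    cells.\<close>
  define xs where "xs = sorted_list_of_set (insert 0 P)"
  have xs: "set xs = insert 0 P" "sorted_wrt (<) xs"
    using P(1) unfolding xs_def by (intro set_sorted_list_of_set strict_sorted_list_of_set; simp)+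
  then have "xs \<noteq> []" by auto
  note xs = xs this
  define n where "n = length xs - 1"
  have mono: "\<And>i j. i < j \<Longrightarrow> j \<le> n \<Longrightarrow> xs ! i < xs ! j"
    using xs sorted_wrt_nth_less[of "(<)" xs] by (auto simp: n_def Suc_diff_le)
  have "insert 0 P \<subseteq> (!) xs ` {..n}"
  proof
    fix x assume "x \<in> insert 0 P"
    then obtain i where "i < length xs" "x = xs ! i" using xs(1) by (metis in_set_conv_nth)
    then show "x \<in> (!) xs ` {..n}" by (auto simp: n_def)
  qed
  with P(3)[of n "(!) xs", OF mono]
  have "step_fun n ((!) xs) (\<lambda>j. \<phi> (xs ! (Suc j))) = \<phi>" "step_integral W n ((!) xs) (\<lambda>j. \<phi> (xs ! (Suc j))) = Z"
    by auto
  moreover have "xs ! j \<in> {0..T}" if "j \<le> n" for j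
  proof -
    have "xs ! j \<in> set xs" using that xs(3) by (intro nth_mem) (cases xs; simp add: n_def)
    then show ?thesis using P(2) xs(1) assms(2) by auto
  qed
  ultimately show ?thesis
    using mono by (intro that[of n "(!) xs" "\<lambda>j. \<phi> (xs ! (Suc j))"]) (auto simp: less_imp_le Suc_le_eq)
qed

section \<open>The Ito isometry\<close>

context noise_space begin

lemma W_measurable:
  assumes "0 \<le> t" "t \<le> T"
  shows "W t \<in> borel_measurable M"
proof -
  have "(\<lambda>\<omega>. W t \<omega> \<bullet> e) \<in> borel_measurable M" if "e \<in> Basis" for e
    using that W_comp_measurable[OF assms] by (auto simp: Basis_vec_def inner_axis)
  then show ?thesis by (subst borel_measurable_euclidean_space) auto
qed

lemma simple_integral_random:
  "simple_integral W T \<phi> Z \<Longrightarrow> Z \<in> borel_measurable M"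
proof (induction rule: simple_integral.induct)
  case (add \<phi> Z a b c)
  then have [measurable]: "W a \<in> borel_measurable M" "W b \<in> borel_measurable M"
    by (auto intro!: W_measurable)
  have [measurable]: "Z \<in> borel_measurable M" by (rule add.IH)
  show ?case by measurable
qed simp

lemma inner_matrix_mult: "(c *v x) \<bullet> e = (\<Sum>r\<in>UNIV. \<Sum>j\<in>UNIV. c $ r $ j * e $ r * x $ j)"
  for c :: "real^'m^'r"
  by (simp add: inner_vec_def matrix_vector_mult_def sum_distrib_left mult_ac)

lemma simple_integral_mean:
  "simple_integral W T \<phi> Z \<Longrightarrow> integrable M (\<lambda>\<omega>. Z \<omega> \<bullet> e) \<and> expectation (\<lambda>\<omega>. Z \<omega> \<bullet> e) = 0"
proof (induction rule: simple_integral.induct)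
  case (add \<phi> Z a b c)
  have "integrable M (\<lambda>\<omega>. (c *v (W b \<omega> - W a \<omega>)) \<bullet> e) \<and> expectation (\<lambda>\<omega>. (c *v (W b \<omega> - W a \<omega>)) \<bullet> e) = 0"
    unfolding inner_matrix_mult using increment_moments[OF add(2-4)] by simp
  with add show ?case by (simp add: inner_add_left)
qed simp

lemma inner_matrix_mult2: "(c *v x) \<bullet> (c' *v y) =
   (\<Sum>r\<in>UNIV. \<Sum>j\<in>UNIV. \<Sum>l\<in>UNIV. c $ r $ j * c' $ r $ l * (x $ j * y $ l))"
  for c :: "real^'m^'r"
  by (simp add: inner_vec_def matrix_vector_mult_def sum_product) (simp add: mult_ac)

text \<open>Distinct coordinates are uncorrelated, so only the diagonal of the double sum over
  coordinates survives; what is left is the Frobenius product of the coefficients times the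
  overlap.\<close>

lemma generator_isometry:
  fixes c c' :: "real^('p option \<times> 'd)^'r::finite"
  assumes "0 \<le> a" "a \<le> b" "b \<le> T" "0 \<le> a'" "a' \<le> b'" "b' \<le> T"
  shows "integrable M (\<lambda>\<omega>. (c *v (W b \<omega> - W a \<omega>)) \<bullet> (c' *v (W b' \<omega> - W a' \<omega>)))"
    and "expectation (\<lambda>\<omega>. (c *v (W b \<omega> - W a \<omega>)) \<bullet> (c' *v (W b' \<omega> - W a' \<omega>))) =
      (c \<bullet> c') * measure lborel ({a<..b} \<inter> {a'<..b'})"
proof -
  show "integrable M (\<lambda>\<omega>. (c *v (W b \<omega> - W a \<omega>)) \<bullet> (c' *v (W b' \<omega> - W a' \<omega>)))"
    unfolding inner_matrix_mult2 using increment_cov[OF assms] by simp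
  have "expectation (\<lambda>\<omega>. (c *v (W b \<omega> - W a \<omega>)) \<bullet> (c' *v (W b' \<omega> - W a' \<omega>))) =
    (\<Sum>r\<in>UNIV. \<Sum>j\<in>UNIV. \<Sum>l\<in>UNIV. c $ r $ j * c' $ r $ l *
      (if j = l then measure lborel ({a<..b} \<inter> {a'<..b'}) else 0))"
    unfolding inner_matrix_mult2 using increment_cov[OF assms] by simp
  also have "\<dots> = (c \<bullet> c') * measure lborel ({a<..b} \<inter> {a'<..b'})"
    by (simp add: if_distrib[of "\<lambda>x. _ * x"] inner_vec_def sum_distrib_right cong: if_cong)
  finally show "expectation (\<lambda>\<omega>. (c *v (W b \<omega> - W a \<omega>)) \<bullet> (c' *v (W b' \<omega> - W a' \<omega>))) =
      (c \<bullet> c') * measure lborel ({a<..b} \<inter> {a'<..b'})" .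
qed

lemma interval_inner_integral:
  "integrable lborel (\<lambda>s::real. (indicat_real {a<..b} s *\<^sub>R c) \<bullet> (indicat_real {a'<..b'} s *\<^sub>R c'))"
  "(\<integral>s. (indicat_real {a<..b} s *\<^sub>R c) \<bullet> (indicat_real {a'<..b'} s *\<^sub>R c') \<partial>lborel) =
    (c \<bullet> c') * measure lborel ({a<..b} \<inter> {a'<..b'})" for c c' :: "'b::real_inner"
proof -
  have *: "(\<lambda>s. (indicat_real {a<..b} s *\<^sub>R c) \<bullet> (indicat_real {a'<..b'} s *\<^sub>R c')) =
    (\<lambda>s. (c \<bullet> c') * indicator ({a<..b} \<inter> {a'<..b'}) s)"
    by (auto simp: indicator_def fun_eq_iff)
  have "emeasure lborel ({a<..b} \<inter> {a'<..b'}) \<le> emeasure lborel {a..b}"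
    by (intro emeasure_mono) auto
  also have "\<dots> < \<infinity>" by (simp add: emeasure_lborel_Icc_eq)
  finally have fin: "emeasure lborel ({a<..b} \<inter> {a'<..b'}) < \<infinity>" .
  show "integrable lborel (\<lambda>s. (indicat_real {a<..b} s *\<^sub>R c) \<bullet> (indicat_real {a'<..b'} s *\<^sub>R c'))"
    unfolding * using fin by simp
  show "(\<integral>s. (indicat_real {a<..b} s *\<^sub>R c) \<bullet> (indicat_real {a'<..b'} s *\<^sub>R c') \<partial>lborel) =
    (c \<bullet> c') * measure lborel ({a<..b} \<inter> {a'<..b'})"
    unfolding * using fin by simp
qed

text \<open>Induction over the second argument with a single increment in the first;
  \<open>ito_isometry_inner\<close> adds the induction over the first. Both reduce the identity to
  pairs of increments.\<close>

lemma ito_isometry_aux: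
  fixes c :: "real^('p option \<times> 'd)^'r::finite"
  assumes "0 \<le> a" "a \<le> b" "b \<le> T" "simple_integral W T \<psi> Y"
  shows "integrable M (\<lambda>\<omega>. (c *v (W b \<omega> - W a \<omega>)) \<bullet> Y \<omega>) \<and>
    integrable lborel (\<lambda>s. (indicat_real {a<..b} s *\<^sub>R c) \<bullet> \<psi> s) \<and>
    expectation (\<lambda>\<omega>. (c *v (W b \<omega> - W a \<omega>)) \<bullet> Y \<omega>) = (\<integral>s. (indicat_real {a<..b} s *\<^sub>R c) \<bullet> \<psi> s \<partial>lborel)"
  using assms(4)
proof induction
  case (add \<phi> Z a' b' c')
  show ?case
    using add(5) generator_isometry[OF assms(1-3) add(2-4), of c c']
      interval_inner_integral[of a b c a' b' c']
    by (simp only: inner_add_right) simp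
qed simp

lemma ito_isometry_inner:
  assumes "simple_integral W T \<phi> Z" "simple_integral W T \<psi> Y"
  shows "integrable M (\<lambda>\<omega>. Z \<omega> \<bullet> Y \<omega>) \<and> integrable lborel (\<lambda>s. \<phi> s \<bullet> \<psi> s) \<and>
    expectation (\<lambda>\<omega>. Z \<omega> \<bullet> Y \<omega>) = (\<integral>s. \<phi> s \<bullet> \<psi> s \<partial>lborel)"
  using assms(1)
proof induction
  case (add \<phi> Z a b c)
  show ?case
    using add(5) ito_isometry_aux[OF add(2-4) assms(2), of c]
    by (simp only: inner_add_left) simp
qed simp

text \<open>Simple integrals have mean 0 and are therefore orthogonal to constants. Hence one mean
  square controls the constant and the kernel at the same time.\<close>

lemma ito_isometry:
  fixes e :: "real^'r::finite"
  assumes "simple_integral W T \<phi> Z"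
  shows "msq M (\<lambda>\<omega>. e + Z \<omega>) = ennreal ((norm e)\<^sup>2) + msq lborel \<phi>"
proof -
  have sq: "(norm (e + Z \<omega>))\<^sup>2 = (norm e)\<^sup>2 + 2 * (Z \<omega> \<bullet> e) + Z \<omega> \<bullet> Z \<omega>" for \<omega>
    by (simp add: power2_norm_eq_inner algebra_simps inner_commute)
  note i = ito_isometry_inner[OF assms assms] simple_integral_mean[OF assms, of e]
  have "msq M (\<lambda>\<omega>. e + Z \<omega>) = ennreal (\<integral>\<omega>. (norm (e + Z \<omega>))\<^sup>2 \<partial>M)"
    by (rule msq_eq_integral) (unfold sq, use i in simp)
  also have "(\<integral>\<omega>. (norm (e + Z \<omega>))\<^sup>2 \<partial>M) = (norm e)\<^sup>2 + (\<integral>s. \<phi> s \<bullet> \<phi> s \<partial>lborel)"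
    unfolding sq using i by (simp add: prob_space)
  also have "ennreal \<dots> = ennreal ((norm e)\<^sup>2) + msq lborel \<phi>"
    using i by (simp add: msq_eq_integral power2_norm_eq_inner)
  finally show ?thesis .
qed

lemma simple_integral_msq_finite:
  assumes "simple_integral W T \<phi> Z"
  shows "msq lborel \<phi> < \<infinity>" "msq M (\<lambda>\<omega>. e + Z \<omega>) < \<infinity>"
proof -
  show *: "msq lborel \<phi> < \<infinity>"
    using ito_isometry_inner[OF assms assms] by (simp add: msq_eq_integral power2_norm_eq_inner)
  then show "msq M (\<lambda>\<omega>. e + Z \<omega>) < \<infinity>"
    unfolding ito_isometry[OF assms] by (simp add: less_top)
qed

text \<open>The closure in L2 of constants plus simple integrals, formulated without a kernel. This
  makes closedness and algebraic stability immediate; the kernel is recovered once, in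
  \<open>gaussian_linear_wiener_integral\<close>.\<close>

definition gaussian_linear :: "('w \<Rightarrow> real^'r::finite) \<Rightarrow> bool" where
  "gaussian_linear Z \<longleftrightarrow> Z \<in> borel_measurable M \<and>
    (\<forall>\<epsilon>>0. \<exists>\<phi> I c. simple_integral W T \<phi> I \<and> msq M (\<lambda>\<omega>. Z \<omega> - (c + I \<omega>)) < ennreal \<epsilon>)"

lemma gaussian_linearD: "gaussian_linear Z \<Longrightarrow> Z \<in> borel_measurable M"
  by (simp add: gaussian_linear_def)

lemma gaussian_linear_msq:
  assumes "gaussian_linear Z"
  shows "msq M Z < \<infinity>"
proof -
  obtain \<phi> I c where *: "simple_integral W T \<phi> I" "msq M (\<lambda>\<omega>. Z \<omega> - (c + I \<omega>)) < ennreal 1"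
    using assms unfolding gaussian_linear_def by (meson zero_less_one)
  have [measurable]: "I \<in> borel_measurable M" "Z \<in> borel_measurable M"
    using * assms simple_integral_random by (auto simp: gaussian_linear_def)
  have "msq M (\<lambda>\<omega>. (Z \<omega> - (c + I \<omega>)) + (c + I \<omega>)) \<le>
    2 * msq M (\<lambda>\<omega>. Z \<omega> - (c + I \<omega>)) + 2 * msq M (\<lambda>\<omega>. c + I \<omega>)"
    by (rule msq_add) measurable
  also have "\<dots> < \<infinity>" using *(2) simple_integral_msq_finite(2)[OF *(1), of c]
    by (auto simp: ennreal_mult_less_top intro: order.strict_trans)
  finally show ?thesis by simp
qed

lemma gaussian_linear_limit:
  assumes Z: "Z \<in> borel_measurable M"
    and "\<And>\<epsilon>. \<epsilon> > 0 \<Longrightarrow> \<exists>Y. gaussian_linear Y \<and> msq M (\<lambda>\<omega>. Z \<omega> - Y \<omega>) < ennreal \<epsilon>"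
  shows "gaussian_linear Z"
  unfolding gaussian_linear_def
proof (intro conjI allI impI Z)
  fix \<epsilon> :: real assume "\<epsilon> > 0"
  then obtain Y where Y: "gaussian_linear Y" "msq M (\<lambda>\<omega>. Z \<omega> - Y \<omega>) < ennreal (\<epsilon>/4)"
    using assms(2)[of "\<epsilon>/4"] by auto
  obtain \<phi> I c where *: "simple_integral W T \<phi> I" "msq M (\<lambda>\<omega>. Y \<omega> - (c + I \<omega>)) < ennreal (\<epsilon>/4)"
    using Y(1) \<open>\<epsilon> > 0\<close> unfolding gaussian_linear_def by (meson divide_pos_pos zero_less_numeral)
  have [measurable]: "I \<in> borel_measurable M" "Z \<in> borel_measurable M" "Y \<in> borel_measurable M"
    using * Y Z simple_integral_random by (auto simp: gaussian_linear_def)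
  have "msq M (\<lambda>\<omega>. (Z \<omega> - Y \<omega>) + (Y \<omega> - (c + I \<omega>))) < ennreal \<epsilon>"
    using Y(2) *(2) by (intro msq_add_less) measurable
  also have "(\<lambda>\<omega>. (Z \<omega> - Y \<omega>) + (Y \<omega> - (c + I \<omega>))) = (\<lambda>\<omega>. Z \<omega> - (c + I \<omega>))"
    by (simp add: fun_eq_iff)
  finally show "\<exists>\<phi> I c. simple_integral W T \<phi> I \<and> msq M (\<lambda>\<omega>. Z \<omega> - (c + I \<omega>)) < ennreal \<epsilon>"
    using *(1) by (intro exI[of _ \<phi>] exI[of _ I] exI[of _ c]) simp
qed

lemma gaussian_linear_const: "gaussian_linear (\<lambda>_. e)"
  unfolding gaussian_linear_def
  by (intro conjI allI impI exI[of _ "\<lambda>_. 0"] exI[of _ e] simple_integral.zero) (simp_all add: msq_def)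

lemma gaussian_linear_add:
  assumes Z: "gaussian_linear Z" and Y: "gaussian_linear Y"
  shows "gaussian_linear (\<lambda>\<omega>. Z \<omega> + Y \<omega>)"
  unfolding gaussian_linear_def
proof (intro conjI allI impI)
  have [measurable]: "Z \<in> borel_measurable M" "Y \<in> borel_measurable M"
    using Y Z by (auto simp: gaussian_linear_def)
  show "(\<lambda>\<omega>. Z \<omega> + Y \<omega>) \<in> borel_measurable M" by measurable
  fix \<epsilon> :: real assume "\<epsilon> > 0"
  then obtain \<phi> I c \<psi> J d where *: "simple_integral W T \<phi> I" "msq M (\<lambda>\<omega>. Z \<omega> - (c + I \<omega>)) < ennreal (\<epsilon>/4)"
     "simple_integral W T \<psi> J" "msq M (\<lambda>\<omega>. Y \<omega> - (d + J \<omega>)) < ennreal (\<epsilon>/4)"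
    using Y Z unfolding gaussian_linear_def by (meson divide_pos_pos zero_less_numeral)
  have [measurable]: "I \<in> borel_measurable M" "J \<in> borel_measurable M"
    using * simple_integral_random by auto
  have "msq M (\<lambda>\<omega>. (Z \<omega> - (c + I \<omega>)) + (Y \<omega> - (d + J \<omega>))) < ennreal \<epsilon>"
    using *(2,4) by (intro msq_add_less) measurable
  then have "msq M (\<lambda>\<omega>. Z \<omega> + Y \<omega> - ((c + d) + (I \<omega> + J \<omega>))) < ennreal \<epsilon>"
    by (simp add: algebra_simps)
  then show "\<exists>\<phi> I c. simple_integral W T \<phi> I \<and> msq M (\<lambda>\<omega>. Z \<omega> + Y \<omega> - (c + I \<omega>)) < ennreal \<epsilon>"
    using simple_integral_add[OF *(1,3)] by blast
qed

lemma gaussian_linear_matrix_mult: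
  fixes A :: "real^'r::finite^'q::finite"
  assumes Z: "gaussian_linear Z"
  shows "gaussian_linear (\<lambda>\<omega>. A *v Z \<omega>)"
  unfolding gaussian_linear_def
proof (intro conjI allI impI)
  have [measurable]: "Z \<in> borel_measurable M"
    using Z by (auto simp: gaussian_linear_def)
  show "(\<lambda>\<omega>. A *v Z \<omega>) \<in> borel_measurable M" by measurable
  \<comment> \<open>The added 1 keeps the divisor positive when A is 0.\<close>
  define B where "B = (onorm ((*v) A))\<^sup>2 + 1"
  have B: "B > 0" "(onorm ((*v) A))\<^sup>2 \<le> B" by (auto simp: B_def add_nonneg_pos)
  fix \<epsilon> :: real assume "\<epsilon> > 0"
  then obtain \<phi> I c where *: "simple_integral W T \<phi> I" "msq M (\<lambda>\<omega>. Z \<omega> - (c + I \<omega>)) < ennreal (\<epsilon>/B)"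
    using Z B unfolding gaussian_linear_def by (meson divide_pos_pos)
  have [measurable]: "I \<in> borel_measurable M"
    using * simple_integral_random by auto
  have "msq M (\<lambda>\<omega>. A *v (Z \<omega> - (c + I \<omega>))) \<le> ennreal ((onorm ((*v) A))\<^sup>2) * msq M (\<lambda>\<omega>. Z \<omega> - (c + I \<omega>))"
    by (rule msq_matrix_mult) measurable
  also have "\<dots> \<le> ennreal B * msq M (\<lambda>\<omega>. Z \<omega> - (c + I \<omega>))"
    using B by (intro mult_right_mono ennreal_leI) auto
  also have "\<dots> < ennreal B * ennreal (\<epsilon>/B)"
    using * B by (intro ennreal_mult_strict_left_mono) auto
  also have "\<dots> = ennreal \<epsilon>"
    using \<open>\<epsilon> > 0\<close> B by (simp flip: ennreal_mult')
  finally have "msq M (\<lambda>\<omega>. A *v Z \<omega> - (A *v c + A *v I \<omega>)) < ennreal \<epsilon>"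
    by (simp add: matrix_vector_right_distrib matrix_vector_mult_diff_distrib)
  then show "\<exists>\<phi> I c. simple_integral W T \<phi> I \<and> msq M (\<lambda>\<omega>. A *v Z \<omega> - (c + I \<omega>)) < ennreal \<epsilon>"
    using simple_integral_matrix_mult[OF *(1), of A] by blast
qed

lemma gaussian_linear_scaleR: "gaussian_linear Z \<Longrightarrow> gaussian_linear (\<lambda>\<omega>. r *\<^sub>R Z \<omega>)"
  using gaussian_linear_matrix_mult[of Z "r *\<^sub>R mat 1"] by (simp add: scaleR_matrix_vector_assoc[symmetric])

lemma step_integral_approx_simple:
  assumes "\<forall>j<m. a \<le> \<tau> j \<and> \<tau> j \<le> \<tau> (Suc j) \<and> \<tau> (Suc j) \<le> b" "0 \<le> a" "b \<le> T"
  shows "simple_integral W T (step_fun m \<tau> c) (step_integral W m \<tau> c)"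
  by (rule simple_integral_step) (use assms in fastforce)

lemma wiener_integral_gaussian_linear:
  assumes "wiener_integral M W a b f Z" "0 \<le> a" "b \<le> T"
  shows "gaussian_linear Z"
  unfolding gaussian_linear_def
proof (intro conjI allI impI)
  show Z: "Z \<in> borel_measurable M" using assms(1) by (simp add: wiener_integral_def)
  fix \<epsilon> :: real assume "\<epsilon> > 0"
  obtain m \<tau> c where *: "\<And>q. \<forall>j<m q. a \<le> \<tau> q j \<and> \<tau> q j \<le> \<tau> q (Suc j) \<and> \<tau> q (Suc j) \<le> b"
    "(\<lambda>q. msq M (\<lambda>\<omega>. step_integral W (m q) (\<tau> q) (c q) \<omega> - Z \<omega>)) \<longlonglongrightarrow> 0"
    using assms(1) unfolding wiener_integral_def msq_def by auto
  have "\<forall>\<^sub>F q in sequentially. msq M (\<lambda>\<omega>. step_integral W (m q) (\<tau> q) (c q) \<omega> - Z \<omega>) < ennreal \<epsilon>"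
    using \<open>\<epsilon> > 0\<close> by (intro order_tendstoD(2)[OF *(2)]) auto
  then obtain q where q: "msq M (\<lambda>\<omega>. step_integral W (m q) (\<tau> q) (c q) \<omega> - Z \<omega>) < ennreal \<epsilon>"
    by (auto simp: eventually_sequentially)
  have "msq M (\<lambda>\<omega>. Z \<omega> - (0 + step_integral W (m q) (\<tau> q) (c q) \<omega>)) < ennreal \<epsilon>"
    using q by (simp add: msq_def norm_minus_commute)
  then show "\<exists>\<phi> I c. simple_integral W T \<phi> I \<and> msq M (\<lambda>\<omega>. Z \<omega> - (c + I \<omega>)) < ennreal \<epsilon>"
    using step_integral_approx_simple[OF *(1)[of q] assms(2,3)] by blast
qed

text \<open>The constant 4 comes from two uses of the crude triangle inequality, one between Z and
  the step integrals and one between the step functions and f. It is harmless, as only boundedness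
  in time is wanted.\<close>

lemma wiener_integral_msq_le:
  assumes "wiener_integral M W a b f Z" "0 \<le> a" "b \<le> T"
  shows "msq M Z \<le> 4 * (\<integral>\<^sup>+s\<in>{a..b}. ennreal ((norm (f s))\<^sup>2) \<partial>lborel)"
proof -
  have Z[measurable]: "Z \<in> borel_measurable M" using assms(1) by (simp add: wiener_integral_def)
  have f[measurable]: "(\<lambda>s. indicat_real {a..b} s *\<^sub>R f s) \<in> borel_measurable borel"
    using assms(1) by (simp add: wiener_integral_def set_borel_measurable_def)
  obtain m \<tau> c where *: "\<And>q. \<forall>j<m q. a \<le> \<tau> q j \<and> \<tau> q j \<le> \<tau> q (Suc j) \<and> \<tau> q (Suc j) \<le> b"
    "(\<lambda>q. \<integral>\<^sup>+s\<in>{a..b}. ennreal ((norm (step_fun (m q) (\<tau> q) (c q) s - f s))\<^sup>2) \<partial>lborel) \<longlonglongrightarrow> 0"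
    "(\<lambda>q. msq M (\<lambda>\<omega>. step_integral W (m q) (\<tau> q) (c q) \<omega> - Z \<omega>)) \<longlonglongrightarrow> 0"
    using assms(1) unfolding wiener_integral_def msq_def by auto
  define F where "F = (\<lambda>s. indicat_real {a..b} s *\<^sub>R f s)"
  have F[measurable]: "F \<in> borel_measurable borel" using f by (simp add: F_def)
  have fF: "(\<integral>\<^sup>+s\<in>{a..b}. ennreal ((norm (f s))\<^sup>2) \<partial>lborel) = msq lborel F"
    unfolding msq_def F_def by (intro nn_integral_cong) (auto simp: indicator_def)
  let ?\<phi> = "\<lambda>q. step_fun (m q) (\<tau> q) (c q)" and ?I = "\<lambda>q. step_integral W (m q) (\<tau> q) (c q)"
  have si: "simple_integral W T (?\<phi> q) (?I q)" for q
    by (rule step_integral_approx_simple[OF *(1) assms(2,3)])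
  have le: "msq M Z \<le> 2 * msq M (\<lambda>\<omega>. ?I q \<omega> - Z \<omega>) +
     2 * (2 * (\<integral>\<^sup>+s\<in>{a..b}. ennreal ((norm (?\<phi> q s - f s))\<^sup>2) \<partial>lborel) + 2 * msq lborel F)" for q
  proof -
    have [measurable]: "?I q \<in> borel_measurable M" by (rule simple_integral_random[OF si])
    have [measurable]: "?\<phi> q \<in> borel_measurable borel" by (rule simple_integral_measurable[OF si])
    \<comment> \<open>All cells lie in [a,b], so the distance to the zero extension F over the whole
      line is the distance to f over [a,b].\<close>
    have 0: "?\<phi> q s = 0" if "s \<notin> {a..b}" for s
      using *(1)[of q] that unfolding step_fun_def by (intro sum.neutral) (fastforce split: split_indicator)
    have "msq M Z = msq M (\<lambda>\<omega>. ?I q \<omega> - (?I q \<omega> - Z \<omega>))" by simp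
    also have "\<dots> \<le> 2 * msq M (?I q) + 2 * msq M (\<lambda>\<omega>. ?I q \<omega> - Z \<omega>)"
      by (intro msq_diff) measurable
    also have "msq M (?I q) = msq lborel (?\<phi> q)"
      using ito_isometry[OF si, of 0] by simp
    also have "msq lborel (?\<phi> q) = msq lborel (\<lambda>s. (?\<phi> q s - F s) + F s)" by simp
    also have "\<dots> \<le> 2 * msq lborel (\<lambda>s. ?\<phi> q s - F s) + 2 * msq lborel F"
      by (intro msq_add) measurable
    also have "msq lborel (\<lambda>s. ?\<phi> q s - F s) =
      (\<integral>\<^sup>+s\<in>{a..b}. ennreal ((norm (?\<phi> q s - f s))\<^sup>2) \<partial>lborel)"
      unfolding msq_def F_def using 0 by (intro nn_integral_cong) (auto simp: indicator_def)
    finally show ?thesis by (simp add: add.commute mult_left_mono)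
  qed
  have "(\<lambda>q. 2 * msq M (\<lambda>\<omega>. ?I q \<omega> - Z \<omega>) +
     2 * (2 * (\<integral>\<^sup>+s\<in>{a..b}. ennreal ((norm (?\<phi> q s - f s))\<^sup>2) \<partial>lborel) + 2 * msq lborel F))
    \<longlonglongrightarrow> 2 * 0 + 2 * (2 * 0 + 2 * msq lborel F)"
    by (intro tendsto_intros ennreal_tendsto_cmult *) auto
  then have "msq M Z \<le> 2 * 0 + 2 * (2 * 0 + 2 * msq lborel F)"
    by (rule tendsto_lowerbound) (use le in auto)
  also have "\<dots> = 4 * msq lborel F" by (simp add: mult.assoc[symmetric])
  finally show ?thesis unfolding fF .
qed

end

section \<open>Completeness and time integration\<close>

lemma nn_integral_norm_sq_le:
  assumes [measurable]: "f \<in> borel_measurable N"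
  shows "(\<integral>\<^sup>+x. ennreal (norm (f x)) \<partial>N)\<^sup>2 \<le> emeasure N (space N) * msq N f"
  using Cauchy_Schwarz_nn_integral[of "\<lambda>x. ennreal (norm (f x))" N "\<lambda>_. 1"]
  by (simp add: msq_def ennreal_power mult.commute)

text \<open>The default value 0 of a divergent Bochner integral makes this form of Cauchy-Schwarz
  unconditional, so it applies to every single path.\<close>

lemma norm_integral_sq_le:
  fixes f :: "'a \<Rightarrow> 'b::{banach, second_countable_topology}"
  assumes [measurable]: "f \<in> borel_measurable N"
  shows "ennreal ((norm (\<integral>x. f x \<partial>N))\<^sup>2) \<le> emeasure N (space N) * msq N f"
proof (cases "integrable N f")
  case True
  have "ennreal ((norm (\<integral>x. f x \<partial>N))\<^sup>2) = (ennreal (norm (\<integral>x. f x \<partial>N)))\<^sup>2"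
    by (simp add: ennreal_power)
  also have "\<dots> \<le> (\<integral>\<^sup>+x. ennreal (norm (f x)) \<partial>N)\<^sup>2"
    using integral_norm_bound_ennreal[OF True] by (rule power_mono) simp
  also have "\<dots> \<le> emeasure N (space N) * msq N f" by (rule nn_integral_norm_sq_le) measurable
  finally show ?thesis .
qed (simp add: not_integrable_integral_eq)

lemma (in finite_measure) msq_finite_integrable:
  fixes f :: "'a \<Rightarrow> 'b::{banach, second_countable_topology}"
  assumes [measurable]: "f \<in> borel_measurable M" and "msq M f < \<infinity>"
  shows "integrable M f"
proof (rule integrableI_bounded)
  have "(\<integral>\<^sup>+x. ennreal (norm (f x)) \<partial>M)\<^sup>2 \<le> emeasure M (space M) * msq M f"
    by (rule nn_integral_norm_sq_le) measurable
  also have "\<dots> < \<infinity>" using assms(2) by (auto simp: ennreal_mult_eq_top_iff emeasure_eq_measure less_top[symmetric])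
  finally show "(\<integral>\<^sup>+x. ennreal (norm (f x)) \<partial>M) < \<infinity>" by (simp add: power_less_top_ennreal)
qed measurable

text \<open>On a finite measure an L2 Cauchy sequence is L1 Cauchy and so has an almost everywhere
  convergent subsequence. Fatou's lemma along that subsequence turns the pointwise limit into an L2
  limit of the full sequence.\<close>

lemma (in finite_measure) L2_complete:
  fixes \<phi> :: "nat \<Rightarrow> 'a \<Rightarrow> 'b::{banach, second_countable_topology}"
  assumes [measurable]: "\<And>q. \<phi> q \<in> borel_measurable M"
    and fin: "\<And>q. msq M (\<phi> q) < \<infinity>"
    and cauchy: "\<And>\<epsilon>. \<epsilon> > 0 \<Longrightarrow> \<exists>Q. \<forall>q\<ge>Q. \<forall>r\<ge>Q. msq M (\<lambda>x. \<phi> q x - \<phi> r x) < ennreal \<epsilon>"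
  obtains f where "f \<in> borel_measurable M" "(\<lambda>q. msq M (\<lambda>x. \<phi> q x - f x)) \<longlonglongrightarrow> 0"
proof -
  \<comment> \<open>A strictly positive bound of the total mass, so that epsilon^2 / B makes sense
    also for the null measure.\<close>
  define B where "B = measure M (space M) + 1"
  have B: "B > 0" "emeasure M (space M) \<le> ennreal B"
    by (auto simp: B_def emeasure_eq_measure add_nonneg_pos intro!: ennreal_leI)
  have "\<exists>Q. \<forall>q\<ge>Q. \<forall>r\<ge>Q. LINT x|M. norm (\<phi> q x - \<phi> r x) < \<epsilon>" if \<epsilon>: "\<epsilon> > 0" for \<epsilon>
  proof -
    obtain Q where Q: "\<And>q r. q \<ge> Q \<Longrightarrow> r \<ge> Q \<Longrightarrow> msq M (\<lambda>x. \<phi> q x - \<phi> r x) < ennreal (\<epsilon>\<^sup>2 / B)"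
      using cauchy[of "\<epsilon>\<^sup>2 / B"] \<epsilon> B(1) by (auto simp del: ennreal_divide_numeral)
    have "LINT x|M. norm (\<phi> q x - \<phi> r x) < \<epsilon>" if "q \<ge> Q" "r \<ge> Q" for q r
    proof -
      have "ennreal ((norm (\<integral>x. norm (\<phi> q x - \<phi> r x) \<partial>M))\<^sup>2) \<le> emeasure M (space M) * msq M (\<lambda>x. norm (\<phi> q x - \<phi> r x))"
        by (rule norm_integral_sq_le) measurable
      also have "msq M (\<lambda>x. norm (\<phi> q x - \<phi> r x)) = msq M (\<lambda>x. \<phi> q x - \<phi> r x)" by (rule msq_cong) simp
      also have "emeasure M (space M) * msq M (\<lambda>x. \<phi> q x - \<phi> r x) \<le> ennreal B * msq M (\<lambda>x. \<phi> q x - \<phi> r x)"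
        by (intro mult_right_mono B) simp
      also have "\<dots> < ennreal B * ennreal (\<epsilon>\<^sup>2 / B)"
        using Q[OF that] B by (intro ennreal_mult_strict_left_mono) auto
      also have "\<dots> = ennreal (\<epsilon>\<^sup>2)" using B by (simp flip: ennreal_mult')
      finally have "(\<integral>x. norm (\<phi> q x - \<phi> r x) \<partial>M)\<^sup>2 < \<epsilon>\<^sup>2" by (simp add: ennreal_less_iff)
      then show ?thesis by (rule power2_less_imp_less) (use \<open>\<epsilon> > 0\<close> in simp)
    qed
    then show ?thesis by blast
  qed
  moreover have "integrable M (\<phi> q)" for q by (intro msq_finite_integrable fin) measurable
  ultimately obtain r where r: "strict_mono r" "AE x in M. Cauchy (\<lambda>i. \<phi> (r i) x)"
    using cauchy_L1_AE_cauchy_subseq[of M \<phi>] by blast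
  define f where "f = (\<lambda>x. lim (\<lambda>i. \<phi> (r i) x))"
  have [measurable]: "f \<in> borel_measurable M" unfolding f_def by measurable
  have lim: "AE x in M. (\<lambda>i. \<phi> (r i) x) \<longlonglongrightarrow> f x"
    using r(2) by eventually_elim (simp add: f_def Cauchy_convergent_iff convergent_LIMSEQ_iff)
  \<comment> \<open>Fatou: a distance bound from the q-th term to all late terms passes to the limit
    f.\<close>
  have bound: "msq M (\<lambda>x. \<phi> q x - f x) \<le> ennreal \<epsilon>"
    if "\<And>i. i \<ge> Q \<Longrightarrow> msq M (\<lambda>x. \<phi> q x - \<phi> i x) \<le> ennreal \<epsilon>" for q Q \<epsilon>
  proof -
    have "msq M (\<lambda>x. \<phi> q x - f x) = (\<integral>\<^sup>+x. liminf (\<lambda>i. ennreal ((norm (\<phi> q x - \<phi> (r i) x))\<^sup>2)) \<partial>M)"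
      unfolding msq_def
    proof (rule nn_integral_cong_AE)
      show "AE x in M. ennreal ((norm (\<phi> q x - f x))\<^sup>2) = liminf (\<lambda>i. ennreal ((norm (\<phi> q x - \<phi> (r i) x))\<^sup>2))"
        using lim
      proof eventually_elim
        case (elim x)
        then have "(\<lambda>i. ennreal ((norm (\<phi> q x - \<phi> (r i) x))\<^sup>2)) \<longlonglongrightarrow> ennreal ((norm (\<phi> q x - f x))\<^sup>2)"
          by (intro tendsto_ennrealI tendsto_intros)
        from lim_imp_Liminf[OF _ this] show ?case by simp
      qed
    qed
    also have "\<dots> \<le> liminf (\<lambda>i. msq M (\<lambda>x. \<phi> q x - \<phi> (r i) x))"
      unfolding msq_def by (rule nn_integral_liminf) measurable
    also have "\<dots> \<le> liminf (\<lambda>i. ennreal \<epsilon>)"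
    proof (rule Liminf_mono)
      have "\<forall>\<^sub>F i in sequentially. r i \<ge> Q"
        using filterlim_subseq[OF r(1)] by (auto simp: filterlim_at_top)
      then show "\<forall>\<^sub>F i in sequentially. msq M (\<lambda>x. \<phi> q x - \<phi> (r i) x) \<le> ennreal \<epsilon>"
        by eventually_elim (rule that)
    qed
    finally show ?thesis by (simp add: Liminf_const)
  qed
  have "(\<lambda>q. msq M (\<lambda>x. \<phi> q x - f x)) \<longlonglongrightarrow> 0"
  proof (rule order_tendstoI)
    fix a :: ennreal assume "0 < a"
    then obtain b where b: "0 < b" "b < a" using dense by blast
    then obtain \<epsilon> where "b = ennreal \<epsilon>" "0 \<le> \<epsilon>" by (cases b) auto
    with b have \<epsilon>: "0 < \<epsilon>" "ennreal \<epsilon> < a" by auto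
    obtain Q where Q: "\<And>q r. q \<ge> Q \<Longrightarrow> r \<ge> Q \<Longrightarrow> msq M (\<lambda>x. \<phi> q x - \<phi> r x) < ennreal \<epsilon>"
      using cauchy[OF \<epsilon>(1)] by auto
    have "msq M (\<lambda>x. \<phi> q x - f x) < a" if "q \<ge> Q" for q
      using bound[of Q q \<epsilon>] Q[OF that] \<epsilon>(2) by (meson order.strict_trans1 less_imp_le)
    then show "\<forall>\<^sub>F q in sequentially. msq M (\<lambda>x. \<phi> q x - f x) < a"
      by (auto simp: eventually_sequentially)
  qed simp
  then show thesis by (intro that[of f]) measurable
qed

section \<open>Recovering the kernel of an L2 limit\<close>

context noise_space begin

text \<open>The isometry is used backwards. If c_q + I_q converges to Z, the squared distances of
  the constants and of the kernels add up to the squared distance of the approximations, so both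
  sequences are Cauchy. Their limits are the constant and the kernel for Z.\<close>

lemma gaussian_linear_wiener_integral:
  fixes Z :: "'w \<Rightarrow> real^'r::finite"
  assumes "gaussian_linear Z"
  shows "\<exists>f c. wiener_integral M W 0 T f (\<lambda>\<omega>. Z \<omega> - c)"
proof -
  have Z[measurable]: "Z \<in> borel_measurable M" using assms by (simp add: gaussian_linear_def)
  define \<delta> where "\<delta> q = inverse (real (Suc q))" for q
  have \<delta>: "\<delta> q > 0" "\<delta> \<longlonglongrightarrow> 0" for q
    unfolding \<delta>_def by (simp, rule LIMSEQ_inverse_real_of_nat)
  have "\<exists>\<phi> I c. simple_integral W T \<phi> I \<and> msq M (\<lambda>\<omega>. Z \<omega> - (c + I \<omega>)) < ennreal (\<delta> q)" for q
    using assms \<delta>(1)[of q] unfolding gaussian_linear_def by blast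
  then obtain \<phi> I c where si: "\<And>q. simple_integral W T (\<phi> q) (I q)"
    and close: "\<And>q. msq M (\<lambda>\<omega>. Z \<omega> - (c q + I q \<omega>)) < ennreal (\<delta> q)" by metis
  have [measurable]: "\<And>q. I q \<in> borel_measurable M" by (rule simple_integral_random[OF si])
  have [measurable]: "\<And>q. \<phi> q \<in> borel_measurable borel" by (rule simple_integral_measurable[OF si])
  \<comment> \<open>Both approximations are within epsilon/4 of Z in \<open>msq\<close>, so
    \<open>msq_add_less\<close> brings them within epsilon of each other, and the isometry splits
    this distance.\<close>
  have diff: "ennreal ((norm (c q - c r))\<^sup>2) + msq lborel (\<lambda>s. \<phi> q s - \<phi> r s) < ennreal \<epsilon>"
    if "\<delta> q \<le> \<epsilon>/4" "\<delta> r \<le> \<epsilon>/4" for q r \<epsilon>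
  proof -
    have "ennreal ((norm (c q - c r))\<^sup>2) + msq lborel (\<lambda>s. \<phi> q s - \<phi> r s) =
      msq M (\<lambda>\<omega>. (c q - c r) + (I q \<omega> - I r \<omega>))"
      using ito_isometry[OF simple_integral_diff[OF si si]] by simp
    also have "\<dots> = msq M (\<lambda>\<omega>. (Z \<omega> - (c r + I r \<omega>)) + - (Z \<omega> - (c q + I q \<omega>)))"
      by (rule msq_cong) (simp add: algebra_simps)
    also have "\<dots> < ennreal \<epsilon>"
    proof (rule msq_add_less)
      show "msq M (\<lambda>\<omega>. Z \<omega> - (c r + I r \<omega>)) < ennreal (\<epsilon>/4)"
        using close[of r] ennreal_leI[OF that(2)] by (rule order.strict_trans2)
      have "msq M (\<lambda>\<omega>. - (Z \<omega> - (c q + I q \<omega>))) = msq M (\<lambda>\<omega>. Z \<omega> - (c q + I q \<omega>))"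
        by (rule msq_cong) (simp add: norm_minus_commute)
      also have "\<dots> < ennreal (\<epsilon>/4)"
        using close[of q] ennreal_leI[OF that(1)] by (rule order.strict_trans2)
      finally show "msq M (\<lambda>\<omega>. - (Z \<omega> - (c q + I q \<omega>))) < ennreal (\<epsilon>/4)" .
    qed measurable
    finally show ?thesis .
  qed
  have ev: "\<exists>Q. \<forall>q\<ge>Q. \<delta> q \<le> \<epsilon>" if "\<epsilon> > 0" for \<epsilon>
    using order_tendstoD(2)[OF \<delta>(2) that] by (auto simp: eventually_sequentially intro: less_imp_le)
  have "Cauchy c"
  proof (rule metric_CauchyI)
    fix e :: real assume "e > 0"
    then obtain Q where Q: "\<And>q. q \<ge> Q \<Longrightarrow> \<delta> q \<le> e\<^sup>2/4" using ev[of "e\<^sup>2/4"] by auto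
    have "dist (c q) (c r) < e" if "q \<ge> Q" "r \<ge> Q" for q r
    proof -
      have "ennreal ((norm (c q - c r))\<^sup>2) < ennreal (e\<^sup>2)"
        using diff[OF Q Q, OF that] by (rule order.strict_trans1[rotated]) simp
      then have "(norm (c q - c r))\<^sup>2 < e\<^sup>2" by (simp add: ennreal_less_iff)
      then have "norm (c q - c r) < e" by (rule power2_less_imp_less) (use \<open>e > 0\<close> in simp)
      then show ?thesis by (simp add: dist_norm)
    qed
    then show "\<exists>Q. \<forall>q\<ge>Q. \<forall>r\<ge>Q. dist (c q) (c r) < e" by blast
  qed
  then obtain d where d: "c \<longlonglongrightarrow> d" by (auto simp: Cauchy_convergent_iff convergent_def)
  \<comment> \<open>Completeness is available on finite measures, so the kernels are compared over
    [0,T]. Passing from \<open>lborel\<close> to N can only decrease \<open>msq\<close>, which keeps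
    the Cauchy estimate.\<close>
  define N where "N = density lborel (indicator {0..T} :: real \<Rightarrow> ennreal)"
  have N_msq: "msq N g = (\<integral>\<^sup>+s\<in>{0..T}. ennreal ((norm (g s))\<^sup>2) \<partial>lborel)"
    if "g \<in> borel_measurable borel" for g :: "real \<Rightarrow> real^('p option \<times> 'd)^'r"
    using that unfolding msq_def N_def by (subst nn_integral_density) (auto simp: mult.commute)
  have N_le: "msq N g \<le> msq lborel g"
    if "g \<in> borel_measurable borel" for g :: "real \<Rightarrow> real^('p option \<times> 'd)^'r"
    unfolding N_msq[OF that] unfolding msq_def by (intro nn_integral_mono) (auto simp: indicator_def)
  have sets_N[measurable_cong]: "sets N = sets borel" by (simp add: N_def)
  interpret N: finite_measure N
    by standard (simp add: N_def emeasure_density T_nonneg)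
  obtain f where f: "f \<in> borel_measurable N" "(\<lambda>q. msq N (\<lambda>x. \<phi> q x - f x)) \<longlonglongrightarrow> 0"
  proof (rule N.L2_complete[of \<phi>])
    show "\<phi> q \<in> borel_measurable N" for q by measurable
    have "msq N (\<phi> q) \<le> msq lborel (\<phi> q)" for q by (rule N_le) measurable
    then show "msq N (\<phi> q) < \<infinity>" for q
      using simple_integral_msq_finite(1)[OF si] by (rule order.strict_trans1)
    fix \<epsilon> :: real assume "\<epsilon> > 0"
    then obtain Q where Q: "\<And>q. q \<ge> Q \<Longrightarrow> \<delta> q \<le> \<epsilon>/4" using ev[of "\<epsilon>/4"] by auto
    have "msq N (\<lambda>x. \<phi> q x - \<phi> r x) < ennreal \<epsilon>" if "q \<ge> Q" "r \<ge> Q" for q r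
    proof -
      have "msq N (\<lambda>x. \<phi> q x - \<phi> r x) \<le> msq lborel (\<lambda>x. \<phi> q x - \<phi> r x)" by (rule N_le) measurable
      also have "\<dots> < ennreal \<epsilon>"
        using diff[OF Q Q, OF that] by (rule order.strict_trans1[rotated]) simp
      finally show ?thesis .
    qed
    then show "\<exists>Q. \<forall>q\<ge>Q. \<forall>r\<ge>Q. msq N (\<lambda>x. \<phi> q x - \<phi> r x) < ennreal \<epsilon>" by blast
  qed
  have f'[measurable]: "f \<in> borel_measurable borel" using f(1) by measurable
  have f_fin: "msq N f < \<infinity>"
  proof -
    obtain q where q: "msq N (\<lambda>x. \<phi> q x - f x) < 1"
      using order_tendstoD(2)[OF f(2), of 1] by (auto simp: eventually_sequentially)
    have "msq N f = msq N (\<lambda>x. \<phi> q x - (\<phi> q x - f x))" by simp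
    also have "\<dots> \<le> 2 * msq N (\<phi> q) + 2 * msq N (\<lambda>x. \<phi> q x - f x)" by (rule msq_diff) measurable
    also have "\<dots> < \<infinity>"
      using q order.strict_trans1[OF N_le simple_integral_msq_finite(1)[OF si], of q]
      by (auto simp: ennreal_mult_less_top intro: order.strict_trans)
    finally show ?thesis .
  qed
  have "\<exists>m \<tau> a. (\<forall>j<m. 0 \<le> \<tau> j \<and> \<tau> j \<le> \<tau> (Suc j) \<and> \<tau> (Suc j) \<le> T) \<and>
      step_fun m \<tau> a = \<phi> q \<and> step_integral W m \<tau> a = I q" for q
    by (rule simple_integral_as_step[OF si T_nonneg, of q]) blast
  then obtain m \<tau> a where step: "\<And>q. \<forall>j<m q. 0 \<le> \<tau> q j \<and> \<tau> q j \<le> \<tau> q (Suc j) \<and> \<tau> q (Suc j) \<le> T"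
      "\<And>q. step_fun (m q) (\<tau> q) (a q) = \<phi> q" "\<And>q. step_integral W (m q) (\<tau> q) (a q) = I q"
    by metis
  have lim: "(\<lambda>q. msq M (\<lambda>\<omega>. I q \<omega> - (Z \<omega> - d))) \<longlonglongrightarrow> 0"
  proof (rule tendsto_sandwich[of "\<lambda>_. 0"])
    have "msq M (\<lambda>\<omega>. I q \<omega> - (Z \<omega> - d)) \<le> 2 * ennreal (\<delta> q) + 2 * ennreal ((norm (c q - d))\<^sup>2)" for q
    proof -
      have "msq M (\<lambda>\<omega>. I q \<omega> - (Z \<omega> - d)) = msq M (\<lambda>\<omega>. (Z \<omega> - (c q + I q \<omega>)) + (c q - d))"
        unfolding msq_def by (subst norm_minus_commute) (simp add: algebra_simps)
      also have "\<dots> \<le> 2 * msq M (\<lambda>\<omega>. Z \<omega> - (c q + I q \<omega>)) + 2 * msq M (\<lambda>\<omega>. c q - d)"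
        by (rule msq_add) measurable
      also have "msq M (\<lambda>\<omega>. c q - d) = ennreal ((norm (c q - d))\<^sup>2)"
        by (simp add: msq_def emeasure_space_1)
      also have "2 * msq M (\<lambda>\<omega>. Z \<omega> - (c q + I q \<omega>)) \<le> 2 * ennreal (\<delta> q)"
        using close[of q] by (intro mult_left_mono) auto
      finally show ?thesis by (simp add: add_right_mono)
    qed
    then show "\<forall>\<^sub>F q in sequentially. msq M (\<lambda>\<omega>. I q \<omega> - (Z \<omega> - d)) \<le>
      2 * ennreal (\<delta> q) + 2 * ennreal ((norm (c q - d))\<^sup>2)" by simp
    have "(\<lambda>q. ennreal ((norm (c q - d))\<^sup>2)) \<longlonglongrightarrow> ennreal ((norm (d - d))\<^sup>2)"
      by (intro tendsto_ennrealI tendsto_intros d)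
    then have c0: "(\<lambda>q. ennreal ((norm (c q - d))\<^sup>2)) \<longlonglongrightarrow> 0"
      unfolding diff_self norm_zero by (simp only: zero_power2 ennreal_0)
    have "(\<lambda>q. ennreal (\<delta> q)) \<longlonglongrightarrow> 0"
      using tendsto_ennrealI[OF \<delta>(2)] by (simp only: ennreal_0)
    then have "(\<lambda>q. 2 * ennreal (\<delta> q) + 2 * ennreal ((norm (c q - d))\<^sup>2)) \<longlonglongrightarrow> 2 * 0 + 2 * 0"
      by (intro tendsto_add ennreal_tendsto_cmult c0) (simp_all add: less_top[symmetric])
    then show "(\<lambda>q. 2 * ennreal (\<delta> q) + 2 * ennreal ((norm (c q - d))\<^sup>2)) \<longlonglongrightarrow> 0"
      by (simp only: mult_zero_right add_0)
  qed simp_all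
  have "wiener_integral M W 0 T f (\<lambda>\<omega>. Z \<omega> - d)"
    unfolding wiener_integral_def
  proof (intro conjI exI[of _ m] exI[of _ \<tau>] exI[of _ a])
    show "set_borel_measurable lborel {0..T} f" unfolding set_borel_measurable_def by measurable
    show "set_integrable lborel {0..T} (\<lambda>s. (norm (f s))\<^sup>2)"
      unfolding set_integrable_def
    proof (rule integrableI_bounded)
      have "(\<integral>\<^sup>+s. ennreal (norm (indicat_real {0..T} s *\<^sub>R (norm (f s))\<^sup>2)) \<partial>lborel) =
        (\<integral>\<^sup>+s\<in>{0..T}. ennreal ((norm (f s))\<^sup>2) \<partial>lborel)"
        by (intro nn_integral_cong) (auto simp: indicator_def)
      then show "(\<integral>\<^sup>+s. ennreal (norm (indicat_real {0..T} s *\<^sub>R (norm (f s))\<^sup>2)) \<partial>lborel) < \<infinity>"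
        using f_fin by (simp add: N_msq[OF f'])
    qed measurable
    show "(\<lambda>q. \<integral>\<^sup>+s\<in>{0..T}. ennreal ((norm (step_fun (m q) (\<tau> q) (a q) s - f s))\<^sup>2) \<partial>lborel) \<longlonglongrightarrow> 0"
      using f(2) by (simp add: N_msq step)
    show "(\<lambda>q. \<integral>\<^sup>+\<omega>. ennreal ((norm (step_integral W (m q) (\<tau> q) (a q) \<omega> - (Z \<omega> - d)))\<^sup>2) \<partial>M) \<longlonglongrightarrow> 0"
      using lim by (simp add: step msq_def)
  qed (use step in auto)
  then show ?thesis by blast
qed

end

section \<open>Stability under integration over a parameter\<close>

context noise_space begin

text \<open>Z has no regularity in s, so an average over sampled points has to replace Riemann sums.
  Independent random samples would have mean square error of order 1/n. At each step some s does
  nearly as well as the average over s, so a deterministic choice, one point after the other,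
  achieves this rate.\<close>

lemma gaussian_linear_integral:
  fixes Z :: "'s \<Rightarrow> 'w \<Rightarrow> real^'r::finite"
  assumes "finite_measure N"
    and Z[measurable]: "(\<lambda>(s, \<omega>). Z s \<omega>) \<in> borel_measurable (N \<Otimes>\<^sub>M M)"
    and fin: "(\<integral>\<^sup>+s. msq M (Z s) \<partial>N) < \<infinity>"
    and gl: "\<And>s. s \<in> space N \<Longrightarrow> gaussian_linear (Z s)"
  shows "gaussian_linear (\<lambda>\<omega>. \<integral>s. Z s \<omega> \<partial>N)"
proof -
  interpret N: finite_measure N by fact
  interpret P: pair_sigma_finite N M ..
  interpret PF: finite_measure "N \<Otimes>\<^sub>M M"
    by (rule finite_measure_pair_measure) (unfold_locales)
  define c where "c = measure N (space N)"
  define m where "m \<omega> = (\<integral>s. Z s \<omega> \<partial>N)" for \<omega>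
  have Z'[measurable]: "(\<lambda>(\<omega>, s). Z s \<omega>) \<in> borel_measurable (M \<Otimes>\<^sub>M N)"
    using measurable_pair_swap[OF Z] by (simp add: split_beta')
  have m[measurable]: "m \<in> borel_measurable M" unfolding m_def by measurable
  have emN: "emeasure N (space N) = ennreal c" by (simp add: c_def N.emeasure_eq_measure)
  have fub: "(\<integral>\<^sup>+\<omega>. msq N (\<lambda>s. Z s \<omega>) \<partial>M) = (\<integral>\<^sup>+s. msq M (Z s) \<partial>N)"
    unfolding msq_def by (rule P.Fubini') measurable
  show ?thesis
  proof (cases "c = 0")
    \<comment> \<open>For the null measure Cauchy-Schwarz with total mass 0 makes the integral
      vanish in mean square.\<close>
    case True
    have "msq M m \<le> (\<integral>\<^sup>+\<omega>. ennreal c * msq N (\<lambda>s. Z s \<omega>) \<partial>M)"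
      unfolding msq_def[of M] m_def emN[symmetric] by (intro nn_integral_mono norm_integral_sq_le) measurable
    also have "\<dots> = 0" by (simp add: True)
    finally have "msq M m = 0" by simp
    then have "msq M (\<lambda>\<omega>. m \<omega> - 0) < ennreal \<epsilon>" if "\<epsilon> > 0" for \<epsilon> using that by simp
    then show ?thesis
      unfolding m_def[symmetric] using gaussian_linear_const[of 0]
      by (intro gaussian_linear_limit m) auto
  next
    case False
    then have c: "c > 0" by (simp add: c_def less_le)
    have m_fin: "msq M m < \<infinity>"
    proof -
      have "msq M m \<le> (\<integral>\<^sup>+\<omega>. ennreal c * msq N (\<lambda>s. Z s \<omega>) \<partial>M)"
        unfolding msq_def[of M] m_def emN[symmetric] by (intro nn_integral_mono norm_integral_sq_le) measurable
      also have "\<dots> = ennreal c * (\<integral>\<^sup>+s. msq M (Z s) \<partial>N)"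
        unfolding fub[symmetric] unfolding msq_def by (rule nn_integral_cmult) measurable
      also have "\<dots> < \<infinity>" using fin by (simp add: ennreal_mult_less_top)
      finally show ?thesis .
    qed
    \<comment> \<open>The centred sample: under the probability N / c the variable c Z_s has mean
      m.\<close>
    define D where "D = (\<lambda>(s, \<omega>). c *\<^sub>R Z s \<omega> - m \<omega>)"
    have D[measurable]: "D \<in> borel_measurable (N \<Otimes>\<^sub>M M)" unfolding D_def by measurable
    have Zp: "msq (N \<Otimes>\<^sub>M M) (\<lambda>(s, \<omega>). Z s \<omega>) < \<infinity>"
      using fin unfolding msq_def by (subst nn_integral_fst[symmetric]) (simp_all add: split_beta')
    have lift: "msq (N \<Otimes>\<^sub>M M) (\<lambda>(s, \<omega>). R \<omega>) < \<infinity>"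
      if "R \<in> borel_measurable M" "msq M R < \<infinity>" for R :: "'w \<Rightarrow> real^'r"
    proof -
      have "msq (N \<Otimes>\<^sub>M M) (\<lambda>(s, \<omega>). R \<omega>) = msq M R * ennreal c"
        using that unfolding msq_def
        by (subst nn_integral_fst[symmetric]) (simp_all add: split_beta' emN)
      then show ?thesis using that by (simp add: ennreal_mult_less_top)
    qed
    have D_fin: "msq (N \<Otimes>\<^sub>M M) D < \<infinity>"
    proof -
      have "msq (N \<Otimes>\<^sub>M M) D = msq (N \<Otimes>\<^sub>M M) (\<lambda>p. c *\<^sub>R (case p of (s, \<omega>) \<Rightarrow> Z s \<omega>) - (case p of (s, \<omega>) \<Rightarrow> m \<omega>))"
        by (simp add: D_def split_beta')
      also have "\<dots> \<le> 2 * msq (N \<Otimes>\<^sub>M M) (\<lambda>p. c *\<^sub>R (case p of (s, \<omega>) \<Rightarrow> Z s \<omega>)) +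
        2 * msq (N \<Otimes>\<^sub>M M) (\<lambda>(s, \<omega>). m \<omega>)"
        by (rule msq_diff) measurable
      also have "msq (N \<Otimes>\<^sub>M M) (\<lambda>p. c *\<^sub>R (case p of (s, \<omega>) \<Rightarrow> Z s \<omega>)) =
        ennreal (c\<^sup>2) * msq (N \<Otimes>\<^sub>M M) (\<lambda>(s, \<omega>). Z s \<omega>)"
        by (rule msq_scaleR) measurable
      also have "2 * \<dots> + 2 * msq (N \<Otimes>\<^sub>M M) (\<lambda>(s, \<omega>). m \<omega>) < \<infinity>"
        using Zp lift[OF m m_fin] by (simp add: ennreal_mult_less_top)
      finally show ?thesis .
    qed
    define C where "C = (\<integral>p. (norm (D p))\<^sup>2 \<partial>(N \<Otimes>\<^sub>M M))"
    have C: "C \<ge> 0" by (simp add: C_def)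
    \<comment> \<open>Integrability of a path over N holds only almost surely, by Fubini. On such a
      path the integral of c Z and the integral of the constant m are both c m.\<close>
    have D_mean: "AE \<omega> in M. (\<integral>s. D (s, \<omega>) \<partial>N) = 0 \<and> integrable N (\<lambda>s. D (s, \<omega>))"
    proof -
      have "AE \<omega> in M. msq N (\<lambda>s. Z s \<omega>) \<noteq> \<infinity>"
      proof (rule nn_integral_PInf_AE)
        show "(\<lambda>\<omega>. msq N (\<lambda>s. Z s \<omega>)) \<in> borel_measurable M" unfolding msq_def by measurable
      qed (use fin in \<open>simp add: fub\<close>)
      with AE_space show ?thesis
      proof eventually_elim
        case (elim \<omega>)
        then have "integrable N (\<lambda>s. Z s \<omega>)"
          by (intro N.msq_finite_integrable) (auto simp: less_top)
        then show ?case by (simp add: D_def m_def c_def)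
      qed
    qed
    \<comment> \<open>Integrated over N the cross term of R and D_s vanishes, so the average
      increase of the mean square is C / c. If every s did worse than C / c + 1, integration would
      contradict this; the 1 is the slack that makes the contradiction strict.\<close>
    have step: "\<exists>s\<in>space N. msq M (\<lambda>\<omega>. R \<omega> + D (s, \<omega>)) \<le> msq M R + ennreal (C / c + 1)"
      if R[measurable]: "R \<in> borel_measurable M" and R_fin: "msq M R < \<infinity>" for R :: "'w \<Rightarrow> real^'r"
    proof (rule ccontr)
      assume contra: "\<not> ?thesis"
      define E where "E = (\<integral>\<omega>. (norm (R \<omega>))\<^sup>2 \<partial>M)"
      have E: "msq M R = ennreal E" "E \<ge> 0"
        by (simp_all add: E_def msq_eq_integral[OF msq_integrable[OF R R_fin]])
      let ?P = "N \<Otimes>\<^sub>M M"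
      have i1: "integrable ?P (\<lambda>(s, \<omega>). (norm (R \<omega>))\<^sup>2)"
        using msq_integrable[OF _ lift[OF R R_fin]] by (simp add: split_beta')
      have i2: "integrable ?P (\<lambda>p. (norm (D p))\<^sup>2)" by (rule msq_integrable[OF D D_fin])
      have i3: "integrable ?P (\<lambda>(s, \<omega>). R \<omega> \<bullet> D (s, \<omega>))"
      proof (rule Bochner_Integration.integrable_bound[OF Bochner_Integration.integrable_add[OF i1 i2]])
        have "\<bar>R \<omega> \<bullet> D (s, \<omega>)\<bar> \<le> (norm (R \<omega>))\<^sup>2 + (norm (D (s, \<omega>)))\<^sup>2" for s \<omega>
          using Cauchy_Schwarz_ineq2[of "R \<omega>" "D (s, \<omega>)"] sum_squares_bound[of "norm (R \<omega>)" "norm (D (s, \<omega>))"]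
            mult_nonneg_nonneg[OF norm_ge_zero[of "R \<omega>"] norm_ge_zero[of "D (s, \<omega>)"]]
          by linarith
        then show "AE x in ?P. norm (case x of (s, \<omega>) \<Rightarrow> R \<omega> \<bullet> D (s, \<omega>)) \<le>
          norm ((case x of (s, \<omega>) \<Rightarrow> (norm (R \<omega>))\<^sup>2) + (norm (D x))\<^sup>2)"
          by (intro AE_I2) (auto simp: split_beta')
      qed measurable
      have z: "(\<integral>p. (case p of (s, \<omega>) \<Rightarrow> R \<omega> \<bullet> D (s, \<omega>)) \<partial>?P) = 0"
      proof -
        have "(\<integral>p. (case p of (s, \<omega>) \<Rightarrow> R \<omega> \<bullet> D (s, \<omega>)) \<partial>?P) = (\<integral>\<omega>. (\<integral>s. R \<omega> \<bullet> D (s, \<omega>) \<partial>N) \<partial>M)"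
          using P.integral_snd[OF i3] by simp
        also have "\<dots> = (\<integral>\<omega>. 0 \<partial>M)"
        proof (rule integral_cong_AE)
          show "AE \<omega> in M. (\<integral>s. R \<omega> \<bullet> D (s, \<omega>) \<partial>N) = 0"
            using D_mean by eventually_elim (simp add: integral_inner_right)
        qed measurable
        finally show ?thesis by simp
      qed
      have e1: "(\<integral>p. (case p of (s, \<omega>) \<Rightarrow> (norm (R \<omega>))\<^sup>2) \<partial>?P) = c * E"
        using P.integral_fst'[OF i1] by (simp add: E_def c_def)
      have sq: "(norm (R \<omega> + D (s, \<omega>)))\<^sup>2 = (norm (R \<omega>))\<^sup>2 + 2 * (R \<omega> \<bullet> D (s, \<omega>)) + (norm (D (s, \<omega>)))\<^sup>2" for s \<omega>
        by (simp add: power2_norm_eq_inner inner_add_left inner_add_right inner_commute)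
      let ?F = "\<lambda>p. (case p of (s, \<omega>) \<Rightarrow> (norm (R \<omega>))\<^sup>2) + 2 * (case p of (s, \<omega>) \<Rightarrow> R \<omega> \<bullet> D (s, \<omega>)) + (norm (D p))\<^sup>2"
      have F: "integrable ?P ?F" "(\<integral>p. ?F p \<partial>?P) = c * E + C"
        using i1 i2 i3 z e1 by (simp_all add: C_def)
      have "ennreal c * (ennreal E + ennreal (C / c + 1)) = (\<integral>\<^sup>+s. ennreal E + ennreal (C / c + 1) \<partial>N)"
        by (simp add: emN mult.commute)
      also have "\<dots> \<le> (\<integral>\<^sup>+s. msq M (\<lambda>\<omega>. R \<omega> + D (s, \<omega>)) \<partial>N)"
        using contra unfolding E(1) by (intro nn_integral_mono) (auto simp: not_le intro: less_imp_le)
      also have "\<dots> = (\<integral>\<^sup>+p. ennreal (?F p) \<partial>?P)"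
        unfolding msq_def by (subst nn_integral_fst[symmetric]) (simp_all add: sq)
      also have "\<dots> = ennreal (c * E + C)"
        unfolding F(2)[symmetric]
        by (rule nn_integral_eq_integral[OF F(1)]) (auto simp: split_beta' sq[symmetric])
      finally have "c * (E + (C / c + 1)) \<le> c * E + C"
        using c C E(2) by (simp flip: ennreal_plus ennreal_mult')
      then show False using c by (simp add: algebra_simps)
    qed
    define K where "K = C / c + 1"
    have K: "K > 0" using C c by (simp add: K_def add_nonneg_pos)
    \<comment> \<open>S is a sum of n samples c Z_s. Its squared error against n m grows only
      linearly in n, so after division by n the error is at most K / n.\<close>
    have greedy: "\<exists>S. gaussian_linear S \<and> msq M (\<lambda>\<omega>. S \<omega> - real n *\<^sub>R m \<omega>) \<le> ennreal (real n * K)" for n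
    proof (induction n)
      case 0
      show ?case by (intro exI[of _ "\<lambda>_. 0"]) (simp add: gaussian_linear_const msq_def)
    next
      case (Suc n)
      then obtain S where S: "gaussian_linear S" "msq M (\<lambda>\<omega>. S \<omega> - real n *\<^sub>R m \<omega>) \<le> ennreal (real n * K)" by auto
      have [measurable]: "S \<in> borel_measurable M" using S(1) by (rule gaussian_linearD)
      have "msq M (\<lambda>\<omega>. S \<omega> - real n *\<^sub>R m \<omega>) < \<infinity>"
        using S(2) by (rule order.strict_trans1) simp
      then obtain s where s: "s \<in> space N"
        "msq M (\<lambda>\<omega>. (S \<omega> - real n *\<^sub>R m \<omega>) + D (s, \<omega>)) \<le> msq M (\<lambda>\<omega>. S \<omega> - real n *\<^sub>R m \<omega>) + ennreal K"
        using step[of "\<lambda>\<omega>. S \<omega> - real n *\<^sub>R m \<omega>"] unfolding K_def by auto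
      have "msq M (\<lambda>\<omega>. (S \<omega> + c *\<^sub>R Z s \<omega>) - real (Suc n) *\<^sub>R m \<omega>) = msq M (\<lambda>\<omega>. (S \<omega> - real n *\<^sub>R m \<omega>) + D (s, \<omega>))"
        by (simp add: D_def algebra_simps)
      also have "\<dots> \<le> ennreal (real n * K) + ennreal K"
        using s(2) S(2) by (meson add_right_mono order_trans)
      also have "\<dots> = ennreal (real (Suc n) * K)"
        using K by (simp add: algebra_simps flip: ennreal_plus)
      finally show ?case
        using gaussian_linear_add[OF S(1) gaussian_linear_scaleR[OF gl[OF s(1)], of c]] by blast
    qed
    show ?thesis
      unfolding m_def[symmetric]
    proof (rule gaussian_linear_limit[OF m])
      fix \<epsilon> :: real assume "\<epsilon> > 0"
      obtain n where n: "K / \<epsilon> < real n" using reals_Archimedean2 by blast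
      then have n0: "real n > 0" using K \<open>\<epsilon> > 0\<close> by (meson divide_pos_pos order.strict_trans)
      obtain S where S: "gaussian_linear S" "msq M (\<lambda>\<omega>. S \<omega> - real n *\<^sub>R m \<omega>) \<le> ennreal (real n * K)"
        using greedy by blast
      have [measurable]: "S \<in> borel_measurable M" using S(1) by (rule gaussian_linearD)
      have "msq M (\<lambda>\<omega>. m \<omega> - (1 / real n) *\<^sub>R S \<omega>) = msq M (\<lambda>\<omega>. (1 / real n) *\<^sub>R (S \<omega> - real n *\<^sub>R m \<omega>))"
        using n0 by (intro msq_cong) (simp add: scaleR_diff_right norm_minus_commute)
      also have "\<dots> = ennreal ((1 / real n)\<^sup>2) * msq M (\<lambda>\<omega>. S \<omega> - real n *\<^sub>R m \<omega>)"
        by (rule msq_scaleR) measurable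
      also have "\<dots> \<le> ennreal ((1 / real n)\<^sup>2) * ennreal (real n * K)"
        by (intro mult_left_mono S) simp
      also have "\<dots> = ennreal (K / real n)"
        using n0 K by (simp add: power2_eq_square field_simps flip: ennreal_mult')
      also have "\<dots> < ennreal \<epsilon>"
        using n n0 \<open>\<epsilon> > 0\<close> by (intro ennreal_lessI) (auto simp: field_simps)
      finally show "\<exists>Y. gaussian_linear Y \<and> msq M (\<lambda>\<omega>. m \<omega> - Y \<omega>) < ennreal \<epsilon>"
        using gaussian_linear_scaleR[OF S(1), of "1 / real n"] by blast
    qed
  qed
qed

end

section \<open>Linear Volterra equations\<close>

text \<open>Bounded Borel functions on the whole index space are closed under sums, bilinear
  products and integration over a common bounded interval. With a bounded support, integrability and
  the conditions of Fubini's theorem become automatic for them.\<close>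

definition bounded_borel :: "('i::topological_space \<Rightarrow> 'a::real_normed_vector) \<Rightarrow> bool" where
  "bounded_borel f \<longleftrightarrow> f \<in> borel_measurable borel \<and> (\<exists>B. \<forall>x. norm (f x) \<le> B)"

lemma bounded_borelI: "f \<in> borel_measurable borel \<Longrightarrow> (\<And>x. norm (f x) \<le> B) \<Longrightarrow> bounded_borel f"
  by (auto simp: bounded_borel_def)

lemma bounded_borelD [measurable_dest]: "bounded_borel f \<Longrightarrow> f \<in> borel_measurable borel"
  by (simp add: bounded_borel_def)

lemma bounded_borel_bound:
  assumes "bounded_borel f"
  obtains B where "B > 0" "\<And>x. norm (f x) \<le> B"
proof -
  from assms obtain B where "\<And>x. norm (f x) \<le> B" by (auto simp: bounded_borel_def)
  then show thesis by (intro that[of "max B 1"]) (auto intro: le_max_iff_disj[THEN iffD2])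
qed

lemma bounded_borel_const: "bounded_borel (\<lambda>_. c)"
  by (auto simp: bounded_borel_def)

lemma bounded_borel_indicator: "A \<in> sets borel \<Longrightarrow> bounded_borel (indicat_real A)"
  by (rule bounded_borelI[of _ 1]) (auto simp: indicator_def)

lemma bounded_borel_compose:
  "bounded_borel f \<Longrightarrow> g \<in> borel_measurable borel \<Longrightarrow> bounded_borel (\<lambda>x. f (g x))"
  unfolding bounded_borel_def by (auto intro: measurable_compose)

lemma bounded_borel_add:
  fixes f g :: "'i::topological_space \<Rightarrow> 'a::{real_normed_vector, second_countable_topology}"
  assumes "bounded_borel f" "bounded_borel g"
  shows "bounded_borel (\<lambda>x. f x + g x)"
proof -
  obtain B C where "\<And>x. norm (f x) \<le> B" "\<And>x. norm (g x) \<le> C"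
    using assms by (metis bounded_borel_def)
  then have "norm (f x + g x) \<le> B + C" for x by (rule norm_triangle_mono)
  with assms show ?thesis by (intro bounded_borelI[of _ "B + C"]) (auto simp: bounded_borel_def)
qed

lemma bounded_borel_bilinear:
  fixes f :: "'i::topological_space \<Rightarrow> 'a::{real_normed_vector, second_countable_topology}"
    and g :: "'i \<Rightarrow> 'b::{real_normed_vector, second_countable_topology}"
    and h :: "'a \<Rightarrow> 'b \<Rightarrow> 'c::{real_normed_vector, second_countable_topology}"
  assumes "bounded_bilinear h" "bounded_borel f" "bounded_borel g"
  shows "bounded_borel (\<lambda>x. h (f x) (g x))"
proof -
  obtain B where B: "B > 0" "\<And>x. norm (f x) \<le> B" using assms(2) by (rule bounded_borel_bound) blast
  obtain C where C: "C > 0" "\<And>x. norm (g x) \<le> C" using assms(3) by (rule bounded_borel_bound) blast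
  obtain D where D: "D > 0" "\<And>a b. norm (h a b) \<le> norm a * norm b * D"
    using bounded_bilinear.pos_bounded[OF assms(1)] by auto
  have "norm (h (f x) (g x)) \<le> B * C * D" for x
    using D(2)[of "f x" "g x"] B C D(1)
    by (meson mult_mono mult_right_mono norm_ge_zero order_trans less_imp_le)
  moreover have "(\<lambda>x. h (f x) (g x)) \<in> borel_measurable borel"
    using assms
    by (intro borel_measurable_continuous_Pair[of f borel g h])
      (auto simp: bounded_borel_def intro!: bounded_bilinear.continuous_on[OF assms(1)] continuous_intros)
  ultimately show ?thesis by (intro bounded_borelI)
qed

lemmas bounded_borel_scaleR = bounded_borel_bilinear[OF bounded_bilinear_scaleR]
lemmas bounded_borel_matrix_mult = bounded_borel_bilinear[OF bounded_bilinear_matrix_matrix_mult]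
lemmas bounded_borel_matrix_vector_mult = bounded_borel_bilinear[OF bounded_bilinear_matrix_vector_mult]

lemma bounded_borel_linear:
  fixes f :: "'i::topological_space \<Rightarrow> 'a::{real_normed_vector, second_countable_topology}"
    and h :: "'a \<Rightarrow> 'c::{real_normed_vector, second_countable_topology}"
  assumes "bounded_linear h" "bounded_borel f"
  shows "bounded_borel (\<lambda>x. h (f x))"
proof -
  obtain B where B: "\<And>x. norm (f x) \<le> B" using assms(2) by (rule bounded_borel_bound) blast
  obtain D where D: "D > 0" "\<And>a. norm (h a) \<le> norm a * D"
    using bounded_linear.pos_bounded[OF assms(1)] by auto
  have "norm (h (f x)) \<le> B * D" for x
    using D B by (meson mult_right_mono order_trans less_imp_le)
  moreover have "(\<lambda>x. h (f x)) \<in> borel_measurable borel"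
    by (rule measurable_compose[OF bounded_borelD[OF assms(2)]
          borel_measurable_continuous_onI[OF linear_continuous_on[OF assms(1)]]])
  ultimately show ?thesis by (intro bounded_borelI)
qed

lemma bounded_linear_transpose: "bounded_linear (transpose :: real^'n::finite^'m::finite \<Rightarrow> real^'m^'n)"
  by (subst linear_conv_bounded_linear[symmetric])
    (auto simp: linear_iff transpose_def vec_eq_iff)

lemmas bounded_borel_transpose = bounded_borel_linear[OF bounded_linear_transpose]

lemma bounded_borel_diff:
  fixes f g :: "'i::topological_space \<Rightarrow> 'a::{real_normed_vector, second_countable_topology}"
  assumes "bounded_borel f" "bounded_borel g"
  shows "bounded_borel (\<lambda>x. f x - g x)"
  using bounded_borel_add[OF assms(1) bounded_borel_linear[OF bounded_linear_minus[OF bounded_linear_ident] assms(2)]]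
  by simp

lemma bounded_borel_sum:
  fixes f :: "'k \<Rightarrow> 'i::topological_space \<Rightarrow> 'a::{real_normed_vector, second_countable_topology}"
  assumes "\<And>k. k \<in> S \<Longrightarrow> bounded_borel (f k)"
  shows "bounded_borel (\<lambda>x. \<Sum>k\<in>S. f k x)"
  using assms
proof (induction S rule: infinite_finite_induct)
  case (insert k S)
  then show ?case by (simp add: bounded_borel_add)
qed (simp_all add: bounded_borel_const)

lemma integrable_bounded_borel:
  fixes f :: "real \<Rightarrow> 'a::{banach, second_countable_topology}"
  assumes "bounded_borel f" "\<And>s. s \<notin> {a..b} \<Longrightarrow> f s = 0"
  shows "integrable lborel f"
proof -
  obtain B where "\<And>x. norm (f x) \<le> B" using assms(1) by (rule bounded_borel_bound) blast
  then show ?thesis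
    using assms by (intro integrableI_bounded_set[of "{a..b}" _ _ B]) (auto simp: bounded_borel_def emeasure_lborel_Icc_eq)
qed

lemma integrable_bounded_borel_prod:
  fixes f :: "real \<times> real \<Rightarrow> 'a::{banach, second_countable_topology}"
  assumes "bounded_borel f" "\<And>s r. s \<notin> {a..b} \<or> r \<notin> {a..b} \<Longrightarrow> f (s, r) = 0"
  shows "integrable (lborel \<Otimes>\<^sub>M lborel) f"
proof -
  obtain B where "\<And>x. norm (f x) \<le> B" using assms(1) by (rule bounded_borel_bound) blast
  moreover have "f \<in> borel_measurable (lborel \<Otimes>\<^sub>M lborel)"
    using assms(1) by (simp add: bounded_borel_def lborel_prod)
  moreover have "emeasure (lborel \<Otimes>\<^sub>M lborel) ({a..b} \<times> {a..b}) < \<infinity>"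
    by (subst lborel.emeasure_pair_measure_Times) (auto simp: emeasure_lborel_Icc_eq ennreal_mult_less_top)
  moreover have "f p = 0" if "p \<notin> {a..b} \<times> {a..b}" for p
    using assms(2)[of "fst p" "snd p"] that by (cases p) auto
  ultimately show ?thesis
    by (intro integrableI_bounded_set[of "{a..b} \<times> {a..b}" _ _ B] AE_I2 impI) auto
qed

lemma bounded_borel_integral:
  fixes f :: "'i::second_countable_topology \<Rightarrow> real \<Rightarrow> 'a::{banach, second_countable_topology}"
  assumes f: "bounded_borel (\<lambda>(i, s). f i s)" and supp: "\<And>i s. s \<notin> {a..b} \<Longrightarrow> f i s = 0"
  shows "bounded_borel (\<lambda>i. \<integral>s. f i s \<partial>lborel)"
proof -
  obtain B where B: "B > 0" "\<And>x. norm ((\<lambda>(i, s). f i s) x) \<le> B" using f by (rule bounded_borel_bound) blast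
  have fi: "bounded_borel (f i)" for i
    using bounded_borel_compose[OF f, of "\<lambda>s. (i, s)"] by simp
  have "norm (\<integral>s. f i s \<partial>lborel) \<le> (\<integral>s. B * indicator {a..b} s \<partial>lborel)" for i
  proof (rule Bochner_Integration.integral_norm_bound_integral)
    show "integrable lborel (f i)" by (rule integrable_bounded_borel[OF fi supp])
    show "norm (f i s) \<le> B * indicator {a..b} s" for s
      using B(2)[of "(i, s)"] supp[of s i] by (auto simp: indicator_def)
  qed (auto simp: emeasure_lborel_Icc_eq)
  moreover have "(\<lambda>i. \<integral>s. f i s \<partial>lborel) \<in> borel_measurable borel"
  proof (rule lborel.borel_measurable_lebesgue_integral)
    have [measurable]: "(\<lambda>(i, s). f i s) \<in> borel_measurable (borel \<Otimes>\<^sub>M borel)"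
      using f unfolding bounded_borel_def borel_prod by (rule conjunct1)
    show "(\<lambda>(i, s). f i s) \<in> borel_measurable (borel \<Otimes>\<^sub>M lborel)" by measurable
  qed
  ultimately show ?thesis by (intro bounded_borelI)
qed

section \<open>The resolvent kernel and the solution formula\<close>

lemma integral_exp_weight:
  fixes s t lam :: real
  assumes "t \<le> s" "0 < lam"
  shows "has_bochner_integral lborel (\<lambda>r. exp (lam * (s - r)) * indicator {t..s} r) ((exp (lam * (s - t)) - 1) / lam)"
proof -
  have "has_bochner_integral lborel (\<lambda>r. exp (lam * (s - r)) * indicator {t..s} r)
    ((- exp (lam * (s - s)) / lam) - (- exp (lam * (s - t)) / lam))"
  proof (rule has_bochner_integral_FTC_Icc_nonneg)
    show "((\<lambda>r. - exp (lam * (s - r)) / lam) has_real_derivative exp (lam * (s - r))) (at r)" for r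
      using assms by (auto intro!: derivative_eq_intros simp: field_simps)
  qed (use assms in auto)
  then show ?thesis by (simp add: diff_divide_distrib)
qed

text \<open>R is the sum of the iterated convolutions \<open>Rn\<close>. The resolvent identity has
  K to the left of R, the order in which \<open>volterra_solution\<close> applies K to the solution
  formula.\<close>

lemma volterra_resolvent:
  fixes K :: "real \<Rightarrow> real \<Rightarrow> real^'n::finite^'n"
  assumes K: "bounded_borel (\<lambda>(t, s). K t s)"
    and supp: "\<And>t s. \<not> (0 \<le> t \<and> t \<le> s \<and> s \<le> T) \<Longrightarrow> K t s = 0"
  obtains R where "bounded_borel (\<lambda>(t, s). R t s)"
    "\<And>t s. \<not> (0 \<le> t \<and> t \<le> s \<and> s \<le> T) \<Longrightarrow> R t s = 0"
    "\<And>t s. R t s = K t s + (\<integral>r. K t r ** R r s \<partial>lborel)"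
proof -
  obtain C where C: "C > 0" "\<And>t s. norm (K t s) \<le> C" using K by (rule bounded_borel_bound) force
  obtain D where D: "D > 0" "\<And>(A :: real^'n^'n) (B :: real^'n^'n). norm (A ** B) \<le> norm A * norm B * D"
    using bounded_bilinear.pos_bounded[OF bounded_bilinear_matrix_matrix_mult] by blast
  \<comment> \<open>With the weight \<open>exp (lam * (s - t))\<close> each convolution with \<open>K\<close> gains a factor \<open>1/2\<close>, so the
    Neumann series is dominated by a geometric one.\<close>
  define lam where "lam = 2 * C * D"
  have lam: "lam > 0" using C D by (simp add: lam_def)
  define Rn where "Rn = rec_nat K (\<lambda>_ Q t s. \<integral>r. K t r ** Q r s \<partial>lborel)"
  have Rn_0: "Rn 0 = K" and Rn_Suc: "Rn (Suc n) t s = (\<integral>r. K t r ** Rn n r s \<partial>lborel)" for n t s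
    by (simp_all add: Rn_def)
  define E where "E n t s = C * (1/2)^n * exp (lam * (s - t))" for n t s
  have E_pos: "E n t s \<ge> 0" for n t s using C by (simp add: E_def)
  have Rn: "bounded_borel (\<lambda>(t, s). Rn n t s) \<and>
    (\<forall>t s. \<not> (0 \<le> t \<and> t \<le> s \<and> s \<le> T) \<longrightarrow> Rn n t s = 0) \<and>
    (\<forall>t s. t \<le> s \<longrightarrow> norm (Rn n t s) \<le> E n t s)" for n
  proof (induction n)
    case 0
    have "C \<le> E 0 t s" if "t \<le> s" for t s
      using C lam that mult_left_mono[of 1 "exp (lam * (s - t))" C] by (simp add: E_def)
    with C(2) have "norm (K t s) \<le> E 0 t s" if "t \<le> s" for t s
      using that order_trans by blast
    then show ?case using K supp by (auto simp: Rn_0)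
  next
    case (Suc n)
    then have IH: "bounded_borel (\<lambda>(t, s). Rn n t s)"
      "\<And>t s. \<not> (0 \<le> t \<and> t \<le> s \<and> s \<le> T) \<Longrightarrow> Rn n t s = 0"
      "\<And>t s. t \<le> s \<Longrightarrow> norm (Rn n t s) \<le> E n t s" by auto
    \<comment> \<open>A nonzero integrand forces t <= r <= s: convolutions of causal kernels are
      causal, and only r in [t,s] contributes.\<close>
    have supp_int: "K t r ** Rn n r s = 0" if "\<not> (0 \<le> t \<and> t \<le> r \<and> r \<le> s \<and> s \<le> T)" for t r s
      using supp[of t r] IH(2)[of r s] that
      by (cases "0 \<le> t \<and> t \<le> r \<and> r \<le> T")
        (auto simp: bounded_bilinear.zero_left[OF bounded_bilinear_matrix_matrix_mult]
          bounded_bilinear.zero_right[OF bounded_bilinear_matrix_matrix_mult])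
    have joint: "bounded_borel (\<lambda>(p, r). K (fst p) r ** Rn n r (snd p))"
      unfolding split_beta'
      by (intro bounded_borel_matrix_mult
          bounded_borel_compose[OF K, of "\<lambda>x. (fst (fst x), snd x)", unfolded split]
          bounded_borel_compose[OF IH(1), of "\<lambda>x. (snd x, snd (fst x))", unfolded split]
          borel_measurable_continuous_onI continuous_intros)
    have sect: "bounded_borel (\<lambda>r. K t r ** Rn n r s)" for t s
      using bounded_borel_compose[OF joint, of "\<lambda>r. ((t, s), r)"] by simp
    have "bounded_borel (\<lambda>p. \<integral>r. K (fst p) r ** Rn n r (snd p) \<partial>lborel)"
      by (rule bounded_borel_integral[OF joint, of 0 T]) (rule supp_int, auto)
    moreover have "Rn (Suc n) t s = 0" if "\<not> (0 \<le> t \<and> t \<le> s \<and> s \<le> T)" for t s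
      using supp_int[of t _ s] that by (auto simp: Rn_Suc)
    moreover have "norm (Rn (Suc n) t s) \<le> E (Suc n) t s" if ts: "t \<le> s" for t s
    proof -
      note hb = integral_exp_weight[OF ts lam]
      have "norm (Rn (Suc n) t s) \<le> (\<integral>r. C * (C * (1/2)^n) * D * (exp (lam * (s - r)) * indicator {t..s} r) \<partial>lborel)"
        unfolding Rn_Suc
      proof (rule Bochner_Integration.integral_norm_bound_integral)
        show "integrable lborel (\<lambda>r. K t r ** Rn n r s)"
          by (rule integrable_bounded_borel[OF sect, of 0 T]) (rule supp_int, auto)
        show "norm (K t r ** Rn n r s) \<le> C * (C * (1/2)^n) * D * (exp (lam * (s - r)) * indicator {t..s} r)" for r
        proof (cases "r \<in> {t..s}")
          case True
          have "norm (K t r ** Rn n r s) \<le> norm (K t r) * norm (Rn n r s) * D" by (rule D)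
          also have "\<dots> \<le> C * E n r s * D"
            using C D IH(3)[of r s] True by (intro mult_right_mono mult_mono) auto
          finally show ?thesis using True by (simp add: E_def mult_ac)
        next
          case False
          then show ?thesis using supp_int[of t r s] by auto
        qed
      qed (use hb in \<open>auto simp: has_bochner_integral_iff\<close>)
      also have "\<dots> = C * (C * (1/2)^n) * D * ((exp (lam * (s - t)) - 1) / lam)"
        using hb by (simp add: has_bochner_integral_iff)
      also have "\<dots> \<le> C * (C * (1/2)^n) * D * (exp (lam * (s - t)) / lam)"
        using C D lam by (intro mult_left_mono divide_right_mono) auto
      \<comment> \<open>The choice of lam turns C * D / lam into 1/2, the ratio of
        \<open>E (Suc n)\<close> to \<open>E n\<close>.\<close>
      also have "\<dots> = E (Suc n) t s"
        using C D by (simp add: E_def lam_def field_simps)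
      finally show ?thesis .
    qed
    ultimately show ?case by (auto simp: Rn_Suc split_beta')
  qed
  \<comment> \<open>On the support s - t is at most T, so the weight is bounded and the geometric
    decay of the iterates is uniform in t and s.\<close>
  define Emax where "Emax = exp (lam * T)"
  have Rn_le: "norm (Rn n t s) \<le> C * Emax * (1/2)^n" for n t s
  proof (cases "0 \<le> t \<and> t \<le> s \<and> s \<le> T")
    case True
    then have "norm (Rn n t s) \<le> C * (1/2)^n * exp (lam * (s - t))" using Rn[of n] by (auto simp: E_def)
    also have "\<dots> \<le> C * (1/2)^n * Emax"
      unfolding Emax_def using True C lam by (intro mult_left_mono) auto
    finally show ?thesis by (simp add: mult_ac)
  next
    case False
    then show ?thesis using Rn[of n] C by (auto simp: Emax_def)
  qed
  have geo: "summable (\<lambda>n. C * Emax * (1/2)^n)" "(\<Sum>n. C * Emax * (1/2)^n) = C * Emax * 2"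
    by (simp_all add: summable_mult summable_geometric suminf_mult suminf_geometric)
  have sn: "summable (\<lambda>n. norm (Rn n t s))" for t s
    by (rule summable_comparison_test'[OF geo(1), of 0]) (simp add: Rn_le)
  have sm: "summable (\<lambda>n. Rn n t s)" for t s by (rule summable_norm_cancel[OF sn])
  define R where "R t s = (\<Sum>n. Rn n t s)" for t s
  have "bounded_borel (\<lambda>(t, s). R t s)"
  proof (rule bounded_borelI)
    have [measurable]: "\<And>n. (\<lambda>(t, s). Rn n t s) \<in> borel_measurable borel"
      using Rn by (auto simp: bounded_borel_def)
    have "(\<lambda>p. \<Sum>n. (case p of (t, s) \<Rightarrow> Rn n t s)) \<in> borel_measurable borel" by measurable
    then show "(\<lambda>(t, s). R t s) \<in> borel_measurable borel" by (simp add: R_def split_beta')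
    show "norm (case p of (t, s) \<Rightarrow> R t s) \<le> C * Emax * 2" for p
    proof (cases p)
      case (Pair t s)
      have "norm (R t s) \<le> (\<Sum>n. norm (Rn n t s))" unfolding R_def by (rule summable_norm[OF sn])
      also have "\<dots> \<le> C * Emax * 2" unfolding geo(2)[symmetric] by (rule suminf_le[OF Rn_le sn geo(1)])
      finally show ?thesis by (simp add: Pair)
    qed
  qed
  moreover have "R t s = 0" if "\<not> (0 \<le> t \<and> t \<le> s \<and> s \<le> T)" for t s
    using Rn that by (auto simp: R_def)
  moreover have "R t s = K t s + (\<integral>r. K t r ** R r s \<partial>lborel)" for t s
  proof -
    interpret mm: bounded_bilinear "(**) :: real^'n^'n \<Rightarrow> real^'n^'n \<Rightarrow> real^'n^'n"
      by (rule bounded_bilinear_matrix_matrix_mult)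
    let ?f = "\<lambda>n r. K t r ** Rn n r s"
    have le: "norm (?f n r) \<le> C * Emax * (1/2)^n * (C * D * indicator {0..T} r)" for n r
    proof (cases "r \<in> {0..T}")
      case True
      have "norm (?f n r) \<le> norm (K t r) * norm (Rn n r s) * D" by (rule D)
      also have "\<dots> \<le> C * (C * Emax * (1/2)^n) * D"
        using C D Rn_le[of n r s] by (intro mult_right_mono mult_mono) auto
      finally show ?thesis using True by (simp add: mult_ac)
    next
      case False
      then show ?thesis using supp[of t r] by auto
    qed
    have int: "integrable lborel (?f n)" for n
    proof (rule integrable_bounded_borel)
      show "bounded_borel (?f n)"
        using Rn[of n] bounded_borel_compose[OF K, of "\<lambda>r. (t, r)"]
          bounded_borel_compose[of "\<lambda>(t, s). Rn n t s", of "\<lambda>r. (r, s)"]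
        by (intro bounded_borel_matrix_mult) auto
      show "?f n r = 0" if "r \<notin> {0..T}" for r using that supp[of t r] by auto
    qed
    have sumf: "summable (\<lambda>n. norm (?f n r))" for r
      by (rule summable_comparison_test'[OF summable_mult2[OF geo(1), of "C * D * indicator {0..T} r"], of 0])
        (simp add: le)
    have "(\<integral>r. K t r ** R r s \<partial>lborel) = (\<integral>r. (\<Sum>n. ?f n r) \<partial>lborel)"
      unfolding R_def by (simp add: sm bounded_linear.suminf[OF mm.bounded_linear_right])
    \<comment> \<open>Integration term by term: the norms are dominated by a geometric series times
      one integrable function of r.\<close>
    also have "\<dots> = (\<Sum>n. \<integral>r. ?f n r \<partial>lborel)"
    proof (rule integral_suminf[OF int])
      show "AE r in lborel. summable (\<lambda>n. norm (?f n r))" using sumf by simp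
      show "summable (\<lambda>n. \<integral>r. norm (?f n r) \<partial>lborel)"
      proof (rule summable_comparison_test'[OF summable_mult2[OF geo(1)], of 0])
        fix n
        have "norm (\<integral>r. norm (?f n r) \<partial>lborel) \<le> (\<integral>r. C * Emax * (1/2)^n * (C * D * indicator {0..T} r) \<partial>lborel)"
          by (rule Bochner_Integration.integral_norm_bound_integral) (use int le in \<open>auto simp: emeasure_lborel_Icc_eq\<close>)
        then show "norm (\<integral>r. norm (?f n r) \<partial>lborel) \<le> C * Emax * (1/2)^n * (\<integral>r. C * D * indicator {0..T} r \<partial>lborel)"
          by simp
      qed
    qed
    also have "\<dots> = (\<Sum>n. Rn (Suc n) t s)" by (simp add: Rn_Suc)
    also have "\<dots> = R t s - K t s"
      using suminf_split_head[OF sm, of t s] by (simp add: R_def Rn_0)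
    finally show ?thesis by simp
  qed
  ultimately show thesis by (rule that)
qed

text \<open>A purely deterministic statement, to be applied along single paths. By Fubini, applying
  K to g + R g gives K g + (K * R) g = K g + (R - K) g = R g, where * is convolution.\<close>

lemma volterra_solution:
  fixes K R :: "real \<Rightarrow> real \<Rightarrow> real^'n::finite^'n" and g :: "real \<Rightarrow> real^'n"
  assumes K: "bounded_borel (\<lambda>(t, s). K t s)" and R: "bounded_borel (\<lambda>(t, s). R t s)"
    and suppK: "\<And>t s. \<not> (0 \<le> t \<and> t \<le> s \<and> s \<le> T) \<Longrightarrow> K t s = 0"
    and suppR: "\<And>t s. \<not> (0 \<le> t \<and> t \<le> s \<and> s \<le> T) \<Longrightarrow> R t s = 0"
    and res: "\<And>t s. R t s = K t s + (\<integral>r. K t r ** R r s \<partial>lborel)"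
    and g: "bounded_borel g"
  defines "Y \<equiv> \<lambda>t. g t + (\<integral>s. R t s *v g s \<partial>lborel)"
  shows "bounded_borel Y" and "Y t = g t + (\<integral>s. K t s *v Y s \<partial>lborel)"
proof -
  interpret mv: bounded_bilinear "(*v) :: real^'n^'n \<Rightarrow> real^'n \<Rightarrow> real^'n"
    by (rule bounded_bilinear_matrix_vector_mult)
  interpret mm: bounded_bilinear "(**) :: real^'n^'n \<Rightarrow> real^'n^'n \<Rightarrow> real^'n^'n"
    by (rule bounded_bilinear_matrix_matrix_mult)
  have Rg: "bounded_borel (\<lambda>(t, s). R t s *v g s)"
    using bounded_borel_matrix_vector_mult[OF R bounded_borel_compose[OF g, of snd]]
    by (simp add: split_beta' borel_measurable_continuous_onI continuous_on_snd)
  have Rg_int: "bounded_borel (\<lambda>t. \<integral>s. R t s *v g s \<partial>lborel)"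
    by (rule bounded_borel_integral[OF Rg, of 0 T]) (subst suppR, auto)
  show Y: "bounded_borel Y" unfolding Y_def by (intro bounded_borel_add g Rg_int)
  have Kt: "bounded_borel (K t)" and Rt: "bounded_borel (R t)" for t
    using bounded_borel_compose[OF K, of "\<lambda>s. (t, s)"] bounded_borel_compose[OF R, of "\<lambda>s. (t, s)"] by auto
  have i1: "integrable lborel (\<lambda>s. K t s *v g s)"
    by (rule integrable_bounded_borel[OF bounded_borel_matrix_vector_mult[OF Kt g], of 0 T]) (subst suppK, auto)
  have i1': "integrable lborel (\<lambda>s. R t s *v g s)" for t
    by (rule integrable_bounded_borel[OF bounded_borel_matrix_vector_mult[OF Rt g], of 0 T]) (subst suppR, auto)
  have i2: "integrable lborel (\<lambda>s. K t s *v (\<integral>r. R s r *v g r \<partial>lborel))"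
    by (rule integrable_bounded_borel[OF bounded_borel_matrix_vector_mult[OF Kt Rg_int], of 0 T]) (subst suppK, auto)
  have i3: "integrable (lborel \<Otimes>\<^sub>M lborel) (\<lambda>(s, r). (K t s ** R s r) *v g r)"
  proof (rule integrable_bounded_borel_prod[of _ 0 T])
    show "bounded_borel (\<lambda>(s, r). (K t s ** R s r) *v g r)"
      unfolding split_beta'
      by (intro bounded_borel_matrix_mult bounded_borel_matrix_vector_mult
          bounded_borel_compose[OF Kt] bounded_borel_compose[OF g] R[unfolded split_beta']
          borel_measurable_continuous_onI continuous_intros)
    show "(\<lambda>(s, r). (K t s ** R s r) *v g r) (s, r) = 0" if "s \<notin> {0..T} \<or> r \<notin> {0..T}" for s r
      using that suppK[of t s] suppR[of s r] by (auto simp: mv.zero_left)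
  qed
  have i4: "integrable lborel (\<lambda>s. K t s ** R s r)" for r
  proof (rule integrable_bounded_borel[of _ 0 T])
    show "bounded_borel (\<lambda>s. K t s ** R s r)"
      using bounded_borel_compose[OF R, of "\<lambda>s. (s, r)"] by (intro bounded_borel_matrix_mult Kt) auto
  qed (subst suppK, auto)
  have "(\<integral>s. K t s *v Y s \<partial>lborel) = (\<integral>s. K t s *v g s \<partial>lborel) + (\<integral>s. K t s *v (\<integral>r. R s r *v g r \<partial>lborel) \<partial>lborel)"
    unfolding Y_def using i1 i2 by (simp add: mv.add_right)
  also have "(\<integral>s. K t s *v (\<integral>r. R s r *v g r \<partial>lborel) \<partial>lborel) = (\<integral>s. (\<integral>r. (K t s ** R s r) *v g r \<partial>lborel) \<partial>lborel)"
    using i1' by (simp add: integral_bounded_linear[OF mv.bounded_linear_right, symmetric] matrix_vector_mul_assoc)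
  also have "\<dots> = (\<integral>r. (\<integral>s. (K t s ** R s r) *v g r \<partial>lborel) \<partial>lborel)"
    using lborel_pair.Fubini_integral[OF i3] by simp
  also have "\<dots> = (\<integral>r. (R t r - K t r) *v g r \<partial>lborel)"
  proof (rule Bochner_Integration.integral_cong[OF refl])
    fix r
    have "(\<integral>s. (K t s ** R s r) *v g r \<partial>lborel) = (\<integral>s. K t s ** R s r \<partial>lborel) *v g r"
      by (rule integral_bounded_linear[OF mv.bounded_linear_left i4])
    also have "(\<integral>s. K t s ** R s r \<partial>lborel) = R t r - K t r" using res[of t r] by simp
    finally show "(\<integral>s. (K t s ** R s r) *v g r \<partial>lborel) = (R t r - K t r) *v g r" .
  qed
  also have "\<dots> = (\<integral>r. R t r *v g r \<partial>lborel) - (\<integral>r. K t r *v g r \<partial>lborel)"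
    using i1 i1' by (simp add: mv.diff_left)
  finally show "Y t = g t + (\<integral>s. K t s *v Y s \<partial>lborel)" by (simp add: Y_def)
qed

section \<open>Fields of Wiener integrals\<close>

context noise_space begin

text \<open>Three properties that together survive integration against a bounded kernel with common
  bounded support: joint measurability for Fubini, membership in the closed subspace at each index,
  and a second-moment bound uniform in the index.\<close>

definition linear_field :: "('i::topological_space \<Rightarrow> 'w \<Rightarrow> real^'r::finite) \<Rightarrow> bool" where
  "linear_field Z \<longleftrightarrow> (\<lambda>(i, \<omega>). Z i \<omega>) \<in> borel_measurable (borel \<Otimes>\<^sub>M M) \<and>
    (\<forall>i. gaussian_linear (Z i)) \<and> (\<exists>B. \<forall>i. msq M (Z i) \<le> ennreal B)"

lemma linear_field_measurable:
  "linear_field Z \<Longrightarrow> (\<lambda>(i, \<omega>). Z i \<omega>) \<in> borel_measurable (borel \<Otimes>\<^sub>M M)"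
  by (simp add: linear_field_def)

lemma linear_field_const:
  assumes "gaussian_linear \<xi>"
  shows "linear_field (\<lambda>_. \<xi>)"
proof -
  have [measurable]: "\<xi> \<in> borel_measurable M" using assms by (rule gaussian_linearD)
  obtain B where "msq M \<xi> = ennreal B"
    using gaussian_linear_msq[OF assms] by (cases "msq M \<xi>") auto
  then show ?thesis using assms by (auto simp: linear_field_def)
qed

lemma linear_field_compose:
  fixes Z :: "'i::topological_space \<Rightarrow> 'w \<Rightarrow> real^'r::finite"
  assumes Z: "linear_field Z" and g: "g \<in> borel_measurable borel"
  shows "linear_field (\<lambda>i. Z (g i))"
proof -
  have "(\<lambda>(i, \<omega>). (g i, \<omega>)) \<in> measurable (borel \<Otimes>\<^sub>M M) (borel \<Otimes>\<^sub>M M)" using g by measurable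
  from measurable_compose[OF this linear_field_measurable[OF Z]]
  have "(\<lambda>(i, \<omega>). Z (g i) \<omega>) \<in> borel_measurable (borel \<Otimes>\<^sub>M M)" by (simp add: split_beta')
  then show ?thesis using Z by (auto simp: linear_field_def)
qed

lemma linear_field_add:
  assumes Z: "linear_field Z" and Y: "linear_field Y"
  shows "linear_field (\<lambda>i \<omega>. Z i \<omega> + Y i \<omega>)"
proof -
  note [measurable] = linear_field_measurable[OF Z] linear_field_measurable[OF Y]
  obtain B C where B: "\<And>i. msq M (Z i) \<le> ennreal B" and C: "\<And>i. msq M (Y i) \<le> ennreal C"
    using Z Y by (auto simp: linear_field_def)
  have two: "ennreal (2 * a + 2 * b) = 2 * ennreal a + 2 * ennreal b" if "0 \<le> a" "0 \<le> b" for a b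
    using that by (simp add: ennreal_mult)
  have "msq M (\<lambda>\<omega>. Z i \<omega> + Y i \<omega>) \<le> ennreal (2 * max B 0 + 2 * max C 0)" for i
  proof -
    have "msq M (\<lambda>\<omega>. Z i \<omega> + Y i \<omega>) \<le> 2 * msq M (Z i) + 2 * msq M (Y i)"
      using Z Y by (intro msq_add gaussian_linearD) (auto simp: linear_field_def)
    also have "\<dots> \<le> 2 * ennreal (max B 0) + 2 * ennreal (max C 0)"
      using B[of i] C[of i] by (intro add_mono mult_left_mono) (auto simp: ennreal_max_0 ennreal_max_0')
    also have "\<dots> = ennreal (2 * max B 0 + 2 * max C 0)"
      by (rule two[symmetric]) auto
    finally show ?thesis .
  qed
  moreover have "gaussian_linear (\<lambda>\<omega>. Z i \<omega> + Y i \<omega>)" for i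
    using Z Y by (intro gaussian_linear_add) (auto simp: linear_field_def)
  moreover have "(\<lambda>(i, \<omega>). Z i \<omega> + Y i \<omega>) \<in> borel_measurable (borel \<Otimes>\<^sub>M M)" by measurable
  ultimately show ?thesis unfolding linear_field_def by blast
qed

lemma linear_field_matrix_mult:
  fixes A :: "real^'q::finite^'r::finite"
  assumes Z: "linear_field Z"
  shows "linear_field (\<lambda>i \<omega>. A *v Z i \<omega>)"
proof -
  note [measurable] = linear_field_measurable[OF Z]
  obtain B where B: "\<And>i. msq M (Z i) \<le> ennreal B"
    using Z by (auto simp: linear_field_def)
  have "msq M (\<lambda>\<omega>. A *v Z i \<omega>) \<le> ennreal ((onorm ((*v) A))\<^sup>2 * B)" for i
  proof -
    have "msq M (\<lambda>\<omega>. A *v Z i \<omega>) \<le> ennreal ((onorm ((*v) A))\<^sup>2) * msq M (Z i)"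
      using Z by (intro msq_matrix_mult gaussian_linearD) (auto simp: linear_field_def)
    also have "\<dots> \<le> ennreal ((onorm ((*v) A))\<^sup>2) * ennreal B" by (intro mult_left_mono B) simp
    finally show ?thesis by (simp add: ennreal_mult')
  qed
  moreover have "gaussian_linear (\<lambda>\<omega>. A *v Z i \<omega>)" for i
    using Z by (intro gaussian_linear_matrix_mult) (auto simp: linear_field_def)
  moreover have "(\<lambda>(i, \<omega>). A *v Z i \<omega>) \<in> borel_measurable (borel \<Otimes>\<^sub>M M)" by measurable
  ultimately show ?thesis unfolding linear_field_def by blast
qed

text \<open>The weight is separate from the kernel because \<open>cost_XX\<close> is integrable but
  possibly unbounded: its norm can be the weight and its direction the bounded kernel. Absorbing w
  into a finite measure N reduces the first claim to
  \<open>gaussian_linear_integral\<close>.\<close>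

lemma weighted_integral_field:
  fixes w :: "real \<Rightarrow> real" and Z :: "real \<Rightarrow> 'w \<Rightarrow> real^'q::finite"
    and K :: "'i::second_countable_topology \<Rightarrow> real \<Rightarrow> real^'q^'r::finite"
  assumes w: "integrable lborel w" and w_nonneg: "\<And>s. 0 \<le> w s"
    and Z[measurable]: "(\<lambda>(s, \<omega>). Z s \<omega>) \<in> borel_measurable (borel \<Otimes>\<^sub>M M)"
    and gl: "\<And>s. gaussian_linear (Z s)"
    and fin: "(\<integral>\<^sup>+s. ennreal (w s) * msq M (Z s) \<partial>lborel) < \<infinity>"
    and K: "bounded_borel (\<lambda>(i, s). K i s)"
  shows "linear_field (\<lambda>i \<omega>. \<integral>s. w s *\<^sub>R (K i s *v Z s \<omega>) \<partial>lborel)"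
    and "AE \<omega> in M. integrable lborel (\<lambda>s. w s *\<^sub>R Z s \<omega>)"
proof -
  have [measurable]: "w \<in> borel_measurable borel" using w by auto
  define N where "N = density lborel (\<lambda>s. ennreal (w s))"
  have sets_N[measurable_cong]: "sets N = sets borel" and space_N: "space N = UNIV" by (simp_all add: N_def)
  define c where "c = integral\<^sup>L lborel w"
  have emN: "emeasure N (space N) = ennreal c"
    using w w_nonneg by (simp add: N_def emeasure_density c_def nn_integral_eq_integral)
  interpret N: finite_measure N by (rule finite_measureI) (simp add: emN)
  interpret P: pair_sigma_finite N M ..
  have [measurable]: "(\<lambda>(i, s). K i s) \<in> borel_measurable (borel \<Otimes>\<^sub>M borel)"
    using K unfolding bounded_borel_def borel_prod by (rule conjunct1)
  have Ki[measurable]: "K i \<in> borel_measurable borel" for i by measurable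
  obtain B where B: "B > 0" "\<And>i s. norm (K i s) \<le> B"
    using K by (rule bounded_borel_bound) force
  obtain D where D: "D > 0" "\<And>(A :: real^'q^'r) x. norm (A *v x) \<le> norm A * norm x * D"
    using bounded_bilinear.pos_bounded[OF bounded_bilinear_matrix_vector_mult] by blast
  define L where "L = B * D"
  have L: "L > 0" "norm (K i s *v x) \<le> L * norm x" for i s x
  proof -
    have "norm (K i s *v x) \<le> norm (K i s) * norm x * D" by (rule D)
    also have "\<dots> \<le> B * norm x * D" using B D by (intro mult_right_mono) auto
    finally show "norm (K i s *v x) \<le> L * norm x" by (simp add: L_def mult_ac)
  qed (use B D in \<open>simp add: L_def\<close>)
  have dens: "(\<integral>s. w s *\<^sub>R f s \<partial>lborel) = integral\<^sup>L N f" if "f \<in> borel_measurable borel" for f :: "real \<Rightarrow> real^'r"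
    using that w_nonneg unfolding N_def by (subst integral_density) auto
  have Zs[measurable]: "(\<lambda>s. Z s \<omega>) \<in> borel_measurable borel" if "\<omega> \<in> space M" for \<omega>
    using measurable_compose[OF measurable_Pair2'[OF that] Z] by simp
  have ZN: "(\<integral>\<^sup>+s. msq M (Z s) \<partial>N) = (\<integral>\<^sup>+s. ennreal (w s) * msq M (Z s) \<partial>lborel)"
    unfolding N_def msq_def by (rule nn_integral_density) measurable
  have msq_K: "msq M (\<lambda>\<omega>. K i s *v Z s \<omega>) \<le> ennreal (L\<^sup>2) * msq M (Z s)" for i s
  proof -
    have "msq M (\<lambda>\<omega>. K i s *v Z s \<omega>) \<le> msq M (\<lambda>\<omega>. L *\<^sub>R Z s \<omega>)"
      using L by (intro msq_mono AE_I2) simp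
    also have "\<dots> = ennreal (L\<^sup>2) * msq M (Z s)" by (rule msq_scaleR) (rule gaussian_linearD[OF gl])
    finally show ?thesis .
  qed
  have KZ: "(\<integral>\<^sup>+s. msq M (\<lambda>\<omega>. K i s *v Z s \<omega>) \<partial>N) \<le> ennreal (L\<^sup>2) * (\<integral>\<^sup>+s. msq M (Z s) \<partial>N)" for i
  proof -
    have "(\<integral>\<^sup>+s. msq M (\<lambda>\<omega>. K i s *v Z s \<omega>) \<partial>N) \<le> (\<integral>\<^sup>+s. ennreal (L\<^sup>2) * msq M (Z s) \<partial>N)"
      by (rule nn_integral_mono) (rule msq_K)
    also have "\<dots> = ennreal (L\<^sup>2) * (\<integral>\<^sup>+s. msq M (Z s) \<partial>N)"
      unfolding msq_def by (rule nn_integral_cmult) measurable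
    finally show ?thesis .
  qed
  have eq: "(\<integral>s. w s *\<^sub>R (K i s *v Z s \<omega>) \<partial>lborel) = (\<integral>s. K i s *v Z s \<omega> \<partial>N)" if "\<omega> \<in> space M" for i \<omega>
    using that by (intro dens) measurable
  have m1: "(\<lambda>(s, \<omega>). K i s *v Z s \<omega>) \<in> borel_measurable (N \<Otimes>\<^sub>M M)" for i by measurable
  have gl2: "gaussian_linear (\<lambda>\<omega>. \<integral>s. K i s *v Z s \<omega> \<partial>N)" for i
  proof (rule gaussian_linear_integral[where N = N and Z = "\<lambda>s \<omega>. K i s *v Z s \<omega>", OF _ m1])
    show "finite_measure N" by (rule N.finite_measure_axioms)
    show "(\<integral>\<^sup>+s. msq M (\<lambda>\<omega>. K i s *v Z s \<omega>) \<partial>N) < \<infinity>"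
      using KZ[of i] fin by (intro order.strict_trans1[OF KZ]) (simp add: ZN ennreal_mult_less_top)
    show "gaussian_linear (\<lambda>\<omega>. K i s *v Z s \<omega>)" for s by (rule gaussian_linear_matrix_mult[OF gl])
  qed
  have gl3: "gaussian_linear (\<lambda>\<omega>. \<integral>s. w s *\<^sub>R (K i s *v Z s \<omega>) \<partial>lborel)" for i
  proof (rule gaussian_linear_limit)
    \<comment> \<open>The integral against w and the integral over N agree on
      \<open>space M\<close>, so they are at distance 0 and \<open>gaussian_linear\<close> is
      inherited as a trivial limit.\<close>
    have 0: "msq M (\<lambda>\<omega>. (\<integral>s. w s *\<^sub>R (K i s *v Z s \<omega>) \<partial>lborel) - (\<integral>s. K i s *v Z s \<omega> \<partial>N)) = 0"
      using msq_cong[of M "\<lambda>\<omega>. (\<integral>s. w s *\<^sub>R (K i s *v Z s \<omega>) \<partial>lborel) - (\<integral>s. K i s *v Z s \<omega> \<partial>N)" "\<lambda>_. 0::real^'r"]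
      by (simp add: eq msq_def)
    show "\<exists>Y. gaussian_linear Y \<and> msq M (\<lambda>\<omega>. (\<integral>s. w s *\<^sub>R (K i s *v Z s \<omega>) \<partial>lborel) - Y \<omega>) < ennreal \<epsilon>"
      if "\<epsilon> > 0" for \<epsilon> using gl2[of i] 0 that by (intro exI[of _ "\<lambda>\<omega>. \<integral>s. K i s *v Z s \<omega> \<partial>N"]) simp
    show "(\<lambda>\<omega>. \<integral>s. w s *\<^sub>R (K i s *v Z s \<omega>) \<partial>lborel) \<in> borel_measurable M"
      using gaussian_linearD[OF gl2[of i]] by (simp add: eq cong: measurable_cong)
  qed
  define S where "S = (\<integral>\<^sup>+s. msq M (Z s) \<partial>N)"
  have S: "S < \<infinity>" using fin by (simp add: S_def ZN)
  have fub: "(\<integral>\<^sup>+\<omega>. msq N (\<lambda>s. F s \<omega>) \<partial>M) = (\<integral>\<^sup>+s. msq M (F s) \<partial>N)"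
    if "(\<lambda>(s, \<omega>). F s \<omega>) \<in> borel_measurable (N \<Otimes>\<^sub>M M)" for F :: "real \<Rightarrow> 'w \<Rightarrow> real^'u::finite"
  proof -
    have [measurable]: "(\<lambda>(s, \<omega>). F s \<omega>) \<in> borel_measurable (borel \<Otimes>\<^sub>M M)"
      using that measurable_cong_sets[OF sets_pair_measure_cong[OF sets_N refl] refl] by blast
    show ?thesis unfolding msq_def by (rule P.Fubini') measurable
  qed
  have bound: "msq M (\<lambda>\<omega>. \<integral>s. w s *\<^sub>R (K i s *v Z s \<omega>) \<partial>lborel) \<le> ennreal c * (ennreal (L\<^sup>2) * S)" for i
  proof -
    have "msq M (\<lambda>\<omega>. \<integral>s. w s *\<^sub>R (K i s *v Z s \<omega>) \<partial>lborel) \<le> (\<integral>\<^sup>+\<omega>. ennreal c * msq N (\<lambda>s. K i s *v Z s \<omega>) \<partial>M)"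
      unfolding msq_def[of M] emN[symmetric] by (intro nn_integral_mono) (simp add: eq norm_integral_sq_le)
    also have "\<dots> = ennreal c * (\<integral>\<^sup>+s. msq M (\<lambda>\<omega>. K i s *v Z s \<omega>) \<partial>N)"
      unfolding fub[OF m1, symmetric] unfolding msq_def by (rule nn_integral_cmult) measurable
    also have "\<dots> \<le> ennreal c * (ennreal (L\<^sup>2) * S)"
      unfolding S_def by (intro mult_left_mono KZ) simp
    finally show ?thesis .
  qed
  have "ennreal c * (ennreal (L\<^sup>2) * S) < \<infinity>" using S by (simp add: ennreal_mult_less_top)
  then obtain C where "ennreal c * (ennreal (L\<^sup>2) * S) = ennreal C"
    by (cases "ennreal c * (ennreal (L\<^sup>2) * S)") auto
  moreover have "(\<lambda>(i, \<omega>). \<integral>s. w s *\<^sub>R (K i s *v Z s \<omega>) \<partial>lborel) \<in> borel_measurable (borel \<Otimes>\<^sub>M M)"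
    by measurable
  ultimately show "linear_field (\<lambda>i \<omega>. \<integral>s. w s *\<^sub>R (K i s *v Z s \<omega>) \<partial>lborel)"
    unfolding linear_field_def using gl3 bound by auto
  have mZ: "(\<lambda>(s, \<omega>). Z s \<omega>) \<in> borel_measurable (N \<Otimes>\<^sub>M M)" by measurable
  \<comment> \<open>A finite total second moment makes almost every path square integrable for N,
    hence integrable, as N is finite.\<close>
  have "AE \<omega> in M. msq N (\<lambda>s. Z s \<omega>) \<noteq> \<infinity>"
  proof (rule nn_integral_PInf_AE)
    show "(\<lambda>\<omega>. msq N (\<lambda>s. Z s \<omega>)) \<in> borel_measurable M" unfolding msq_def by measurable
    show "(\<integral>\<^sup>+\<omega>. msq N (\<lambda>s. Z s \<omega>) \<partial>M) \<noteq> \<infinity>" using S fub[OF mZ] by (simp add: S_def)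
  qed
  with AE_space show "AE \<omega> in M. integrable lborel (\<lambda>s. w s *\<^sub>R Z s \<omega>)"
  proof eventually_elim
    case (elim \<omega>)
    then have "integrable N (\<lambda>s. Z s \<omega>)"
      by (intro N.msq_finite_integrable) (auto simp: less_top)
    with elim w_nonneg show ?case unfolding N_def by (subst (asm) integrable_density) auto
  qed
qed

text \<open>The case of the weight \<open>indicat_real {a..b}\<close>, which the support condition
  on K makes invisible.\<close>

lemma kernel_integral_field:
  fixes Z :: "real \<Rightarrow> 'w \<Rightarrow> real^'q::finite"
    and K :: "'i::second_countable_topology \<Rightarrow> real \<Rightarrow> real^'q^'r::finite"
  assumes Z: "linear_field Z" and K: "bounded_borel (\<lambda>(i, s). K i s)"
    and supp: "\<And>i s. s \<notin> {a..b} \<Longrightarrow> K i s = 0"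
  shows "linear_field (\<lambda>i \<omega>. \<integral>s. K i s *v Z s \<omega> \<partial>lborel)"
proof -
  note [measurable] = linear_field_measurable[OF Z]
  obtain B where B: "\<And>s. msq M (Z s) \<le> ennreal B" using Z by (auto simp: linear_field_def)
  have "linear_field (\<lambda>i \<omega>. \<integral>s. indicat_real {a..b} s *\<^sub>R (K i s *v Z s \<omega>) \<partial>lborel)"
  proof (rule weighted_integral_field(1)[OF _ _ _ _ _ K])
    have "(\<integral>\<^sup>+s. ennreal (indicat_real {a..b} s) * msq M (Z s) \<partial>lborel) \<le>
      (\<integral>\<^sup>+s. ennreal B * indicator {a..b} s \<partial>lborel)"
      using B by (intro nn_integral_mono) (auto simp: indicator_def)
    also have "\<dots> < \<infinity>" by (simp add: nn_integral_cmult emeasure_lborel_Icc_eq ennreal_mult_less_top)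
    finally show "(\<integral>\<^sup>+s. ennreal (indicat_real {a..b} s) * msq M (Z s) \<partial>lborel) < \<infinity>" .
  qed (use Z in \<open>auto simp: linear_field_def emeasure_lborel_Icc_eq\<close>)
  moreover have "indicat_real {a..b} s *\<^sub>R (K i s *v Z s \<omega>) = K i s *v Z s \<omega>" for i s \<omega>
    using supp[of s i] by (auto simp: indicator_def)
  ultimately show ?thesis by simp
qed

lemma linear_field_extended_process:
  fixes Z :: "'i::euclidean_space \<Rightarrow> 'w \<Rightarrow> real^'r::finite"
  assumes Z: "linear_field Z" and I: "I \<in> sets borel" "emeasure lborel I < \<infinity>"
  shows "extended_linear_process M W T I Z"
  unfolding extended_linear_process_def
proof (intro conjI)
  let ?L = "restrict_space lborel I"
  have space_L: "space ?L = I" by (simp add: space_restrict_space)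
  interpret L: finite_measure ?L
    using I by (intro finite_measureI) (simp add: emeasure_restrict_space space_restrict_space)
  interpret P: pair_sigma_finite ?L M ..
  note [measurable] = linear_field_measurable[OF Z]
  have [measurable]: "(\<lambda>(i, \<omega>). Z i \<omega>) \<in> borel_measurable (?L \<Otimes>\<^sub>M M)"
  proof -
    have "(\<lambda>p. p) \<in> measurable (?L \<Otimes>\<^sub>M M) (borel \<Otimes>\<^sub>M M)"
      by (rule measurable_pair) (auto intro: measurable_restrict_space1 simp: comp_def
          intro!: measurable_compose[OF measurable_fst measurable_restrict_space1])
    from measurable_compose[OF this linear_field_measurable[OF Z]] show ?thesis by simp
  qed
  obtain B where B: "\<And>s. msq M (Z s) \<le> ennreal B" using Z by (auto simp: linear_field_def)
  show "L2_process M I Z"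
    unfolding L2_process_def
  proof (intro conjI ballI)
    show "integrable M (\<lambda>\<omega>. (norm (Z i \<omega>))\<^sup>2)" for i
      using Z gaussian_linear_msq gaussian_linearD by (intro msq_integrable) (auto simp: linear_field_def)
    have "(\<integral>\<^sup>+p. ennreal (norm (case p of (t, \<omega>) \<Rightarrow> (norm (Z t \<omega>))\<^sup>2)) \<partial>(?L \<Otimes>\<^sub>M M)) = (\<integral>\<^sup>+t. msq M (Z t) \<partial>?L)"
      unfolding msq_def by (subst nn_integral_fst[symmetric]) (simp_all add: split_beta')
    also have "\<dots> \<le> (\<integral>\<^sup>+t. ennreal B \<partial>?L)" by (intro nn_integral_mono B)
    also have "\<dots> < \<infinity>" by (auto simp: ennreal_mult_eq_top_iff less_top[symmetric] L.emeasure_eq_measure)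
    finally show "integrable (?L \<Otimes>\<^sub>M M) (\<lambda>(t, \<omega>). (norm (Z t \<omega>))\<^sup>2)"
      by (intro integrableI_bounded) measurable
  qed measurable
  \<comment> \<open>\<open>extended_linear_process\<close> asks for mean and kernel at each index
    separately, so they may be chosen pointwise.\<close>
  have "\<forall>t. \<exists>f c. wiener_integral M W 0 T f (\<lambda>\<omega>. Z t \<omega> - c)"
    using Z gaussian_linear_wiener_integral by (auto simp: linear_field_def)
  then obtain Lker Lbar where "\<And>t. wiener_integral M W 0 T (Lker t) (\<lambda>\<omega>. Z t \<omega> - Lbar t)" by metis
  then show "\<exists>Lbar Lker. \<forall>t\<in>I. wiener_integral M W 0 T (Lker t) (\<lambda>\<omega>. Z t \<omega> - Lbar t)" by blast
qed

text \<open>\<open>L2_process\<close> lives on a product with a restricted time space. The zero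
  extension moves it to the whole line, where it can be combined with the other fields.\<close>

lemma L2_process_extend:
  fixes X :: "real \<Rightarrow> 'w \<Rightarrow> real^'r::finite"
  assumes "L2_process M {a..b} X"
  defines "X' \<equiv> \<lambda>s \<omega>. indicat_real {a..b} s *\<^sub>R X s \<omega>"
  shows "(\<lambda>(s, \<omega>). X' s \<omega>) \<in> borel_measurable (borel \<Otimes>\<^sub>M M)"
    and "msq (lborel \<Otimes>\<^sub>M M) (\<lambda>(s, \<omega>). X' s \<omega>) < \<infinity>"
proof -
  let ?L = "restrict_space lborel {a..b}"
  let ?R = "restrict_space (lborel \<Otimes>\<^sub>M M) ({a..b} \<times> space M)"
  have set: "{a..b} \<times> space M \<in> sets (lborel \<Otimes>\<^sub>M M)" by auto
  have id: "(\<lambda>p. p) \<in> measurable ?R (?L \<Otimes>\<^sub>M M)"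
  proof (rule measurable_pair)
    show "fst \<circ> (\<lambda>p. p) \<in> measurable ?R ?L"
      by (rule measurable_restrict_space2)
        (auto simp: space_restrict_space comp_def intro: measurable_restrict_space1)
    show "snd \<circ> (\<lambda>p. p) \<in> measurable ?R M"
      by (auto simp: comp_def intro: measurable_restrict_space1)
  qed
  have "(\<lambda>(t, \<omega>). X t \<omega>) \<in> borel_measurable (?L \<Otimes>\<^sub>M M)" using assms by (simp add: L2_process_def)
  from measurable_compose[OF id this]
  have "(\<lambda>p. indicat_real ({a..b} \<times> space M) p *\<^sub>R (case p of (t, \<omega>) \<Rightarrow> X t \<omega>)) \<in> borel_measurable (lborel \<Otimes>\<^sub>M M)"
    using set by (subst (asm) borel_measurable_restrict_space_iff) (auto simp: space_pair_measure)
  also have "?this \<longleftrightarrow> (\<lambda>(s, \<omega>). X' s \<omega>) \<in> borel_measurable (lborel \<Otimes>\<^sub>M M)"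
    by (intro measurable_cong) (auto simp: X'_def indicator_def space_pair_measure)
  finally have m[measurable]: "(\<lambda>(s, \<omega>). X' s \<omega>) \<in> borel_measurable (lborel \<Otimes>\<^sub>M M)" .
  then show "(\<lambda>(s, \<omega>). X' s \<omega>) \<in> borel_measurable (borel \<Otimes>\<^sub>M M)" by measurable
  have i: "integrable (?L \<Otimes>\<^sub>M M) (\<lambda>(t, \<omega>). (norm (X t \<omega>))\<^sup>2)" using assms by (simp add: L2_process_def)
  have mL: "(\<lambda>(t, \<omega>). (norm (X t \<omega>))\<^sup>2) \<in> borel_measurable (?L \<Otimes>\<^sub>M M)" using i by auto
  have "msq (lborel \<Otimes>\<^sub>M M) (\<lambda>(s, \<omega>). X' s \<omega>) = (\<integral>\<^sup>+s. (\<integral>\<^sup>+\<omega>. ennreal ((norm (X' s \<omega>))\<^sup>2) \<partial>M) \<partial>lborel)"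
    unfolding msq_def by (subst nn_integral_fst[symmetric]) (simp_all add: split_beta')
  also have "\<dots> = (\<integral>\<^sup>+s. (\<integral>\<^sup>+\<omega>. ennreal ((norm (X s \<omega>))\<^sup>2) \<partial>M) * indicator {a..b} s \<partial>lborel)"
    by (intro nn_integral_cong) (auto simp: X'_def indicator_def)
  also have "\<dots> = (\<integral>\<^sup>+s. (\<integral>\<^sup>+\<omega>. ennreal ((norm (X s \<omega>))\<^sup>2) \<partial>M) \<partial>?L)"
    by (subst nn_integral_restrict_space) auto
  also have "\<dots> = (\<integral>\<^sup>+p. ennreal (case p of (t, \<omega>) \<Rightarrow> (norm (X t \<omega>))\<^sup>2) \<partial>(?L \<Otimes>\<^sub>M M))"
    using mL by (subst nn_integral_fst[symmetric]) (auto simp: split_beta')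
  also have "\<dots> < \<infinity>"
    using i by (subst nn_integral_eq_integral) (auto simp: split_beta')
  finally show "msq (lborel \<Otimes>\<^sub>M M) (\<lambda>(s, \<omega>). X' s \<omega>) < \<infinity>" .
qed

end

section \<open>State, forcing and backward paths\<close>

lemma has_derivative_path_cong:
  assumes "has_derivative_path a b h r" "\<And>s. s \<in> {a..b} \<Longrightarrow> r s = r' s"
  shows "has_derivative_path a b h r'"
proof -
  have "set_integrable lborel {a..b} r'"
    using assms set_integrable_cong[of lborel lborel "{a..b}" "{a..b}" r r'] by (simp add: has_derivative_path_def)
  moreover have "(LINT s:{a..t}|lborel. r s) = (LINT s:{a..t}|lborel. r' s)" if "t \<in> {a..b}" for t
    using assms(2) that by (intro set_lebesgue_integral_cong) auto
  ultimately show ?thesis using assms(1) unfolding has_derivative_path_def by metis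
qed

text \<open>The fields are constructed as tail integrals up to T, while
  \<open>has_derivative_path\<close> counts from the left end; hence the change of sign. At T the
  tail shrinks to a null set and leaves the terminal value.\<close>

lemma backward_path:
  fixes \<rho> :: "real \<Rightarrow> 'a::euclidean_space"
  assumes "set_integrable lborel {a..T} \<rho>" "a \<le> T"
    and h: "\<And>t. t \<in> {a..T} \<Longrightarrow> h t = c + (LINT s:{t..T}|lborel. \<rho> s)"
  shows "has_derivative_path a T h (\<lambda>s. - \<rho> s)" and "h T = c"
proof -
  have null: "(LINT s:{t}|lborel. \<rho> s) = 0" for t
  proof -
    have "AE s in lborel. indicat_real {t} s *\<^sub>R \<rho> s = 0"
      using AE_lborel_singleton[of t] by eventually_elim (simp add: indicator_def)
    then show ?thesis
      unfolding set_lebesgue_integral_def by (rule integral_eq_zero_AE)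
  qed
  show hT: "h T = c" using h[of T] assms(2) null[of T] by simp
  have split: "(LINT s:{a..T}|lborel. \<rho> s) = (LINT s:{a..t}|lborel. \<rho> s) + (LINT s:{t..T}|lborel. \<rho> s)"
    if t: "t \<in> {a..T}" for t
  proof -
    have i: "set_integrable lborel {a..t} \<rho>" "set_integrable lborel {t..T} \<rho>"
      using t by (auto intro: set_integrable_subset[OF assms(1)])
    \<comment> \<open>The point t belongs to both halves, which matters only on a null set.\<close>
    have "AE s in lborel. indicat_real {a..T} s *\<^sub>R \<rho> s = indicat_real {a..t} s *\<^sub>R \<rho> s + indicat_real {t..T} s *\<^sub>R \<rho> s"
      using AE_lborel_singleton[of t] by eventually_elim (use t in \<open>auto simp: indicator_def\<close>)
    then have "(LINT s:{a..T}|lborel. \<rho> s) = (\<integral>s. indicat_real {a..t} s *\<^sub>R \<rho> s + indicat_real {t..T} s *\<^sub>R \<rho> s \<partial>lborel)"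
      unfolding set_lebesgue_integral_def
      using assms(1) i by (intro integral_cong_AE) (auto simp: set_integrable_def)
    also have "\<dots> = (LINT s:{a..t}|lborel. \<rho> s) + (LINT s:{t..T}|lborel. \<rho> s)"
      using i unfolding set_lebesgue_integral_def set_integrable_def by (rule Bochner_Integration.integral_add)
    finally show ?thesis .
  qed
  show "has_derivative_path a T h (\<lambda>s. - \<rho> s)"
    unfolding has_derivative_path_def
  proof (intro conjI ballI)
    show "set_integrable lborel {a..T} (\<lambda>s. - \<rho> s)" using assms(1) by (simp add: set_integrable_def)
    fix t assume t: "t \<in> {a..T}"
    have "(LINT s:{a..t}|lborel. - \<rho> s) = - (LINT s:{a..t}|lborel. \<rho> s)"
      by (simp add: set_lebesgue_integral_def)
    then show "h t = h a + (LINT s:{a..t}|lborel. - \<rho> s)"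
      using h[OF t] h[of a] split[OF t] assms(2) by simp
  qed
qed

lemma bounded_borel_uncurry:
  fixes K :: "real \<Rightarrow> real \<Rightarrow> 'a::real_normed_vector"
  assumes K: "bounded_borel (\<lambda>(t, u). K t u)" and f: "f \<in> borel_measurable borel" and g: "g \<in> borel_measurable borel"
  shows "bounded_borel (\<lambda>x. K (f x) (g x))"
proof -
  have fg: "(\<lambda>x. (f x, g x)) \<in> borel_measurable borel"
    using f g by (rule borel_measurable_Pair)
  have "bounded_borel (\<lambda>x. (\<lambda>(t, u). K t u) (f x, g x))"
    by (rule bounded_borel_compose[OF K fg])
  then show ?thesis unfolding split .
qed

text \<open>This is the substitution that produces the Volterra equation. H is a tail integral in s,
  its load contains a memory integral in z, and Fubini turns the load of H into one tail integral of
  Y against a new kernel. In the application \<open>e\<close> is the error kernel, \<open>L1\<close>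
  is the observation matrix transposed times the selector, and \<open>L2\<close> is
  \<open>mat_P\<close>.\<close>

lemma memory_integral_exchange:
  fixes \<Phi> :: "real \<Rightarrow> real \<Rightarrow> real^'n::finite^'m::finite" and e :: "real \<Rightarrow> real^'m^'k::finite"
    and L1 :: "real^'m^'l::finite" and L2 :: "real^'k^'l" and Y :: "real \<Rightarrow> real^'n"
  assumes \<Phi>: "bounded_borel (\<lambda>(s, u). \<Phi> s u)" and e: "bounded_borel e" and Y: "bounded_borel Y"
    and supp: "\<And>z. z \<notin> {0..T} \<Longrightarrow> e z = 0" and t: "0 \<le> t"
  defines "H \<equiv> \<lambda>u. \<integral>s. indicat_real {t..T} s *\<^sub>R (\<Phi> s u *v Y s) \<partial>lborel"
  shows "bounded_borel H"
    and "(\<integral>s. indicat_real {t..T} s *\<^sub>R ((L1 ** \<Phi> s u + L2 ** (\<integral>z. e z ** \<Phi> s z \<partial>lborel)) *v Y s) \<partial>lborel) =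
      L1 *v H u + L2 *v (\<integral>z. e z *v H z \<partial>lborel)" (is "?lhs = ?rhs")
proof -
  interpret mv: bounded_bilinear "(*v) :: real^'n^'m \<Rightarrow> real^'n \<Rightarrow> real^'m"
    by (rule bounded_bilinear_matrix_vector_mult)
  interpret mvk: bounded_bilinear "(*v) :: real^'m^'k \<Rightarrow> real^'m \<Rightarrow> real^'k"
    by (rule bounded_bilinear_matrix_vector_mult)
  interpret mvn: bounded_bilinear "(*v) :: real^'n^'k \<Rightarrow> real^'n \<Rightarrow> real^'k"
    by (rule bounded_bilinear_matrix_vector_mult)
  interpret mv1: bounded_bilinear "(*v) :: real^'m^'l \<Rightarrow> real^'m \<Rightarrow> real^'l"
    by (rule bounded_bilinear_matrix_vector_mult)
  interpret mv2: bounded_bilinear "(*v) :: real^'k^'l \<Rightarrow> real^'k \<Rightarrow> real^'l"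
    by (rule bounded_bilinear_matrix_vector_mult)
  interpret mm: bounded_bilinear "(**) :: real^'m^'k \<Rightarrow> real^'n^'m \<Rightarrow> real^'n^'k"
    by (rule bounded_bilinear_matrix_matrix_mult)
  note bb = bounded_borel_scaleR bounded_borel_matrix_mult bounded_borel_matrix_vector_mult
    bounded_borel_uncurry[OF \<Phi>] bounded_borel_compose[OF Y] bounded_borel_compose[OF e]
    bounded_borel_compose[OF bounded_borel_indicator]
  note cont = borel_measurable_continuous_onI continuous_on_fst continuous_on_snd continuous_on_id continuous_on_const
  have joint: "bounded_borel (\<lambda>(u, s). indicat_real {t..T} s *\<^sub>R (\<Phi> s u *v Y s))"
    unfolding split_beta' by (intro bb cont) auto
  show H: "bounded_borel H"
    unfolding H_def by (rule bounded_borel_integral[OF joint, of t T]) simp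
  define I where "I s = (\<integral>z. e z ** \<Phi> s z \<partial>lborel)" for s
  have jI: "bounded_borel (\<lambda>(s, z). e z ** \<Phi> s z)"
    unfolding split_beta' by (intro bb cont)
  have eI: "e z ** \<Phi> s z = 0" if "z \<notin> {0..T}" for s z using supp[OF that] by (simp add: mm.zero_left)
  have I: "bounded_borel I" unfolding I_def by (rule bounded_borel_integral[OF jI eI])
  have i_u: "integrable lborel (\<lambda>s. indicat_real {t..T} s *\<^sub>R (\<Phi> s u *v Y s))" for u
    using bounded_borel_compose[OF joint, of "\<lambda>s. (u, s)"]
    by (intro integrable_bounded_borel[of _ t T]) auto
  have i_z: "integrable lborel (\<lambda>z. e z ** \<Phi> s z)" for s
    using bounded_borel_compose[OF jI, of "\<lambda>z. (s, z)"] eI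
    by (intro integrable_bounded_borel[of _ 0 T]) auto
  have i_I: "integrable lborel (\<lambda>s. indicat_real {t..T} s *\<^sub>R (I s *v Y s))"
    by (intro integrable_bounded_borel[of _ t T] bounded_borel_scaleR bounded_borel_matrix_vector_mult
        bounded_borel_indicator I Y) auto
  have i_p: "integrable (lborel \<Otimes>\<^sub>M lborel) (\<lambda>(s, z). indicat_real {t..T} s *\<^sub>R ((e z ** \<Phi> s z) *v Y s))"
  proof (rule integrable_bounded_borel_prod[of _ 0 T])
    show "bounded_borel (\<lambda>(s, z). indicat_real {t..T} s *\<^sub>R ((e z ** \<Phi> s z) *v Y s))"
      unfolding split_beta' by (intro bb cont) auto
    show "(\<lambda>(s, z). indicat_real {t..T} s *\<^sub>R ((e z ** \<Phi> s z) *v Y s)) (s, z) = 0"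
      if "s \<notin> {0..T} \<or> z \<notin> {0..T}" for s z
      using that t eI[of z s] by (cases "z \<in> {0..T}") (auto simp: indicator_def mvn.zero_left)
  qed
  have 1: "indicat_real {t..T} s *\<^sub>R ((L1 ** \<Phi> s u + L2 ** I s) *v Y s) =
     L1 *v (indicat_real {t..T} s *\<^sub>R (\<Phi> s u *v Y s)) + L2 *v (indicat_real {t..T} s *\<^sub>R (I s *v Y s))" for s
    by (simp add: matrix_vector_mult_add_rdistrib mv1.scaleR_right mv2.scaleR_right scaleR_right_distrib
        matrix_vector_mul_assoc)
  have "?lhs = L1 *v H u + L2 *v (\<integral>s. indicat_real {t..T} s *\<^sub>R (I s *v Y s) \<partial>lborel)"
    unfolding I_def[symmetric] 1 H_def
    using i_u i_I by (simp add: integral_bounded_linear[OF mv1.bounded_linear_right]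
        integral_bounded_linear[OF mv2.bounded_linear_right]
        integrable_bounded_linear[OF mv1.bounded_linear_right] integrable_bounded_linear[OF mv2.bounded_linear_right])
  also have "(\<integral>s. indicat_real {t..T} s *\<^sub>R (I s *v Y s) \<partial>lborel) =
    (\<integral>s. (\<integral>z. indicat_real {t..T} s *\<^sub>R ((e z ** \<Phi> s z) *v Y s) \<partial>lborel) \<partial>lborel)"
    unfolding I_def by (simp add: integral_bounded_linear[OF mvn.bounded_linear_left i_z])
  also have "\<dots> = (\<integral>z. (\<integral>s. indicat_real {t..T} s *\<^sub>R ((e z ** \<Phi> s z) *v Y s) \<partial>lborel) \<partial>lborel)"
    using lborel_pair.Fubini_integral[OF i_p] by simp
  also have "\<dots> = (\<integral>z. e z *v H z \<partial>lborel)"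
  proof (rule Bochner_Integration.integral_cong[OF refl])
    fix z
    have "(\<integral>s. indicat_real {t..T} s *\<^sub>R ((e z ** \<Phi> s z) *v Y s) \<partial>lborel) =
      (\<integral>s. e z *v (indicat_real {t..T} s *\<^sub>R (\<Phi> s z *v Y s)) \<partial>lborel)"
      by (simp add: mvk.scaleR_right matrix_vector_mul_assoc)
    also have "\<dots> = e z *v H z"
      unfolding H_def by (rule integral_bounded_linear[OF mvk.bounded_linear_right i_u])
    finally show "(\<integral>s. indicat_real {t..T} s *\<^sub>R ((e z ** \<Phi> s z) *v Y s) \<partial>lborel) = e z *v H z" .
  qed
  finally show "?lhs = ?rhs" .
qed

section \<open>Extension of coefficients by zero\<close>

lemma bounded_coeff_extend:
  assumes "bounded_coeff T f"
  shows "bounded_borel (\<lambda>s. indicat_real {0..T} s *\<^sub>R f s)"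
proof -
  obtain B where "\<forall>s\<in>{0..T}. norm (f s) \<le> B"
    using assms by (auto simp: bounded_coeff_def bounded_iff)
  then show ?thesis
    using assms
    by (intro bounded_borelI[of _ "max B 0"])
      (auto simp: bounded_coeff_def set_borel_measurable_def indicator_def intro: max.coboundedI1)
qed

lemma bounded_kernel_extend:
  assumes "bounded_kernel T K"
  shows "bounded_borel (\<lambda>(t, u). indicat_real (triangle T) (t, u) *\<^sub>R K t u)"
proof -
  obtain B where "\<And>t u. (t, u) \<in> triangle T \<Longrightarrow> norm (K t u) \<le> B"
    using assms by (fastforce simp: bounded_kernel_def bounded_iff)
  then have "norm (indicat_real (triangle T) (t, u) *\<^sub>R K t u) \<le> max B 0" for t u
    by (cases "(t, u) \<in> triangle T") (auto intro: max.coboundedI1)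
  then show ?thesis
    using assms
    by (intro bounded_borelI[of _ "max B 0"])
      (auto simp: bounded_kernel_def measurable_kernel_def set_borel_measurable_def split_beta')
qed

lemma triangle_borel: "triangle T \<in> sets borel"
proof -
  have "closed {x::real \<times> real. 0 \<le> snd x \<and> snd x \<le> fst x \<and> fst x \<le> T}"
    by (intro closed_Collect_conj closed_Collect_le continuous_intros)
  moreover have "{x. 0 \<le> snd x \<and> snd x \<le> fst x \<and> fst x \<le> T} = triangle T"
    by (auto simp: triangle_def)
  ultimately show ?thesis by (simp add: borel_closed)
qed

lemma emeasure_triangle_finite: "emeasure lborel (triangle T) < \<infinity>"
proof -
  have "bounded (triangle T)"
    by (rule bounded_subset[of "cbox (0,0) (T,T)"]) (auto simp: triangle_def)
  then show ?thesis by (rule emeasure_bounded_finite)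
qed

section \<open>Second moments of the state and of the forcing\<close>

context noise_space begin

lemma msq_section_integral:
  assumes [measurable]: "(\<lambda>(s, \<omega>). Z s \<omega>) \<in> borel_measurable (borel \<Otimes>\<^sub>M M)"
  shows "msq (lborel \<Otimes>\<^sub>M M) (\<lambda>(s, \<omega>). Z s \<omega>) = (\<integral>\<^sup>+s. msq M (Z s) \<partial>lborel)"
  unfolding msq_def by (subst nn_integral_fst[symmetric]) (simp_all add: split_beta')

text \<open>Cauchy-Schwarz over [0,t] costs the mass t <= T, so the bound is the same for all
  t.\<close>

lemma msq_time_integral_le:
  fixes b :: "real \<Rightarrow> 'w \<Rightarrow> real^'r::finite"
  assumes b[measurable]: "(\<lambda>(s, \<omega>). b s \<omega>) \<in> borel_measurable (borel \<Otimes>\<^sub>M M)" and t: "t \<in> {0..T}"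
  shows "(\<lambda>\<omega>. \<integral>s. indicat_real {0..t} s *\<^sub>R b s \<omega> \<partial>lborel) \<in> borel_measurable M"
    and "msq M (\<lambda>\<omega>. \<integral>s. indicat_real {0..t} s *\<^sub>R b s \<omega> \<partial>lborel) \<le>
      ennreal T * msq (lborel \<Otimes>\<^sub>M M) (\<lambda>(s, \<omega>). b s \<omega>)"
proof -
  interpret P: pair_sigma_finite lborel M ..
  have b'[measurable]: "(\<lambda>(\<omega>, s). b s \<omega>) \<in> borel_measurable (M \<Otimes>\<^sub>M borel)"
    using measurable_pair_swap[OF b] by (simp add: split_beta')
  show "(\<lambda>\<omega>. \<integral>s. indicat_real {0..t} s *\<^sub>R b s \<omega> \<partial>lborel) \<in> borel_measurable M" by measurable
  define N where "N = density lborel (\<lambda>s. ennreal (indicat_real {0..t} s))"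
  have emN: "emeasure N (space N) \<le> ennreal T"
    using t by (simp add: N_def emeasure_density ennreal_indicator ennreal_leI)
  have "ennreal ((norm (\<integral>s. indicat_real {0..t} s *\<^sub>R b s \<omega> \<partial>lborel))\<^sup>2) \<le> ennreal T * msq lborel (\<lambda>s. b s \<omega>)"
    if [measurable]: "\<omega> \<in> space M" for \<omega>
  proof -
    have [measurable]: "(\<lambda>s. b s \<omega>) \<in> borel_measurable borel" by measurable
    have "(\<integral>s. indicat_real {0..t} s *\<^sub>R b s \<omega> \<partial>lborel) = (\<integral>s. b s \<omega> \<partial>N)"
      unfolding N_def by (subst integral_density) auto
    then have "ennreal ((norm (\<integral>s. indicat_real {0..t} s *\<^sub>R b s \<omega> \<partial>lborel))\<^sup>2) \<le> emeasure N (space N) * msq N (\<lambda>s. b s \<omega>)"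
      using norm_integral_sq_le[of "\<lambda>s. b s \<omega>" N] by (simp add: N_def)
    also have "\<dots> \<le> ennreal T * msq lborel (\<lambda>s. b s \<omega>)"
    proof (rule mult_mono[OF emN])
      show "msq N (\<lambda>s. b s \<omega>) \<le> msq lborel (\<lambda>s. b s \<omega>)"
        unfolding msq_def N_def by (subst nn_integral_density) (auto intro!: nn_integral_mono simp: indicator_def)
    qed auto
    finally show ?thesis .
  qed
  then have "msq M (\<lambda>\<omega>. \<integral>s. indicat_real {0..t} s *\<^sub>R b s \<omega> \<partial>lborel) \<le> (\<integral>\<^sup>+\<omega>. ennreal T * msq lborel (\<lambda>s. b s \<omega>) \<partial>M)"
    unfolding msq_def[of M] by (intro nn_integral_mono)
  also have "\<dots> = ennreal T * (\<integral>\<^sup>+\<omega>. msq lborel (\<lambda>s. b s \<omega>) \<partial>M)"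
    unfolding msq_def by (rule nn_integral_cmult) measurable
  also have "(\<integral>\<^sup>+\<omega>. msq lborel (\<lambda>s. b s \<omega>) \<partial>M) = (\<integral>\<^sup>+s. msq M (b s) \<partial>lborel)"
    unfolding msq_def by (rule P.Fubini') measurable
  also have "\<dots> = msq (lborel \<Otimes>\<^sub>M M) (\<lambda>(s, \<omega>). b s \<omega>)" by (rule msq_section_integral[OF b, symmetric])
  finally show "msq M (\<lambda>\<omega>. \<integral>s. indicat_real {0..t} s *\<^sub>R b s \<omega> \<partial>lborel) \<le>
      ennreal T * msq (lborel \<Otimes>\<^sub>M M) (\<lambda>(s, \<omega>). b s \<omega>)" .
qed

lemma msq_product_sum_finite:
  fixes Z :: "'k \<Rightarrow> real \<Rightarrow> 'w \<Rightarrow> real^'r::finite"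
  assumes "\<And>k. k \<in> S \<Longrightarrow> (\<lambda>(s, \<omega>). Z k s \<omega>) \<in> borel_measurable (borel \<Otimes>\<^sub>M M)"
    and "\<And>k. k \<in> S \<Longrightarrow> msq (lborel \<Otimes>\<^sub>M M) (\<lambda>(s, \<omega>). Z k s \<omega>) < \<infinity>"
  shows "(\<lambda>(s, \<omega>). \<Sum>k\<in>S. Z k s \<omega>) \<in> borel_measurable (borel \<Otimes>\<^sub>M M) \<and>
    msq (lborel \<Otimes>\<^sub>M M) (\<lambda>(s, \<omega>). \<Sum>k\<in>S. Z k s \<omega>) < \<infinity>"
  using assms
proof (induction S rule: infinite_finite_induct)
  case (insert k S)
  then have IH: "(\<lambda>(s, \<omega>). \<Sum>k\<in>S. Z k s \<omega>) \<in> borel_measurable (borel \<Otimes>\<^sub>M M)"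
    "msq (lborel \<Otimes>\<^sub>M M) (\<lambda>(s, \<omega>). \<Sum>k\<in>S. Z k s \<omega>) < \<infinity>"
    and k: "(\<lambda>(s, \<omega>). Z k s \<omega>) \<in> borel_measurable (borel \<Otimes>\<^sub>M M)"
    "msq (lborel \<Otimes>\<^sub>M M) (\<lambda>(s, \<omega>). Z k s \<omega>) < \<infinity>" by auto
  note [measurable] = IH(1) k(1)
  have "msq (lborel \<Otimes>\<^sub>M M) (\<lambda>p. (case p of (s, \<omega>) \<Rightarrow> Z k s \<omega>) + (case p of (s, \<omega>) \<Rightarrow> \<Sum>k\<in>S. Z k s \<omega>)) \<le>
    2 * msq (lborel \<Otimes>\<^sub>M M) (\<lambda>(s, \<omega>). Z k s \<omega>) + 2 * msq (lborel \<Otimes>\<^sub>M M) (\<lambda>(s, \<omega>). \<Sum>k\<in>S. Z k s \<omega>)"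
    by (rule msq_add) measurable
  also have "\<dots> < \<infinity>" using IH k by (simp add: ennreal_mult_less_top)
  finally have "msq (lborel \<Otimes>\<^sub>M M) (\<lambda>(s, \<omega>). \<Sum>k\<in>insert k S. Z k s \<omega>) < \<infinity>"
    using insert(1,2) by (simp add: split_beta')
  moreover have "(\<lambda>(s, \<omega>). Z k s \<omega> + (\<Sum>k\<in>S. Z k s \<omega>)) \<in> borel_measurable (borel \<Otimes>\<^sub>M M)" by measurable
  ultimately show ?case using insert(1,2) by simp
qed (auto simp: msq_def)

lemma msq_product_mult_finite:
  fixes A :: "real \<Rightarrow> real^'q::finite^'r::finite"
  assumes A: "bounded_borel A"
    and [measurable]: "(\<lambda>(s, \<omega>). Z s \<omega>) \<in> borel_measurable (borel \<Otimes>\<^sub>M M)"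
    and fin: "msq (lborel \<Otimes>\<^sub>M M) (\<lambda>(s, \<omega>). Z s \<omega>) < \<infinity>"
  shows "(\<lambda>(s, \<omega>). A s *v Z s \<omega>) \<in> borel_measurable (borel \<Otimes>\<^sub>M M)"
    and "msq (lborel \<Otimes>\<^sub>M M) (\<lambda>(s, \<omega>). A s *v Z s \<omega>) < \<infinity>"
proof -
  have [measurable]: "A \<in> borel_measurable borel" using A by (rule bounded_borelD)
  show "(\<lambda>(s, \<omega>). A s *v Z s \<omega>) \<in> borel_measurable (borel \<Otimes>\<^sub>M M)" by measurable
  obtain B where B: "B > 0" "\<And>s. norm (A s) \<le> B"
    using A by (rule bounded_borel_bound) force
  obtain D where D: "D > 0" "\<And>(A :: real^'q^'r) x. norm (A *v x) \<le> norm A * norm x * D"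
    using bounded_bilinear.pos_bounded[OF bounded_bilinear_matrix_vector_mult] by blast
  have L: "norm (A s *v x) \<le> norm ((B * D) *\<^sub>R x)" for s x
  proof -
    have "norm (A s *v x) \<le> norm (A s) * norm x * D" by (rule D)
    also have "\<dots> \<le> B * norm x * D" using B D by (intro mult_right_mono) auto
    finally show ?thesis using B D by (simp add: mult_ac)
  qed
  have "msq (lborel \<Otimes>\<^sub>M M) (\<lambda>(s, \<omega>). A s *v Z s \<omega>) \<le>
    msq (lborel \<Otimes>\<^sub>M M) (\<lambda>p. (B * D) *\<^sub>R (case p of (s, \<omega>) \<Rightarrow> Z s \<omega>))"
    using L by (intro msq_mono AE_I2) (auto simp: split_beta')
  also have "\<dots> = ennreal ((B * D)\<^sup>2) * msq (lborel \<Otimes>\<^sub>M M) (\<lambda>(s, \<omega>). Z s \<omega>)"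
    by (rule msq_scaleR) measurable
  also have "\<dots> < \<infinity>" using fin by (simp add: ennreal_mult_less_top)
  finally show "msq (lborel \<Otimes>\<^sub>M M) (\<lambda>(s, \<omega>). A s *v Z s \<omega>) < \<infinity>" .
qed

text \<open>An L2 process has finite second moments at each time and over [0,T], but no bound
  uniform in t; pairing the state with a merely integrable cost needs one. In the state equation the
  Wiener part has a bounded kernel and the drift part is controlled by its L2 norm over [0,T], both
  independently of t.\<close>

lemma state_msq_bound:
  fixes G :: "('p, 'd, 'w) lq_game"
  assumes eq: "state_equation M W G X D" and T: "horizon G = T"
    and A: "bounded_coeff T (mat_A G)" and Sig: "bounded_coeff T (mat_Sigma G)"
    and X: "L2_process M {0..T} X" and D: "\<And>j. L2_process M {0..T} (D j)"
  shows "\<exists>B. \<forall>t\<in>{0..T}. msq M (X t) \<le> ennreal B"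
proof -
  define ext :: "(real \<Rightarrow> 'w \<Rightarrow> real^'d) \<Rightarrow> real \<Rightarrow> 'w \<Rightarrow> real^'d"
    where "ext = (\<lambda>Z s \<omega>. indicat_real {0..T} s *\<^sub>R Z s \<omega>)"
  define A' where "A' = (\<lambda>s. indicat_real {0..T} s *\<^sub>R mat_A G s)"
  have A': "bounded_borel A'" unfolding A'_def by (rule bounded_coeff_extend[OF A])
  note X' = L2_process_extend[OF X, folded ext_def]
  note D' = L2_process_extend[OF D, folded ext_def]
  note AX = msq_product_mult_finite[OF A' X']
  \<comment> \<open>\<open>None\<close> holds A X and \<open>Some j\<close> the control of player j,
    so the whole drift is one finite sum.\<close>
  define Z where "Z o' = (case o' of None \<Rightarrow> (\<lambda>s \<omega>. A' s *v ext X s \<omega>) | Some j \<Rightarrow> ext (D j))" for o' :: "'p option"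
  define b where "b s \<omega> = (\<Sum>o'\<in>UNIV. Z o' s \<omega>)" for s \<omega>
  have "(\<lambda>(s, \<omega>). b s \<omega>) \<in> borel_measurable (borel \<Otimes>\<^sub>M M) \<and> msq (lborel \<Otimes>\<^sub>M M) (\<lambda>(s, \<omega>). b s \<omega>) < \<infinity>"
    unfolding b_def using AX D' by (intro msq_product_sum_finite) (auto simp: Z_def ext_def split: option.splits)
  then have b: "(\<lambda>(s, \<omega>). b s \<omega>) \<in> borel_measurable (borel \<Otimes>\<^sub>M M)"
    "msq (lborel \<Otimes>\<^sub>M M) (\<lambda>(s, \<omega>). b s \<omega>) < \<infinity>" by auto
  have b_eq: "b s \<omega> = mat_A G s *v X s \<omega> + (\<Sum>j\<in>UNIV. D j s \<omega>)" if "s \<in> {0..T}" for s \<omega>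
    using that by (simp add: b_def Z_def ext_def A'_def UNIV_option_conv sum.reindex)
  define S where "S s = (mat 1 :: real^'d^'d) ** ((indicat_real {0..T} s *\<^sub>R mat_Sigma G s) ** (noise_sel None :: real^('p option \<times> 'd)^'d))" for s
  have "bounded_borel S"
    unfolding S_def by (intro bounded_borel_matrix_mult bounded_borel_const bounded_coeff_extend[OF Sig])
  then obtain C where C: "C > 0" "\<And>s. norm (S s) \<le> C" by (rule bounded_borel_bound) blast
  \<comment> \<open>Collects the Wiener part, at most 4 C^2 T by
    \<open>wiener_integral_msq_le\<close>, the initial value and the drift integral; the factors 2
    come from two uses of \<open>msq_add\<close>.\<close>
  define Bd where "Bd = 2 * (2 * (4 * (ennreal (C\<^sup>2) * ennreal T)) + 2 * ennreal ((norm (x_init G))\<^sup>2)) +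
    2 * (ennreal T * msq (lborel \<Otimes>\<^sub>M M) (\<lambda>(s, \<omega>). b s \<omega>))"
  have "Bd < \<infinity>" using b(2) by (simp add: Bd_def ennreal_mult_less_top)
  then obtain B where B: "Bd = ennreal B" by (cases Bd) auto
  have "msq M (X t) \<le> Bd" if t: "t \<in> {0..T}" for t
  proof -
    define J where "J \<omega> = (\<integral>s. indicat_real {0..t} s *\<^sub>R b s \<omega> \<partial>lborel)" for \<omega>
    define I where "I \<omega> = X t \<omega> - x_init G - J \<omega>" for \<omega>
    have J_eq: "(LINT s:{0..t}|lborel. mat 1 *v (mat_A G s *v X s \<omega> + (\<Sum>j\<in>UNIV. D j s \<omega>))) = J \<omega>" for \<omega>
      unfolding J_def set_lebesgue_integral_def
      using t b_eq by (intro Bochner_Integration.integral_cong) (auto simp: indicator_def)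
    have wi: "wiener_integral M W 0 t (\<lambda>s. mat 1 ** (mat_Sigma G s ** noise_sel None)) I"
    proof -
      have "differential_integral M W 0 t (\<lambda>_. mat 1) (\<lambda>s. mat_Sigma G s ** noise_sel None)
          (\<lambda>s \<omega>. mat_A G s *v X s \<omega> + (\<Sum>j\<in>UNIV. D j s \<omega>)) (\<lambda>\<omega>. X t \<omega> - x_init G)"
        using eq t unfolding state_equation_def T by (rule bspec)
      then show ?thesis unfolding differential_integral_def J_eq I_def[abs_def] by (rule conjunct2)
    qed
    have I[measurable]: "I \<in> borel_measurable M" using wi by (simp add: wiener_integral_def)
    have J[measurable]: "J \<in> borel_measurable M" and msqJ: "msq M J \<le> ennreal T * msq (lborel \<Otimes>\<^sub>M M) (\<lambda>(s, \<omega>). b s \<omega>)"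
      unfolding J_def using msq_time_integral_le[OF b(1) t] by auto
    have "msq M I \<le> 4 * (\<integral>\<^sup>+s\<in>{0..t}. ennreal ((norm ((mat 1 :: real^'d^'d) ** (mat_Sigma G s ** (noise_sel None :: real^('p option \<times> 'd)^'d))))\<^sup>2) \<partial>lborel)"
      using t by (intro wiener_integral_msq_le[OF wi]) auto
    also have "\<dots> \<le> 4 * (\<integral>\<^sup>+s. ennreal (C\<^sup>2) * indicator {0..T} s \<partial>lborel)"
    proof (intro mult_left_mono nn_integral_mono)
      fix s
      show "ennreal ((norm ((mat 1 :: real^'d^'d) ** (mat_Sigma G s ** (noise_sel None :: real^('p option \<times> 'd)^'d))))\<^sup>2) * indicator {0..t} s
        \<le> ennreal (C\<^sup>2) * indicator {0..T} s"
        using C(2)[of s] t by (auto simp: indicator_def S_def intro!: ennreal_leI power_mono)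
    qed simp
    also have "\<dots> = 4 * (ennreal (C\<^sup>2) * ennreal T)"
      using T_nonneg by (simp add: nn_integral_cmult)
    finally have msqI: "msq M I \<le> 4 * (ennreal (C\<^sup>2) * ennreal T)" .
    have "msq M (X t) = msq M (\<lambda>\<omega>. (I \<omega> + x_init G) + J \<omega>)" by (simp add: I_def)
    also have "\<dots> \<le> 2 * msq M (\<lambda>\<omega>. I \<omega> + x_init G) + 2 * msq M J" by (rule msq_add) measurable
    also have "\<dots> \<le> 2 * (2 * msq M I + 2 * msq M (\<lambda>_. x_init G)) + 2 * msq M J"
      by (intro add_mono mult_left_mono msq_add order_refl) auto
    also have "msq M (\<lambda>_. x_init G) = ennreal ((norm (x_init G))\<^sup>2)" by (simp add: msq_def emeasure_space_1)
    also have "2 * (2 * msq M I + 2 * ennreal ((norm (x_init G))\<^sup>2)) + 2 * msq M J \<le> Bd"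
      unfolding Bd_def by (intro add_mono mult_left_mono msqI msqJ order_refl) auto
    finally show ?thesis .
  qed
  then show ?thesis unfolding B by blast
qed

text \<open>F has to be a linear field and also agree with the tail integral along a path for all t
  at once, because the Volterra equation is solved along paths. One null set, on which the integrand
  fails to be integrable, serves all t.\<close>

lemma forcing_field:
  fixes Q :: "real \<Rightarrow> real^'d^'r::finite" and X :: "real \<Rightarrow> 'w \<Rightarrow> real^'d" and c :: "real \<Rightarrow> 'w \<Rightarrow> real^'r"
  assumes Q: "set_integrable lborel {0..T} Q"
    and X: "L2_process M {0..T} X" and glX: "\<And>t. t \<in> {0..T} \<Longrightarrow> gaussian_linear (X t)"
    and B: "\<And>t. t \<in> {0..T} \<Longrightarrow> msq M (X t) \<le> ennreal B"
    and c: "L2_process M {0..T} c" and glc: "\<And>t. t \<in> {0..T} \<Longrightarrow> gaussian_linear (c t)"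
  obtains F where "linear_field F"
    "AE \<omega> in M. integrable lborel (\<lambda>s. indicat_real {0..T} s *\<^sub>R (Q s *v X s \<omega> + c s \<omega>)) \<and>
      (\<forall>t. F t \<omega> = (\<integral>s. indicat_real {t..} s *\<^sub>R (indicat_real {0..T} s *\<^sub>R (Q s *v X s \<omega> + c s \<omega>)) \<partial>lborel))"
proof -
  define X' where "X' = (\<lambda>s \<omega>. indicat_real {0..T} s *\<^sub>R X s \<omega>)"
  define c' where "c' = (\<lambda>s \<omega>. indicat_real {0..T} s *\<^sub>R c s \<omega>)"
  define Q' where "Q' = (\<lambda>s. indicat_real {0..T} s *\<^sub>R Q s)"
  have Q': "integrable lborel Q'" using Q by (simp add: Q'_def set_integrable_def)
  then have Q'm[measurable]: "Q' \<in> borel_measurable borel" by auto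
  note X' = L2_process_extend[OF X, folded X'_def]
  note c' = L2_process_extend[OF c, folded c'_def]
  note [measurable] = X'(1) c'(1)
  have glX': "gaussian_linear (X' s)" for s
    using glX[of s] gaussian_linear_const[of 0] by (cases "s \<in> {0..T}") (auto simp: X'_def)
  have glc': "gaussian_linear (c' s)" for s
    using glc[of s] gaussian_linear_const[of 0] by (cases "s \<in> {0..T}") (auto simp: c'_def)
  have ind_ge: "bounded_borel (\<lambda>x :: real \<times> real. indicat_real {fst x..} (snd x))"
  proof -
    have "closed {x :: real \<times> real. fst x \<le> snd x}" by (intro closed_Collect_le continuous_intros)
    then have "bounded_borel (indicat_real {x :: real \<times> real. fst x \<le> snd x})"
      by (intro bounded_borel_indicator) (simp add: borel_closed)
    moreover have "indicat_real {x :: real \<times> real. fst x \<le> snd x} = (\<lambda>x. indicat_real {fst x..} (snd x))"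
      by (auto simp: indicator_def)
    ultimately show ?thesis by simp
  qed
  \<comment> \<open>Polar form of the cost: the norm of Q' is the integrable weight and
    \<open>sgn (Q' s)\<close> the bounded kernel. Their product is Q' again, also where Q'
    vanishes.\<close>
  have K1: "bounded_borel (\<lambda>(t, s). indicat_real {t..} s *\<^sub>R sgn (Q' s))"
  proof -
    have "bounded_borel (\<lambda>s. sgn (Q' s))"
    proof (rule bounded_borelI)
      show "(\<lambda>s. sgn (Q' s)) \<in> borel_measurable borel" unfolding sgn_div_norm by measurable
      show "norm (sgn (Q' s)) \<le> 1" for s by (simp add: norm_sgn)
    qed
    then have "bounded_borel (\<lambda>x :: real \<times> real. sgn (Q' (snd x)))"
      by (rule bounded_borel_compose) (intro borel_measurable_continuous_onI continuous_intros)
    from bounded_borel_scaleR[OF ind_ge this] show ?thesis unfolding split_beta' .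
  qed
  have K2: "bounded_borel (\<lambda>(t :: real, s). indicat_real {t..} s *\<^sub>R (mat 1 :: real^'r^'r))"
    unfolding split_beta' by (intro bounded_borel_scaleR ind_ge bounded_borel_const)
  have fin1: "(\<integral>\<^sup>+s. ennreal (norm (Q' s)) * msq M (X' s) \<partial>lborel) < \<infinity>"
  proof -
    have "msq M (X' s) \<le> ennreal B" for s
      using B[of s] by (cases "s \<in> {0..T}") (auto simp: X'_def msq_def)
    then have "(\<integral>\<^sup>+s. ennreal (norm (Q' s)) * msq M (X' s) \<partial>lborel) \<le> (\<integral>\<^sup>+s. ennreal (norm (Q' s)) * ennreal B \<partial>lborel)"
      by (intro nn_integral_mono mult_left_mono) auto
    also have "\<dots> = (\<integral>\<^sup>+s. ennreal (norm (Q' s)) \<partial>lborel) * ennreal B"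
      by (rule nn_integral_multc) measurable
    also have "\<dots> < \<infinity>" using Q' by (simp add: integrable_iff_bounded ennreal_mult_less_top)
    finally show ?thesis .
  qed
  have fin2: "(\<integral>\<^sup>+s. ennreal (indicat_real {0..T} s) * msq M (c' s) \<partial>lborel) < \<infinity>"
  proof -
    have "(\<integral>\<^sup>+s. ennreal (indicat_real {0..T} s) * msq M (c' s) \<partial>lborel) \<le> (\<integral>\<^sup>+s. msq M (c' s) \<partial>lborel)"
      by (intro nn_integral_mono) (auto simp: indicator_def)
    also have "\<dots> < \<infinity>" using c'(2) by (simp add: msq_section_integral)
    finally show ?thesis .
  qed
  define F1 where "F1 t \<omega> = (\<integral>s. norm (Q' s) *\<^sub>R ((indicat_real {t..} s *\<^sub>R sgn (Q' s)) *v X' s \<omega>) \<partial>lborel)" for t \<omega>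
  define F2 where "F2 t \<omega> = (\<integral>s. indicat_real {0..T} s *\<^sub>R ((indicat_real {t..} s *\<^sub>R (mat 1 :: real^'r^'r)) *v c' s \<omega>) \<partial>lborel)" for t \<omega>
  note w1 = weighted_integral_field[OF integrable_norm[OF Q'] norm_ge_zero X'(1) glX' fin1 K1]
  have ii: "integrable lborel (indicat_real {0..T})" by (simp add: emeasure_lborel_Icc_eq)
  have in0: "\<And>s. 0 \<le> indicat_real {0..T} s" by simp
  note w2 = weighted_integral_field[OF ii in0 c'(1) glc' fin2 K2]
  show thesis
  proof (rule that[of "\<lambda>t \<omega>. F1 t \<omega> + F2 t \<omega>"])
    show "linear_field (\<lambda>t \<omega>. F1 t \<omega> + F2 t \<omega>)"
      unfolding F1_def F2_def by (rule linear_field_add[OF w1(1) w2(1)])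
    interpret mv: bounded_bilinear "(*v) :: real^'d^'r \<Rightarrow> real^'d \<Rightarrow> real^'r"
      by (rule bounded_bilinear_matrix_vector_mult)
    obtain D where D: "D > 0" "\<And>(A :: real^'d^'r) x. norm (A *v x) \<le> norm A * norm x * D"
      using mv.pos_bounded by blast
    show "AE \<omega> in M. integrable lborel (\<lambda>s. indicat_real {0..T} s *\<^sub>R (Q s *v X s \<omega> + c s \<omega>)) \<and>
      (\<forall>t. F1 t \<omega> + F2 t \<omega> = (\<integral>s. indicat_real {t..} s *\<^sub>R (indicat_real {0..T} s *\<^sub>R (Q s *v X s \<omega> + c s \<omega>)) \<partial>lborel))"
      using w1(2) w2(2) AE_space
    proof eventually_elim
      case (elim \<omega>)
      note [measurable] = elim(3)
      have [measurable]: "(\<lambda>s. X' s \<omega>) \<in> borel_measurable borel" by measurable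
      \<comment> \<open>Known is the integrability of X' weighted by the norm of Q'; with the
        operator constant D this dominates the product of Q' and X'.\<close>
      have a1: "integrable lborel (\<lambda>s. Q' s *v X' s \<omega>)"
      proof (rule Bochner_Integration.integrable_bound)
        show "integrable lborel (\<lambda>s. D *\<^sub>R (norm (Q' s) *\<^sub>R X' s \<omega>))" using elim(1) by (rule integrable_scaleR_right)
        show "AE s in lborel. norm (Q' s *v X' s \<omega>) \<le> norm (D *\<^sub>R (norm (Q' s) *\<^sub>R X' s \<omega>))"
        proof (rule AE_I2)
          show "norm (Q' s *v X' s \<omega>) \<le> norm (D *\<^sub>R (norm (Q' s) *\<^sub>R X' s \<omega>))" for s
            using D(1) D(2)[of "Q' s" "X' s \<omega>"] by (simp add: mult_ac)
        qed
      qed measurable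
      have a2: "integrable lborel (\<lambda>s. c' s \<omega>)"
        using elim(2) by (rule Bochner_Integration.integrable_cong[THEN iffD1, rotated 2]) (auto simp: c'_def indicator_def)
      have f_eq: "indicat_real {0..T} s *\<^sub>R (Q s *v X s \<omega> + c s \<omega>) = Q' s *v X' s \<omega> + c' s \<omega>" for s
        by (auto simp: Q'_def X'_def c'_def indicator_def mv.zero_left)
      have F1: "F1 t \<omega> = (\<integral>s. indicat_real {t..} s *\<^sub>R (Q' s *v X' s \<omega>) \<partial>lborel)" for t
        unfolding F1_def
      proof (rule Bochner_Integration.integral_cong[OF refl])
        fix s
        have "norm (Q' s) *\<^sub>R sgn (Q' s) = Q' s" by (cases "Q' s = 0") (auto simp: sgn_div_norm)
        then show "norm (Q' s) *\<^sub>R ((indicat_real {t..} s *\<^sub>R sgn (Q' s)) *v X' s \<omega>) = indicat_real {t..} s *\<^sub>R (Q' s *v X' s \<omega>)"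
          by (metis mv.scaleR_left scaleR_left_commute)
      qed
      have F2: "F2 t \<omega> = (\<integral>s. indicat_real {t..} s *\<^sub>R c' s \<omega> \<partial>lborel)" for t
        unfolding F2_def
        by (rule Bochner_Integration.integral_cong[OF refl])
          (auto simp: indicator_def c'_def bounded_bilinear.zero_left[OF bounded_bilinear_matrix_vector_mult])
      have b1: "integrable lborel (\<lambda>s. indicat_real {t..} s *\<^sub>R (Q' s *v X' s \<omega>))" for t
        using a1 by (rule integrable_mult_indicator[rotated]) simp
      have b2: "integrable lborel (\<lambda>s. indicat_real {t..} s *\<^sub>R c' s \<omega>)" for t
        using a2 by (rule integrable_mult_indicator[rotated]) simp
      show ?case
        unfolding f_eq F1 F2 using a1 a2 b1 b2 by (simp add: scaleR_right_distrib)
    qed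
  qed
qed

end

section \<open>The backward system\<close>

lemma noise_sel_transpose_mult:
  "noise_sel a *v (transpose (noise_sel b) *v x) = (if a = b then x else 0)"
proof -
  have "(transpose (noise_sel b) *v x) $ (j, c) = (if j = b then x $ c else 0)" for j c
  proof -
    show ?thesis
      by (simp add: transpose_def noise_sel_def matrix_vector_mult_def if_distrib[of "\<lambda>z. z * _"] cong: if_cong)
  qed
  then show ?thesis by (auto simp: vec_eq_iff noise_sel_mult simp del: transpose_matrix_vector)
qed

text \<open>
  \<open>H\<^sup>k\<^sub>t(u)\<close> is driven by \<open>(H\<^sup>X, V\<^sup>k)\<close> through \<open>adjoint_kernel\<close>. All of \<open>H\<^sup>X\<close> and the \<open>V\<^sup>k\<close>
  are stacked into one process with values in \<open>real^('p option \<times> 'd)\<close>: the block \<open>None\<close> is \<open>H\<^sup>X\<close>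
  and the block \<open>Some k\<close> is \<open>V\<^sup>k\<close>, so that \<open>noise_sel\<close> doubles as the block projection.
\<close>

definition adjoint_kernel ::
  "('p::finite, 'd::finite, 'w) lq_game \<Rightarrow> ('p, 'd) environment \<Rightarrow> 'p \<Rightarrow> real \<Rightarrow> real
    \<Rightarrow> real^('p option \<times> 'd)^('p option \<times> 'd)" where
  "adjoint_kernel G V k s u = indicat_real (triangle (horizon G)) (s, u) *\<^sub>R
    (transpose (pol_ker V k s u) ** noise_sel None - transpose (state_ker V s u) ** noise_sel (Some k))"

text \<open>Since \<open>adjoint_kernel\<close> vanishes for s < u, the field is constant in t for t
  < u, with its value at t = u. Thus it is defined for all pairs (t,u) although only the triangle
  matters.\<close>

definition adjoint_field ::
  "('p::finite, 'd::finite, 'w) lq_game \<Rightarrow> ('p, 'd) environment \<Rightarrow> (real \<Rightarrow> 'w \<Rightarrow> real^('p option \<times> 'd))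
    \<Rightarrow> 'p \<Rightarrow> real \<Rightarrow> real \<Rightarrow> 'w \<Rightarrow> real^('p option \<times> 'd)" where
  "adjoint_field G V Y k t u \<omega> =
    (\<integral>s. indicat_real {t..horizon G} s *\<^sub>R (adjoint_kernel G V k s u *v Y s \<omega>) \<partial>lborel)"

text \<open>The result of inserting the integral formula of \<open>adjoint_field\<close> into
  \<open>filter_load\<close> with u = t and pulling the time integral over s outside the memory
  integral over z.\<close>

definition load_kernel ::
  "('p::finite, 'd::finite, 'w) lq_game \<Rightarrow> ('p, 'd) environment \<Rightarrow> 'p \<Rightarrow> real \<Rightarrow> real
    \<Rightarrow> real^('p option \<times> 'd)^'d" where
  "load_kernel G V k t s = (transpose (mat_Gamma G k t) ** noise_sel (Some k)) ** adjoint_kernel G V k s t +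
    mat_P G k t ** (\<integral>z. (indicat_real (triangle (horizon G)) (t, z) *\<^sub>R err_ker V k t z) ** adjoint_kernel G V k s z \<partial>lborel)"

text \<open>The block row \<open>None\<close> carries the adjoint drift and the sum of the loads,
  the block row \<open>Some k\<close> the substituted load of player k. The block row of player i is
  0, so this block of the solution stays 0. The triangle is tested at (s,t) because the equation
  looks ahead from t to s in [t,T].\<close>

definition coupling_kernel ::
  "('p::finite, 'd::finite, 'w) lq_game \<Rightarrow> ('p, 'd) environment \<Rightarrow> 'p \<Rightarrow> real \<Rightarrow> real
    \<Rightarrow> real^('p option \<times> 'd)^('p option \<times> 'd)" where
  "coupling_kernel G V i t s = indicat_real (triangle (horizon G)) (s, t) *\<^sub>R
    (transpose (noise_sel None) ** (transpose (mat_A G s) ** noise_sel None + (\<Sum>k\<in>UNIV - {i}. noise_sel (Some k))) +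
     (\<Sum>k\<in>UNIV - {i}. transpose (noise_sel (Some k)) ** load_kernel G V k t s))"

lemma mat_vec_sum_left: "(\<Sum>k\<in>S. A k) *v x = (\<Sum>k\<in>S. A k *v x)" for x :: "real^'n::finite"
  using bounded_bilinear.sum_left[OF bounded_bilinear_matrix_vector_mult, of A S x] .

lemma coupling_kernel_blocks:
  "noise_sel None *v (coupling_kernel G V i t s *v y) = indicat_real (triangle (horizon G)) (s, t) *\<^sub>R
    (transpose (mat_A G s) *v (noise_sel None *v y) + (\<Sum>k\<in>UNIV - {i}. noise_sel (Some k) *v y))"
  "k \<noteq> i \<Longrightarrow> noise_sel (Some k) *v (coupling_kernel G V i t s *v y) =
    indicat_real (triangle (horizon G)) (s, t) *\<^sub>R (load_kernel G V k t s *v y)"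
proof -
  have *: "noise_sel a *v (coupling_kernel G V i t s *v y) = indicat_real (triangle (horizon G)) (s, t) *\<^sub>R
    ((if a = None then transpose (mat_A G s) *v (noise_sel None *v y) + (\<Sum>k\<in>UNIV - {i}. noise_sel (Some k) *v y) else 0)
     + (\<Sum>k\<in>UNIV - {i}. if a = Some k then load_kernel G V k t s *v y else 0))" for a
    unfolding coupling_kernel_def
    by (cases a) (simp_all add: scaleR_matrix_vector_assoc[symmetric] matrix_vector_mult_scaleR matrix_vector_mult_add_rdistrib
        matrix_vector_right_distrib mat_vec_sum_left matrix_vector_mul_assoc[symmetric] noise_sel_transpose_mult
        linear_sum[OF matrix_vector_mul_linear] cong: if_cong del: transpose_matrix_vector)
  show "noise_sel None *v (coupling_kernel G V i t s *v y) = indicat_real (triangle (horizon G)) (s, t) *\<^sub>R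
    (transpose (mat_A G s) *v (noise_sel None *v y) + (\<Sum>k\<in>UNIV - {i}. noise_sel (Some k) *v y))"
    unfolding * by simp
  show "k \<noteq> i \<Longrightarrow> noise_sel (Some k) *v (coupling_kernel G V i t s *v y) =
    indicat_real (triangle (horizon G)) (s, t) *\<^sub>R (load_kernel G V k t s *v y)"
    unfolding * by simp
qed

lemma triangle_indicator:
  "0 \<le> t \<Longrightarrow> indicat_real (triangle T) (s, t) = indicat_real {t..T} s"
  by (auto simp: triangle_def indicator_def)

section \<open>Bounds for the deterministic kernels\<close>

locale frozen_environment =
  fixes G :: "('p::finite, 'd::finite, 'w) lq_game" and V :: "('p, 'd) environment" and i :: 'p and T :: real
  assumes horizon: "horizon G = T" and T_ge_0: "0 \<le> T"
    and A_bounded: "bounded_coeff T (mat_A G)"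
    and Gamma_bounded: "\<And>k. bounded_coeff T (mat_Gamma G k)"
    and state_bounded: "bounded_kernel T (state_ker V)"
    and err_bounded: "\<And>k. k \<noteq> i \<Longrightarrow> bounded_kernel T (err_ker V k)"
    and pol_bounded: "\<And>k. k \<noteq> i \<Longrightarrow> bounded_kernel T (pol_ker V k)"
begin

lemma adjoint_kernel_outside: "\<not> (0 \<le> u \<and> u \<le> s \<and> s \<le> T) \<Longrightarrow> adjoint_kernel G V k s u = 0"
  by (auto simp: adjoint_kernel_def triangle_def horizon)

lemma bounded_borel_adjoint_kernel:
  assumes "k \<noteq> i"
  shows "bounded_borel (\<lambda>(s, u). adjoint_kernel G V k s u)"
proof -
  let ?ext = "\<lambda>K p. indicat_real (triangle T) p *\<^sub>R (case p of (t, u) \<Rightarrow> K t u)"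
  have ext: "bounded_borel (?ext K)" if "bounded_kernel T K" for K :: "real \<Rightarrow> real \<Rightarrow> real^('p option \<times> 'd)^'d"
    using bounded_kernel_extend[OF that] by (simp add: split_beta')
  have "bounded_borel (\<lambda>p. transpose (?ext (pol_ker V k) p) ** noise_sel None - transpose (?ext (state_ker V) p) ** noise_sel (Some k))"
    by (intro bounded_borel_diff bounded_borel_matrix_mult bounded_borel_transpose ext bounded_borel_const
        state_bounded pol_bounded assms)
  moreover have "(\<lambda>(s, u). adjoint_kernel G V k s u) =
    (\<lambda>p. transpose (?ext (pol_ker V k) p) ** noise_sel None - transpose (?ext (state_ker V) p) ** noise_sel (Some k))"
    by (auto simp: fun_eq_iff adjoint_kernel_def horizon matrix_mult_scaleR_left scaleR_diff_right
        linear_simps(5)[OF bounded_linear_transpose])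
  ultimately show ?thesis by simp
qed

definition err_ext where "err_ext k t z = indicat_real (triangle T) (t, z) *\<^sub>R err_ker V k t z"

lemma bounded_borel_err_ext: "k \<noteq> i \<Longrightarrow> bounded_borel (\<lambda>(t, z). err_ext k t z)"
  unfolding err_ext_def by (rule bounded_kernel_extend[OF err_bounded])

lemma err_ext_outside: "z \<notin> {0..T} \<Longrightarrow> err_ext k t z = 0"
  by (auto simp: err_ext_def triangle_def)

lemma bounded_borel_coupling_kernel: "bounded_borel (\<lambda>(t, s). coupling_kernel G V i t s)"
proof -
  note cont = borel_measurable_continuous_onI continuous_on_fst continuous_on_snd continuous_on_id
  have A: "bounded_borel (\<lambda>p :: real \<times> real. indicat_real {0..T} (snd p) *\<^sub>R mat_A G (snd p))"
    by (rule bounded_borel_compose[OF bounded_coeff_extend[OF A_bounded]]) (intro cont)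
  have Ga: "bounded_borel (\<lambda>p :: real \<times> real. indicat_real {0..T} (fst p) *\<^sub>R mat_Gamma G k (fst p))" for k
    by (rule bounded_borel_compose[OF bounded_coeff_extend[OF Gamma_bounded]]) (intro cont)
  have tri: "bounded_borel (\<lambda>p :: real \<times> real. indicat_real (triangle T) (snd p, fst p))"
    by (rule bounded_borel_compose[OF bounded_borel_indicator[OF triangle_borel]])
      (intro borel_measurable_continuous_onI continuous_intros)
  have adj: "bounded_borel (\<lambda>p :: real \<times> real. adjoint_kernel G V k (snd p) (fst p))" if "k \<noteq> i" for k
    by (intro bounded_borel_uncurry[OF bounded_borel_adjoint_kernel[OF that]] cont)
  have mem: "bounded_borel (\<lambda>p :: real \<times> real. \<integral>z. err_ext k (fst p) z ** adjoint_kernel G V k (snd p) z \<partial>lborel)"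
    if "k \<noteq> i" for k
  proof (rule bounded_borel_integral[of _ 0 T])
    show "bounded_borel (\<lambda>(p :: real \<times> real, z). err_ext k (fst p) z ** adjoint_kernel G V k (snd p) z)"
      unfolding split_beta'
      by (intro bounded_borel_matrix_mult bounded_borel_uncurry[OF bounded_borel_adjoint_kernel[OF that]]
          bounded_borel_uncurry[OF bounded_borel_err_ext[OF that]] cont)
  qed (simp add: err_ext_outside bounded_bilinear.zero_left[OF bounded_bilinear_matrix_matrix_mult])
  let ?Ga = "\<lambda>k p. indicat_real {0..T} (fst p) *\<^sub>R mat_Gamma G k (fst p)"
  let ?load = "\<lambda>k p. (transpose (?Ga k p) ** noise_sel (Some k)) ** adjoint_kernel G V k (snd p) (fst p) +
    (transpose (?Ga k p) ** ?Ga k p) ** (\<integral>z. err_ext k (fst p) z ** adjoint_kernel G V k (snd p) z \<partial>lborel)"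
  have load: "bounded_borel (?load k)" if "k \<noteq> i" for k
    by (intro bounded_borel_add bounded_borel_matrix_mult bounded_borel_transpose Ga adj mem that bounded_borel_const)
  have "bounded_borel (\<lambda>p. indicat_real (triangle T) (snd p, fst p) *\<^sub>R
    (transpose (noise_sel None) ** (transpose (indicat_real {0..T} (snd p) *\<^sub>R mat_A G (snd p)) ** noise_sel None
       + (\<Sum>k\<in>UNIV - {i}. noise_sel (Some k))) +
     (\<Sum>k\<in>UNIV - {i}. transpose (noise_sel (Some k)) ** ?load k p)))" (is "bounded_borel ?K")
    by (intro bounded_borel_scaleR tri bounded_borel_add bounded_borel_matrix_mult bounded_borel_transpose A
        bounded_borel_const bounded_borel_sum load) auto
  \<comment> \<open>On the triangle the indicators inserted for boundedness equal 1; off it both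
    sides are 0.\<close>
  moreover have "?K = (\<lambda>(t, s). coupling_kernel G V i t s)"
  proof (rule ext, clarify)
    fix t s
    show "?K (t, s) = coupling_kernel G V i t s"
      by (cases "(s, t) \<in> triangle T")
        (auto simp: coupling_kernel_def load_kernel_def horizon mat_P_def err_ext_def triangle_def)
  qed
  ultimately show ?thesis by simp
qed

lemma coupling_kernel_outside: "\<not> (0 \<le> t \<and> t \<le> s \<and> s \<le> T) \<Longrightarrow> coupling_kernel G V i t s = 0"
  by (auto simp: coupling_kernel_def triangle_def horizon)

section \<open>The backward system along one fixed path\<close>

context
  fixes Y :: "real \<Rightarrow> 'w \<Rightarrow> real^('p option \<times> 'd)" and \<omega> :: 'w and \<gamma> :: "real \<Rightarrow> real^'d"
  assumes Y: "bounded_borel (\<lambda>t. Y t \<omega>)"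
    and Y_eq: "\<And>t. Y t \<omega> = transpose (noise_sel None) *v \<gamma> t + (\<integral>s. coupling_kernel G V i t s *v Y s \<omega> \<partial>lborel)"
begin

lemma coupling_integrable: "integrable lborel (\<lambda>s. coupling_kernel G V i t s *v Y s \<omega>)"
  using bounded_borel_compose[OF bounded_borel_coupling_kernel, of "\<lambda>s. (t, s)"]
  by (intro integrable_bounded_borel[of _ 0 T] bounded_borel_matrix_vector_mult Y)
    (auto simp: coupling_kernel_outside)

lemma block_equation:
  "noise_sel a *v Y t \<omega> = (if a = None then \<gamma> t else 0) + (\<integral>s. noise_sel a *v (coupling_kernel G V i t s *v Y s \<omega>) \<partial>lborel)"
  by (subst Y_eq)
    (simp add: matrix_vector_right_distrib noise_sel_transpose_mult
      integral_bounded_linear[OF bounded_bilinear.bounded_linear_right[OF bounded_bilinear_matrix_vector_mult] coupling_integrable]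
      del: transpose_matrix_vector)

text \<open>This closes the loop: for H built from Y, block k of Y is the load of that very H. Block
  k of the Volterra equation is a tail integral of \<open>load_kernel\<close>, and
  \<open>memory_integral_exchange\<close> with u = t turns it back into
  \<open>filter_load\<close>.\<close>

lemma filter_load_eq:
  assumes k: "k \<noteq> i" and t: "t \<in> {0..T}"
  shows "filter_load G V k (adjoint_field G V Y k) t \<omega> = noise_sel (Some k) *v Y t \<omega>"
    and "set_integrable lborel {0..t} (\<lambda>z. err_ker V k t z *v adjoint_field G V Y k t z \<omega>)"
proof -
  have e: "bounded_borel (err_ext k t)"
    using bounded_borel_compose[OF bounded_borel_err_ext[OF k], of "\<lambda>z. (t, z)"] by simp
  have t0: "0 \<le> t" using t by simp
  note ex = memory_integral_exchange[OF bounded_borel_adjoint_kernel[OF k] e Y, of T t, OF err_ext_outside t0]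
  have H: "adjoint_field G V Y k t u \<omega> = (\<integral>s. indicat_real {t..T} s *\<^sub>R (adjoint_kernel G V k s u *v Y s \<omega>) \<partial>lborel)" for u
    by (simp add: adjoint_field_def horizon)
  have ext_eq: "err_ext k t z *v x = indicat_real {0..t} z *\<^sub>R (err_ker V k t z *v x)" for z x
    using t by (auto simp: err_ext_def triangle_def indicator_def)
  have "integrable lborel (\<lambda>z. err_ext k t z *v adjoint_field G V Y k t z \<omega>)"
    unfolding H
  proof (rule integrable_bounded_borel[of _ 0 T])
    show "bounded_borel (\<lambda>z. err_ext k t z *v (\<integral>s. indicat_real {t..T} s *\<^sub>R (adjoint_kernel G V k s z *v Y s \<omega>) \<partial>lborel))"
      by (rule bounded_borel_matrix_vector_mult[OF e ex(1)])
  qed (simp add: err_ext_outside bounded_bilinear.zero_left[OF bounded_bilinear_matrix_vector_mult])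
  then show "set_integrable lborel {0..t} (\<lambda>z. err_ker V k t z *v adjoint_field G V Y k t z \<omega>)"
    unfolding ext_eq set_integrable_def .
  have "noise_sel (Some k) *v Y t \<omega> = (\<integral>s. indicat_real {t..T} s *\<^sub>R (load_kernel G V k t s *v Y s \<omega>) \<partial>lborel)"
    unfolding block_equation[of "Some k" t] coupling_kernel_blocks(2)[OF k] horizon triangle_indicator[OF t0] by simp
  also have "\<dots> = (transpose (mat_Gamma G k t) ** noise_sel (Some k)) *v adjoint_field G V Y k t t \<omega> +
    mat_P G k t *v (\<integral>z. err_ext k t z *v adjoint_field G V Y k t z \<omega> \<partial>lborel)"
    unfolding H load_kernel_def horizon err_ext_def[symmetric] by (rule ex(2))
  also have "\<dots> = filter_load G V k (adjoint_field G V Y k) t \<omega>"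
    unfolding filter_load_def set_lebesgue_integral_def ext_eq by (simp add: matrix_vector_mul_assoc)
  finally show "filter_load G V k (adjoint_field G V Y k) t \<omega> = noise_sel (Some k) *v Y t \<omega>" by simp
qed

text \<open>The field is by construction a tail integral of \<open>adjoint_kernel\<close> applied to
  Y, hence vanishes at T. Its integrand mentions block k of Y, which \<open>filter_load_eq\<close>
  identifies with the load.\<close>

lemma opponent_adjoint_path:
  assumes k: "k \<noteq> i" and u: "u \<in> {0..T}"
  shows "has_derivative_path u T (\<lambda>t. adjoint_field G V Y k t u \<omega>)
     (\<lambda>t. - (transpose (pol_ker V k t u) *v (noise_sel None *v Y t \<omega>))
          + transpose (state_ker V t u) *v filter_load G V k (adjoint_field G V Y k) t \<omega>)"
    and "adjoint_field G V Y k T u \<omega> = 0"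
proof -
  let ?\<rho> = "\<lambda>s. adjoint_kernel G V k s u *v Y s \<omega>"
  have "bounded_borel (\<lambda>s. adjoint_kernel G V k s u)"
    using bounded_borel_compose[OF bounded_borel_adjoint_kernel[OF k], of "\<lambda>s. (s, u)"] by simp
  then have int: "set_integrable lborel {u..T} ?\<rho>"
    unfolding set_integrable_def
    by (intro integrable_bounded_borel[of _ u T] bounded_borel_scaleR bounded_borel_matrix_vector_mult Y
        bounded_borel_indicator) auto
  have h: "adjoint_field G V Y k t u \<omega> = 0 + (LINT s:{t..T}|lborel. ?\<rho> s)" for t
    by (simp add: adjoint_field_def horizon set_lebesgue_integral_def)
  have uT: "u \<le> T" using u by simp
  show "adjoint_field G V Y k T u \<omega> = 0" by (rule backward_path(2)[OF int uT h])
  show "has_derivative_path u T (\<lambda>t. adjoint_field G V Y k t u \<omega>)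
     (\<lambda>t. - (transpose (pol_ker V k t u) *v (noise_sel None *v Y t \<omega>))
          + transpose (state_ker V t u) *v filter_load G V k (adjoint_field G V Y k) t \<omega>)"
  proof (rule has_derivative_path_cong[OF backward_path(1)[OF int uT h]])
    fix s assume "s \<in> {u..T}"
    then have "(s, u) \<in> triangle T" "s \<in> {0..T}" using u by (auto simp: triangle_def)
    then show "- ?\<rho> s = - (transpose (pol_ker V k s u) *v (noise_sel None *v Y s \<omega>))
          + transpose (state_ker V s u) *v filter_load G V k (adjoint_field G V Y k) s \<omega>"
      by (simp add: adjoint_kernel_def horizon filter_load_eq[OF k] matrix_vector_mult_diff_rdistrib matrix_vector_mul_assoc)
  qed
qed

text \<open>Block \<open>None\<close> of the Volterra equation is \<open>\<gamma>\<close> plus a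
  tail integral of the adjoint drift and the loads. As \<open>\<gamma>\<close> is the terminal value
  plus a tail integral of f, everything merges into a single tail integral ending at the terminal
  value.\<close>

lemma state_adjoint_path:
  assumes f: "set_integrable lborel {0..T} f" and \<gamma>: "\<And>t. t \<in> {0..T} \<Longrightarrow> \<gamma> t = \<xi> + (LINT s:{t..T}|lborel. f s)"
  shows "has_derivative_path 0 T (\<lambda>t. noise_sel None *v Y t \<omega>)
     (\<lambda>t. - f t - transpose (mat_A G t) *v (noise_sel None *v Y t \<omega>)
          - (\<Sum>k\<in>UNIV - {i}. filter_load G V k (adjoint_field G V Y k) t \<omega>))"
    and "noise_sel None *v Y T \<omega> = \<xi>"
proof -
  let ?d = "\<lambda>s. transpose (mat_A G s) *v (noise_sel None *v Y s \<omega>) + (\<Sum>k\<in>UNIV - {i}. noise_sel (Some k) *v Y s \<omega>)"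
  let ?\<rho> = "\<lambda>s. f s + ?d s"
  have d: "set_integrable lborel {0..T} ?d"
  proof -
    have "bounded_borel (\<lambda>s. indicat_real {0..T} s *\<^sub>R (transpose (indicat_real {0..T} s *\<^sub>R mat_A G s) *v (noise_sel None *v Y s \<omega>) +
      (\<Sum>k\<in>UNIV - {i}. noise_sel (Some k) *v Y s \<omega>)))"
      by (intro bounded_borel_scaleR bounded_borel_indicator bounded_borel_add bounded_borel_matrix_vector_mult
          bounded_borel_transpose bounded_coeff_extend A_bounded bounded_borel_const Y bounded_borel_sum) auto
    then have "integrable lborel (\<lambda>s. indicat_real {0..T} s *\<^sub>R (transpose (indicat_real {0..T} s *\<^sub>R mat_A G s) *v (noise_sel None *v Y s \<omega>) +
      (\<Sum>k\<in>UNIV - {i}. noise_sel (Some k) *v Y s \<omega>)))"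
      by (rule integrable_bounded_borel[of _ 0 T]) simp
    also have "?this \<longleftrightarrow> set_integrable lborel {0..T} ?d"
      unfolding set_integrable_def by (intro Bochner_Integration.integrable_cong) (auto simp: indicator_def)
    finally show ?thesis .
  qed
  have \<rho>: "set_integrable lborel {0..T} ?\<rho>" using f d by (rule set_integral_add(1))
  have h: "noise_sel None *v Y t \<omega> = \<xi> + (LINT s:{t..T}|lborel. ?\<rho> s)" if t: "t \<in> {0..T}" for t
  proof -
    have t0: "0 \<le> t" using t by simp
    have i: "set_integrable lborel {t..T} f"
      by (rule set_integrable_subset[OF f]) (use t in auto)
    have i': "set_integrable lborel {t..T} ?d"
      by (rule set_integrable_subset[OF d]) (use t in auto)
    have "noise_sel None *v Y t \<omega> = \<gamma> t + (LINT s:{t..T}|lborel. ?d s)"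
      unfolding block_equation[of None t] coupling_kernel_blocks(1) horizon triangle_indicator[OF t0] set_lebesgue_integral_def by simp
    then show ?thesis using \<gamma>[OF t] set_integral_add(2)[OF i i'] by simp
  qed
  show "noise_sel None *v Y T \<omega> = \<xi>" by (rule backward_path(2)[OF \<rho> T_ge_0 h])
  show "has_derivative_path 0 T (\<lambda>t. noise_sel None *v Y t \<omega>)
     (\<lambda>t. - f t - transpose (mat_A G t) *v (noise_sel None *v Y t \<omega>)
          - (\<Sum>k\<in>UNIV - {i}. filter_load G V k (adjoint_field G V Y k) t \<omega>))"
    by (rule has_derivative_path_cong[OF backward_path(1)[OF \<rho> T_ge_0 h]])
      (simp_all add: filter_load_eq(1))
qed

end
end


section \<open>Assembly of the random solution\<close>

lemma section_measurable:
  assumes "(\<lambda>(t, \<omega>). Z t \<omega>) \<in> borel_measurable (borel \<Otimes>\<^sub>M M)" "\<omega> \<in> space M"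
  shows "(\<lambda>t. Z t \<omega>) \<in> borel_measurable borel"
  using measurable_compose[OF measurable_Pair2'[OF assms(2)] assms(1)] by simp

lemma set_integral_tail:
  fixes f :: "real \<Rightarrow> 'a::{banach, second_countable_topology}"
  assumes "0 \<le> t"
  shows "(LINT s:{t..T}|lborel. f s) = (\<integral>s. indicat_real {t..} s *\<^sub>R (indicat_real {0..T} s *\<^sub>R f s) \<partial>lborel)"
  unfolding set_lebesgue_integral_def
  using assms by (intro Bochner_Integration.integral_cong) (auto simp: indicator_def)

context noise_space begin

lemma linear_process_gaussian:
  assumes "linear_process M W T X" "t \<in> {0..T}"
  shows "gaussian_linear (X t)"
proof -
  obtain Xbar Xker where "wiener_integral M W 0 t (Xker t) (\<lambda>\<omega>. X t \<omega> - Xbar t)"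
    using assms unfolding linear_process_def linear_process_with_def by blast
  then have "gaussian_linear (\<lambda>\<omega>. X t \<omega> - Xbar t)"
    using assms(2) by (intro wiener_integral_gaussian_linear) auto
  from gaussian_linear_add[OF this gaussian_linear_const[of "Xbar t"]] show ?thesis by simp
qed

text \<open>The formula defining Y is read twice: as a random field, where
  \<open>kernel_integral_field\<close> keeps it in the linear class, and for fixed \<omega>, where
  \<open>volterra_solution\<close> makes it an exact solution. The exceptional null set comes from
  the forcing alone, so it serves all t, u and k.\<close>

lemma backward_system_solution:
  fixes G :: "('p, 'd, 'w) lq_game" and V :: "('p, 'd) environment"
  assumes env: "frozen_environment G V i T"
    and Q: "set_integrable lborel {0..T} (cost_XX G i)"
    and c: "linear_process M W T (cost_X G i)"
    and X: "linear_process M W T X" and X_bounded: "\<exists>B. \<forall>t\<in>{0..T}. msq M (X t) \<le> ennreal B"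
  shows "\<exists>HX H.
       extended_linear_process M W T {0..T} HX \<and>
       (\<forall>k. k \<noteq> i \<longrightarrow>
          extended_linear_process M W T (triangle T) (\<lambda>(t, u). H k t u) \<and>
          (\<forall>u\<in>{0..T}. extended_linear_process M W T {u..T} (\<lambda>t. H k t u))) \<and>
       (AE \<omega> in M.
          has_derivative_path 0 T (\<lambda>t. HX t \<omega>)
            (\<lambda>t. - (cost_XX G i t *v X t \<omega> + cost_X G i t \<omega>)
                 - transpose (mat_A G t) *v HX t \<omega>
                 - (\<Sum>k\<in>UNIV - {i}. filter_load G V k (H k) t \<omega>)) \<and>
          HX T \<omega> = cost_XX G i T *v X T \<omega> + cost_X G i T \<omega> \<and>
          (\<forall>k. k \<noteq> i \<longrightarrow>
             (\<forall>t\<in>{0..T}. set_integrable lborel {0..t} (\<lambda>z. err_ker V k t z *v H k t z \<omega>)) \<and>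
             (\<forall>u\<in>{0..T}.
                has_derivative_path u T (\<lambda>t. H k t u \<omega>)
                  (\<lambda>t. - (transpose (pol_ker V k t u) *v HX t \<omega>)
                       + transpose (state_ker V t u) *v filter_load G V k (H k) t \<omega>) \<and>
                H k T u \<omega> = 0)))"
proof -
  interpret E: frozen_environment G V i T by (rule env)
  obtain B where B: "\<And>t. t \<in> {0..T} \<Longrightarrow> msq M (X t) \<le> ennreal B" using X_bounded by blast
  note glX = linear_process_gaussian[OF X] and glc = linear_process_gaussian[OF c]
  have L2: "L2_process M {0..T} X" "L2_process M {0..T} (cost_X G i)"
    using X c by (auto simp: linear_process_def linear_process_with_def)
  define f where "f \<omega> s = cost_XX G i s *v X s \<omega> + cost_X G i s \<omega>" for \<omega> s
  obtain F where F: "linear_field F"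
    "AE \<omega> in M. integrable lborel (\<lambda>s. indicat_real {0..T} s *\<^sub>R f \<omega> s) \<and>
      (\<forall>t. F t \<omega> = (\<integral>s. indicat_real {t..} s *\<^sub>R (indicat_real {0..T} s *\<^sub>R f \<omega> s) \<partial>lborel))"
    unfolding f_def by (rule forcing_field[OF Q L2(1) glX B L2(2) glc])
  define \<xi> where "\<xi> \<omega> = cost_XX G i T *v X T \<omega> + cost_X G i T \<omega>" for \<omega>
  have \<xi>: "gaussian_linear \<xi>"
    unfolding \<xi>_def using T_nonneg by (intro gaussian_linear_add gaussian_linear_matrix_mult glX glc) auto
  define \<gamma> where "\<gamma> t \<omega> = \<xi> \<omega> + F t \<omega>" for t \<omega>
  \<comment> \<open>The loads have no forcing of their own because H^k vanishes at T; only the block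
    \<open>None\<close> of g is nonzero.\<close>
  define g :: "real \<Rightarrow> 'w \<Rightarrow> real^('p option \<times> 'd)" where "g t \<omega> = transpose (noise_sel None) *v \<gamma> t \<omega>" for t \<omega>
  have g: "linear_field g"
    unfolding g_def \<gamma>_def by (intro linear_field_matrix_mult linear_field_add linear_field_const \<xi> F(1))
  obtain R where R: "bounded_borel (\<lambda>(t, s). R t s)"
    "\<And>t s. \<not> (0 \<le> t \<and> t \<le> s \<and> s \<le> T) \<Longrightarrow> R t s = 0"
    "\<And>t s. R t s = coupling_kernel G V i t s + (\<integral>r. coupling_kernel G V i t r ** R r s \<partial>lborel)"
    by (rule volterra_resolvent[OF E.bounded_borel_coupling_kernel E.coupling_kernel_outside]) blast+
  define Y where "Y t \<omega> = g t \<omega> + (\<integral>s. R t s *v g s \<omega> \<partial>lborel)" for t \<omega>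
  have Y: "linear_field Y"
    unfolding Y_def
    by (intro linear_field_add g kernel_integral_field[OF g R(1), of 0 T]) (auto intro: R(2))
  define HX where "HX t \<omega> = noise_sel None *v Y t \<omega>" for t \<omega>
  define H where "H = adjoint_field G V Y"
  have HX: "extended_linear_process M W T {0..T} HX"
    unfolding HX_def
    by (rule linear_field_extended_process[OF linear_field_matrix_mult[OF Y]])
      (auto simp: emeasure_lborel_Icc_eq)
  have H: "linear_field (\<lambda>p. H k (fst p) (snd p))" if k: "k \<noteq> i" for k
  proof -
    \<comment> \<open>The interval of integration moves with t, so its indicator is measurable in
      (t,u) and s jointly as that of a closed set.\<close>
    have "closed {x :: (real \<times> real) \<times> real. fst (fst x) \<le> snd x \<and> snd x \<le> T}"
      by (intro closed_Collect_conj closed_Collect_le continuous_intros)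
    then have "bounded_borel (indicat_real {x :: (real \<times> real) \<times> real. fst (fst x) \<le> snd x \<and> snd x \<le> T})"
      by (intro bounded_borel_indicator borel_closed)
    also have "indicat_real {x :: (real \<times> real) \<times> real. fst (fst x) \<le> snd x \<and> snd x \<le> T} =
      (\<lambda>x. indicat_real {fst (fst x)..T} (snd x))"
      by (auto simp: indicator_def fun_eq_iff)
    finally have ind: "bounded_borel (\<lambda>x :: (real \<times> real) \<times> real. indicat_real {fst (fst x)..T} (snd x))" .
    have adj: "bounded_borel (\<lambda>x :: (real \<times> real) \<times> real. adjoint_kernel G V k (snd x) (snd (fst x)))"
      by (rule bounded_borel_uncurry[OF E.bounded_borel_adjoint_kernel[OF k]])
        (intro borel_measurable_continuous_onI continuous_intros)+
    have "bounded_borel (\<lambda>(p :: real \<times> real, s). indicat_real {fst p..T} s *\<^sub>R adjoint_kernel G V k s (snd p))"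
      unfolding split_beta' by (rule bounded_borel_scaleR[OF ind adj])
    then have "linear_field (\<lambda>(p :: real \<times> real) \<omega>. \<integral>s. (indicat_real {fst p..T} s *\<^sub>R adjoint_kernel G V k s (snd p)) *v Y s \<omega> \<partial>lborel)"
    proof (rule kernel_integral_field[OF Y])
      show "indicat_real {fst p..T} s *\<^sub>R adjoint_kernel G V k s (snd p) = 0" if "s \<notin> {0..T}" for p s
        using that by (subst E.adjoint_kernel_outside) auto
    qed
    moreover have "H k (fst p) (snd p) =
      (\<lambda>\<omega>. \<integral>s. (indicat_real {fst p..T} s *\<^sub>R adjoint_kernel G V k s (snd p)) *v Y s \<omega> \<partial>lborel)" for p
      by (simp add: H_def adjoint_field_def E.horizon scaleR_matrix_vector_assoc fun_eq_iff)
    ultimately show ?thesis by simp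
  qed
  have H_tri: "extended_linear_process M W T (triangle T) (\<lambda>(t, u). H k t u)" if "k \<noteq> i" for k
    using linear_field_extended_process[OF H[OF that] triangle_borel emeasure_triangle_finite]
    by (simp add: split_beta')
  \<comment> \<open>For fixed u the segment is a null set of the triangle, so square integrability
    along it does not follow from \<open>H_tri\<close>; it comes from restricting the field
    itself.\<close>
  have H_sec: "extended_linear_process M W T {u..T} (\<lambda>t. H k t u)" if "k \<noteq> i" for k u
  proof (rule linear_field_extended_process)
    have "(\<lambda>t :: real. (t, u)) \<in> borel_measurable borel"
      by (intro borel_measurable_continuous_onI continuous_intros)
    from linear_field_compose[OF H[OF that] this] show "linear_field (\<lambda>t. H k t u)" by simp
  qed (auto simp: emeasure_lborel_Icc_eq)
  have "AE \<omega> in M.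
          has_derivative_path 0 T (\<lambda>t. HX t \<omega>)
            (\<lambda>t. - f \<omega> t - transpose (mat_A G t) *v HX t \<omega>
                 - (\<Sum>k\<in>UNIV - {i}. filter_load G V k (H k) t \<omega>)) \<and>
          HX T \<omega> = \<xi> \<omega> \<and>
          (\<forall>k. k \<noteq> i \<longrightarrow>
             (\<forall>t\<in>{0..T}. set_integrable lborel {0..t} (\<lambda>z. err_ker V k t z *v H k t z \<omega>)) \<and>
             (\<forall>u\<in>{0..T}.
                has_derivative_path u T (\<lambda>t. H k t u \<omega>)
                  (\<lambda>t. - (transpose (pol_ker V k t u) *v HX t \<omega>)
                       + transpose (state_ker V t u) *v filter_load G V k (H k) t \<omega>) \<and>
                H k T u \<omega> = 0))"
    using F(2) AE_space
  proof eventually_elim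
    case (elim \<omega>)
    then have f: "integrable lborel (\<lambda>s. indicat_real {0..T} s *\<^sub>R f \<omega> s)"
      and F_eq: "\<And>t. F t \<omega> = (\<integral>s. indicat_real {t..} s *\<^sub>R (indicat_real {0..T} s *\<^sub>R f \<omega> s) \<partial>lborel)"
      and \<omega>: "\<omega> \<in> space M" by auto
    \<comment> \<open>The tail integral is bounded by the L1 norm of f along the path, even where f
      is unbounded. This gives the bounded forcing required by
      \<open>volterra_solution\<close>.\<close>
    have "bounded_borel (\<lambda>t. F t \<omega>)"
    proof (rule bounded_borelI)
      show "(\<lambda>t. F t \<omega>) \<in> borel_measurable borel"
        by (rule section_measurable[OF linear_field_measurable[OF F(1)] \<omega>])
      show "norm (F t \<omega>) \<le> (\<integral>s. norm (indicat_real {0..T} s *\<^sub>R f \<omega> s) \<partial>lborel)" for t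
        unfolding F_eq
      proof (rule Bochner_Integration.integral_norm_bound_integral)
        show "integrable lborel (\<lambda>s. indicat_real {t..} s *\<^sub>R (indicat_real {0..T} s *\<^sub>R f \<omega> s))"
          using f by (rule integrable_mult_indicator[rotated]) simp
        show "integrable lborel (\<lambda>s. norm (indicat_real {0..T} s *\<^sub>R f \<omega> s))"
          using f by (rule integrable_norm)
      qed (auto simp: indicator_def)
    qed
    then have g_path: "bounded_borel (\<lambda>t. g t \<omega>)"
      unfolding g_def \<gamma>_def
      by (intro bounded_borel_matrix_vector_mult bounded_borel_const bounded_borel_add)
    note sol = volterra_solution[where T = T, OF E.bounded_borel_coupling_kernel R(1) _ _ R(3) g_path,
        folded Y_def]
    have Y_path: "bounded_borel (\<lambda>t. Y t \<omega>)"
      by (rule sol(1)) (simp_all add: E.coupling_kernel_outside R(2))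
    have Y_eq: "Y t \<omega> = transpose (noise_sel None) *v \<gamma> t \<omega> + (\<integral>s. coupling_kernel G V i t s *v Y s \<omega> \<partial>lborel)" for t
      unfolding g_def[symmetric] by (rule sol(2)) (simp_all add: E.coupling_kernel_outside R(2))
    have f': "set_integrable lborel {0..T} (f \<omega>)" using f by (simp add: set_integrable_def)
    have \<gamma>_eq: "\<gamma> t \<omega> = \<xi> \<omega> + (LINT s:{t..T}|lborel. f \<omega> s)" if "t \<in> {0..T}" for t
      using that by (simp add: \<gamma>_def F_eq set_integral_tail)
    show ?case
      unfolding HX_def H_def
      using E.state_adjoint_path[where Y = Y and \<omega> = \<omega> and \<gamma> = "\<lambda>t. \<gamma> t \<omega>", OF Y_path Y_eq f' \<gamma>_eq] E.filter_load_eq(2)[where Y = Y and \<omega> = \<omega> and \<gamma> = "\<lambda>t. \<gamma> t \<omega>", OF Y_path Y_eq]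
        E.opponent_adjoint_path[where Y = Y and \<omega> = \<omega> and \<gamma> = "\<lambda>t. \<gamma> t \<omega>", OF Y_path Y_eq]
      by auto
  qed
  then show ?thesis
    unfolding f_def \<xi>_def using HX H_tri H_sec by blast
qed

end


theorem theorem4p2:
  fixes M :: "'w measure"
    and W :: "real \<Rightarrow> 'w \<Rightarrow> real^('p::finite option \<times> 'd::finite)"
    and G :: "('p, 'd, 'w) lq_game"
    and V :: "('p, 'd) environment"
    and Xbase :: "real \<Rightarrow> 'w \<Rightarrow> real^'d"
    and i :: 'p
  defines "T \<equiv> horizon G"
  assumes "game M W G"
    and "baseline_profile M W G V Xbase"
    and "bounded_kernel T (state_ker V)"
    and "\<And>k. k \<noteq> i \<Longrightarrow> bounded_kernel T (err_ker V k)"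
    and "\<And>k. k \<noteq> i \<Longrightarrow> bounded_kernel T (pol_ker V k)"
  shows "\<forall>X. X = Xbase \<or> deviated_state M W G V i X \<longrightarrow>
    (\<exists>HX H.
       extended_linear_process M W T {0..T} HX \<and>
       (\<forall>k. k \<noteq> i \<longrightarrow>
          extended_linear_process M W T (triangle T) (\<lambda>(t, u). H k t u) \<and>
          (\<forall>u\<in>{0..T}. extended_linear_process M W T {u..T} (\<lambda>t. H k t u))) \<and>
       (AE \<omega> in M.
          has_derivative_path 0 T (\<lambda>t. HX t \<omega>)
            (\<lambda>t. - (cost_XX G i t *v X t \<omega> + cost_X G i t \<omega>)
                 - transpose (mat_A G t) *v HX t \<omega>
                 - (\<Sum>k\<in>UNIV - {i}. filter_load G V k (H k) t \<omega>)) \<and>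
          HX T \<omega> = cost_XX G i T *v X T \<omega> + cost_X G i T \<omega> \<and>
          (\<forall>k. k \<noteq> i \<longrightarrow>
             (\<forall>t\<in>{0..T}. set_integrable lborel {0..t} (\<lambda>z. err_ker V k t z *v H k t z \<omega>)) \<and>
             (\<forall>u\<in>{0..T}.
                has_derivative_path u T (\<lambda>t. H k t u \<omega>)
                  (\<lambda>t. - (transpose (pol_ker V k t u) *v HX t \<omega>)
                       + transpose (state_ker V t u) *v filter_load G V k (H k) t \<omega>) \<and>
                H k T u \<omega> = 0))))"
proof -
  note game = assms(2)[unfolded game_def]
  interpret prob_space M using game by simp
  interpret noise_space M W T
    using game by unfold_locales (auto simp: T_def)
  have env: "frozen_environment G V i T"
    using game assms(4-6) T_nonneg by unfold_locales (auto simp: T_def)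
  have cost: "set_integrable lborel {0..T} (cost_XX G i)" "linear_process M W T (cost_X G i)"
    using game by (auto simp: T_def)
  \<comment> \<open>Baseline and deviation are treated alike. From either one takes only that X is a
    linear process and solves the state equation with square-integrable controls, and the bound
    uniform in t follows.\<close>
  have state: "linear_process M W T X \<and> (\<exists>B. \<forall>t\<in>{0..T}. msq M (X t) \<le> ennreal B)"
    if X: "X = Xbase \<or> deviated_state M W G V i X" for X
  proof -
    have "linear_process M W T X \<and> (\<exists>D. state_equation M W G X D \<and> (\<forall>k. L2_process M {0..T} (D k)))"
      using X
    proof
      assume "X = Xbase"
      then show ?thesis
        using assms(3) unfolding baseline_profile_def T_def linear_process_def by blast
    next
      assume "deviated_state M W G V i X"
      then obtain D where D: "linear_process M W T (D i)" "\<And>k. k \<noteq> i \<Longrightarrow> frozen_response M W G V k X (D k)"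
        "state_equation M W G X D" and lin: "linear_process M W T X"
        unfolding deviated_state_def T_def by blast
      have "L2_process M {0..T} (D k)" for k
      proof (cases "k = i")
        case True
        then show ?thesis using D(1) by (auto simp: linear_process_def linear_process_with_def)
      next
        case False
        from D(2)[OF this] show ?thesis unfolding frozen_response_def Let_def T_def by blast
      qed
      with D(3) lin show ?thesis by blast
    qed
    then obtain D where lin: "linear_process M W T X"
      and D: "state_equation M W G X D" "\<And>k. L2_process M {0..T} (D k)"
      by blast
    have "L2_process M {0..T} X" using lin by (auto simp: linear_process_def linear_process_with_def)
    with game lin show ?thesis
      using state_msq_bound[OF D(1) _ _ _ _ D(2)] by (auto simp: T_def)
  qed
  show ?thesis
    by (intro allI impI)
      (rule backward_system_solution[OF env cost state[THEN conjunct1] state[THEN conjunct2]])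
qed

end
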